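(* Let $\sigma\in(0,1)$, $\beta>0$, $c>0$, $r>0$, let $\Theta\sim\mathrm{SBSP}(\beta,\sigma,c)$, and let $Z_1,Z_2,\dots\mid\Theta$ be i.i.d. $\mathrm{NBP}(\Theta,r)$. Let $D_0,D_1,j\ge1$ be integers, let $0<N_{D_0}<\infty$ be the number of distinct units observed in $Z_{1:D_0}=(Z_1,\dots,Z_{D_0})$, and let $$U_{D_0}^{(D_1,j)}=\sum_{n\ge1}\mathbf 1\left(\sum_{d=1}^{D_0}A_{d,n}=0\right)\mathbf 1\left(\sum_{d=1}^{D_1}A_{D_0+d,n}=j\right)$$ be the number of units not observed in the first $D_0$ days whose total count over days $D_0+1,\dots,D_0+D_1$ is exactly $j$. Then $$U_{D_0}^{(D_1,j)}\mid Z_{1:D_0}\sim\mathrm{NegBin}\left(N_{D_0}+c+1,\ p_{D_0}^{(D_1,j)}\right),\qquad p_{D_0}^{(D_1,j)}=\frac{\rho_{D_0}^{(D_1,j)}}{\beta+\psi_0^{(D_0)}+\rho_{D_0}^{(D_1,j)}},$$ where $$\rho_{D_0}^{(D_1,j)}=\binom{j+rD_1-1}{j}\,\sigma\,B\left(r(D_0+D_1)+1,\ j-\sigma\right).$$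
   Context: Conventions. $\mathrm{NegBin}(a,p)$, for $a>0$ and $p\in(0,1)$, has mass function $x\mapsto\binom{x+a-1}{x}p^x(1-p)^a$ on $\{0,1,2,\dots\}$. $B(a,b)=\Gamma(a)\Gamma(b)/\Gamma(a+b)$, also for negative non-integer $b$. For $x,y\ge 0$, $\psi_x^{(y)}=\sigma\left[B(rx+1,-\sigma)-B(r(x+y)+1,-\sigma)\right]$. The prior $\mathrm{SBSP}(\beta,\sigma,c)$ (stable-beta scaled process). Let $\rho(s)=\sigma s^{-1-\sigma}\mathbf 1(s>0)$ and let $\Delta_0>\Delta_1>\cdots$ be the points, in decreasing order, of a Poisson point process on $\mathbb R_+$ with intensity $\rho(s)\,ds$. The density of $\Delta_0$ is $f_{\Delta_0}(s)=\sigma s^{-1-\sigma}e^{-s^{-\sigma}}\mathbf 1(s>0)$. Let $G_t$ be the conditional joint law of $(\Delta_n/\Delta_0)_{n\ge1}$ given $\Delta_0=t$. Let $h_{c,\beta}(s)=\frac{\beta^{c+1}}{\Gamma(c+1)}s^{-c\sigma}\exp\{-(\beta-1)s^{-\sigma}\}$. Let $\Delta_{0,h}$ have density $h_{c,\beta}(s)f_{\Delta_0}(s)$ and, given $\Delta_{0,h}=t$, let $(\theta_n)_{n\ge1}\sim G_t$. Let $\omega_1,\omega_2,\dots$ be i.i.d. from the uniform distribution $P_0$ on $\Omega=[0,1]$, independent of $(\Delta_{0,h},(\theta_n))$. Then $\Theta=\sum_{n\ge1}\theta_n\delta_{\omega_n}\sim\mathrm{SBSP}(\beta,\sigma,c)$.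 The likelihood. Given $\Theta=\sum_n\theta_n\delta_{\omega_n}$, $Z_d\sim\mathrm{NBP}(\Theta,r)$ means $Z_d=\sum_{n\ge1}A_{d,n}\delta_{\omega_n}$ with $A_{d,n}\sim\mathrm{NegBin}(r,\theta_n)$ independently across $n$. A unit is observed in $Z_{1:D_0}$ if it has a positive count on at least one of the days $1,\dots,D_0$. *)

theory Defs
  imports "HOL-Probability.Probability"
begin

abbreviation cond_prob_given ::
    "'a measure \<Rightarrow> ('a \<Rightarrow> 'b) \<Rightarrow> 'b measure \<Rightarrow> 'a set \<Rightarrow> 'a \<Rightarrow> real" where
  "cond_prob_given M X S E \<equiv> real_cond_exp M (vimage_algebra (space M) X S) (indicator E)"

text \<open>Given \<open>X = x\<close>, the variable \<open>Y\<close> has law \<open>\<kappa> x\<close>.  Measurability of \<open>\<kappa>\<close> is not part of this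
  definition; it is required separately where \<open>\<kappa>\<close> is not explicit.\<close>

definition has_cond_law ::
    "'a measure \<Rightarrow> ('a \<Rightarrow> 'b) \<Rightarrow> 'b measure \<Rightarrow> ('a \<Rightarrow> 'c) \<Rightarrow> 'c measure \<Rightarrow> ('b \<Rightarrow> 'c measure) \<Rightarrow> bool"
  where
  "has_cond_law M X S Y T \<kappa> \<longleftrightarrow>
     X \<in> measurable M S \<and> Y \<in> measurable M T \<and>
     (\<forall>E\<in>sets T. AE w in M.
        cond_prob_given M X S (Y -` E \<inter> space M) w = measure (\<kappa> (X w)) E)"

definition points_in :: "(nat \<Rightarrow> 'a \<Rightarrow> 'b) \<Rightarrow> 'b set \<Rightarrow> 'a \<Rightarrow> ennreal" where
  "points_in X B w = emeasure (count_space UNIV) {n. X n w \<in> B}"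

definition poisson_points :: "'a measure \<Rightarrow> 'b measure \<Rightarrow> (nat \<Rightarrow> 'a \<Rightarrow> 'b) \<Rightarrow> bool" where
  "poisson_points P \<mu> X \<longleftrightarrow>
     prob_space P \<and> (\<forall>n. X n \<in> measurable P \<mu>) \<and>
     (\<forall>B\<in>sets \<mu>. emeasure \<mu> B < \<infinity> \<longrightarrow>
        (\<forall>k::nat. measure P {w \<in> space P. points_in X B w = of_nat k}
           = measure \<mu> B ^ k / fact k * exp (- measure \<mu> B))) \<and>
     (\<forall>B\<in>sets \<mu>. emeasure \<mu> B = \<infinity> \<longrightarrow> (AE w in P. points_in X B w = \<infinity>)) \<and>
     (\<forall>B :: nat \<Rightarrow> 'b set. range B \<subseteq> sets \<mu> \<longrightarrow> disjoint_family B \<longrightarrow>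
        prob_space.indep_vars P (\<lambda>_. borel) (\<lambda>i. points_in X (B i)) UNIV)"

abbreviation real_seq :: "(nat \<Rightarrow> real) measure" where
  "real_seq \<equiv> Pi\<^sub>M UNIV (\<lambda>_. borel)"

definition stable_intensity :: "real \<Rightarrow> real measure" where
  "stable_intensity \<sigma> = density lborel (\<lambda>s. ennreal (\<sigma> * s powr (- 1 - \<sigma>) * indicator {0<..} s))"

definition f_jump :: "real \<Rightarrow> real \<Rightarrow> real" where
  "f_jump \<sigma> s = \<sigma> * s powr (- 1 - \<sigma>) * exp (- (s powr (- \<sigma>))) * indicator {0<..} s"

definition h_tilt :: "real \<Rightarrow> real \<Rightarrow> real \<Rightarrow> real \<Rightarrow> real" where
  "h_tilt \<sigma> c \<beta> s =
     \<beta> powr (c + 1) / Gamma (c + 1) * s powr (- c * \<sigma>) * exp (- (\<beta> - 1) * s powr (- \<sigma>))"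

text \<open>\<open>G\<close> is a regular version of the conditional law of \<open>(\<Delta>\<^sub>n / \<Delta>\<^sub>0)\<^sub>n\<^sub>\<ge>\<^sub>1\<close> given \<open>\<Delta>\<^sub>0\<close>.
  Such a law is determined up to a null set of values of \<open>\<Delta>\<^sub>0\<close>.
  Every law of a sequence \<open>\<Delta>\<close> is realised on the space of real sequences, so \<open>P\<close> may be taken there.
  Sequences indexed by \<open>n \<ge> 1\<close> on paper are shifted to start at index \<open>0\<close>.\<close>

definition ratio_kernel :: "real \<Rightarrow> (real \<Rightarrow> (nat \<Rightarrow> real) measure) \<Rightarrow> bool" where
  "ratio_kernel \<sigma> G \<longleftrightarrow>
     G \<in> measurable borel (prob_algebra real_seq) \<and>
     (\<exists>(P :: (nat \<Rightarrow> real) measure) \<Delta>.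
        poisson_points P (stable_intensity \<sigma>) \<Delta> \<and>
        (AE w in P. \<forall>n. \<Delta> (Suc n) w < \<Delta> n w) \<and>
        has_cond_law P (\<Delta> 0) borel (\<lambda>w n. \<Delta> (Suc n) w / \<Delta> 0 w) real_seq G)"

abbreviation label_law :: "real measure" where
  "label_law \<equiv> restrict_space lborel {0..1}"

abbreviation label_seq :: "(nat \<Rightarrow> real) measure" where
  "label_seq \<equiv> Pi\<^sub>M UNIV (\<lambda>_. label_law)"

text \<open>The atoms \<open>\<theta>\<close> and locations \<open>\<omega>\<close> are a series representation of an SBSP random measure
  \<open>\<Theta> = \<Sum>\<^sub>n \<theta>\<^sub>n \<delta>(\<omega>\<^sub>n)\<close>, with \<open>D\<close> in the role of \<open>\<Delta>\<^bsub>0,h\<^esub>\<close>.\<close>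

definition sbsp_series ::
    "'a measure \<Rightarrow> real \<Rightarrow> real \<Rightarrow> real \<Rightarrow> ('a \<Rightarrow> real) \<Rightarrow> (nat \<Rightarrow> 'a \<Rightarrow> real) \<Rightarrow> (nat \<Rightarrow> 'a \<Rightarrow> real) \<Rightarrow> bool"
  where
  "sbsp_series M \<beta> \<sigma> c D \<theta> \<omega> \<longleftrightarrow>
     distributed M lborel D (\<lambda>s. ennreal (h_tilt \<sigma> c \<beta> s * f_jump \<sigma> s)) \<and>
     (\<exists>G. ratio_kernel \<sigma> G \<and> has_cond_law M D borel (\<lambda>w n. \<theta> n w) real_seq G) \<and>
     (\<forall>n. \<omega> n \<in> measurable M label_law \<and> distr M label_law (\<omega> n) = label_law) \<and>
     prob_space.indep_vars M (\<lambda>_. label_law) \<omega> UNIV \<and>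
     prob_space.indep_set M
       (sets (vimage_algebra (space M) (\<lambda>w. (D w, \<lambda>n. \<theta> n w)) (borel \<Otimes>\<^sub>M real_seq)))
       (sets (vimage_algebra (space M) (\<lambda>w n. \<omega> n w) label_seq))"

definition negbin_pmf :: "real \<Rightarrow> real \<Rightarrow> nat pmf" where
  "negbin_pmf a p = embed_pmf (\<lambda>x. ((real x + a - 1) gchoose x) * p ^ x * (1 - p) powr a)"

lemma pmf_negbin:
  assumes "0 < a" "0 < p" "p < 1"
  shows "pmf (negbin_pmf a p) x = ((real x + a - 1) gchoose x) * p ^ x * (1 - p) powr a"
proof -
  let ?f = "\<lambda>x::nat. ((real x + a - 1) gchoose x) * p ^ x * (1 - p) powr a"
  have nn: "0 \<le> ?f x" for x
  proof -
    have "((real x + a - 1) gchoose x) = pochhammer a x / fact x"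
      unfolding gbinomial_pochhammer'
      by (rule arg_cong2[where f = "\<lambda>u v. pochhammer u x / v"]) simp_all
    then show ?thesis
      using assms by (simp add: pochhammer_nonneg)
  qed
  have neg: "((-a) gchoose n) * (-p)^n = ((real n + a - 1) gchoose n) * p ^ n" for n
  proof -
    have "(-p)^n = (-1)^n * p^n"
      by (rule power_minus)
    moreover have "(-1::real)^n * (-1)^n = 1"
      by (metis minus_one_mult_self)
    ultimately show ?thesis
      unfolding gbinomial_minus by (simp add: add.commute mult.left_commute)
  qed
  have "(\<lambda>n. ((-a) gchoose n) * (-p)^n) sums (1 + (-p)) powr (-a)"
    using assms by (intro gen_binomial_real) auto
  then have "?f sums ((1 + (-p)) powr (-a) * (1 - p) powr a)"
    unfolding neg by (rule sums_mult2)
  moreover have "(1 + (-p)) powr (-a) * (1 - p) powr a = 1"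
    using assms by (simp add: powr_minus)
  ultimately have sums: "?f sums 1"
    by (simp only:)
  have "(\<integral>\<^sup>+x. ennreal (?f x) \<partial>count_space UNIV) = (\<Sum>x. ennreal (?f x))"
    by (rule nn_integral_count_space_nat)
  also have "\<dots> = ennreal (\<Sum>x. ?f x)"
    using nn sums by (intro suminf_ennreal2) (auto simp: sums_iff)
  also have "\<dots> = 1"
    using sums by (simp add: sums_iff)
  finally show ?thesis
    unfolding negbin_pmf_def using nn by (intro pmf_embed_pmf)
qed

definition nbp_counts :: "real \<Rightarrow> (nat \<Rightarrow> real) \<Rightarrow> (nat \<Rightarrow> nat) measure" where
  "nbp_counts r t = Pi\<^sub>M UNIV (\<lambda>n. measure_pmf (negbin_pmf r (t n)))"

text \<open>Given \<open>\<Theta>\<close>, i.e. the sequences of atoms and locations, the counts of the days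
  \<open>d = 1, 2, \<dots>\<close> are i.i.d.  The row \<open>A 0\<close> is not used.\<close>

definition iid_nbp ::
    "'a measure \<Rightarrow> real \<Rightarrow> (nat \<Rightarrow> 'a \<Rightarrow> real) \<Rightarrow> (nat \<Rightarrow> 'a \<Rightarrow> real) \<Rightarrow> (nat \<Rightarrow> nat \<Rightarrow> 'a \<Rightarrow> nat) \<Rightarrow> bool"
  where
  "iid_nbp M r \<theta> \<omega> A \<longleftrightarrow>
     has_cond_law M
       (\<lambda>w. (\<lambda>n. \<theta> n w, \<lambda>n. \<omega> n w)) (real_seq \<Otimes>\<^sub>M label_seq)
       (\<lambda>w. \<lambda>d\<in>{1..}. \<lambda>n. A d n w) (Pi\<^sub>M {1..} (\<lambda>_. Pi\<^sub>M UNIV (\<lambda>_. count_space UNIV)))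
       (\<lambda>(t, x). Pi\<^sub>M {1..} (\<lambda>_. nbp_counts r t))"

text \<open>This is \<open>\<Sum>\<^sub>n a\<^sub>n \<delta>(x\<^sub>n)\<close> on \<open>S\<close>.\<close>

definition atomic_measure :: "'b measure \<Rightarrow> (nat \<Rightarrow> ennreal) \<Rightarrow> (nat \<Rightarrow> 'b) \<Rightarrow> 'b measure" where
  "atomic_measure S a x = distr (density (count_space UNIV) a) S x"

lemma emeasure_atomic_measure:
  assumes "\<And>n. x n \<in> space S" "B \<in> sets S"
  shows "emeasure (atomic_measure S a x) B = (\<Sum>n. a n * indicator B (x n))"
proof -
  have "emeasure (atomic_measure S a x) B = (\<integral>\<^sup>+n. a n * indicator (x -` B) n \<partial>count_space UNIV)"
    using assms by (simp add: atomic_measure_def emeasure_distr emeasure_density)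
  also have "\<dots> = (\<Sum>n. a n * indicator B (x n))"
    by (subst nn_integral_count_space_nat) (simp add: indicator_def)
  finally show ?thesis .
qed

text \<open>The evaluation \<open>\<sigma>\<close>-algebra on the set of all measures on \<open>K\<close>; cf. \<^const>\<open>subprob_algebra\<close>.\<close>

definition measure_algebra :: "'b measure \<Rightarrow> 'b measure measure" where
  "measure_algebra K =
     (SUP B\<in>sets K. vimage_algebra {\<nu>. sets \<nu> = sets K} (\<lambda>\<nu>. emeasure \<nu> B) borel)"

definition nbp_day ::
    "(nat \<Rightarrow> 'a \<Rightarrow> real) \<Rightarrow> (nat \<Rightarrow> nat \<Rightarrow> 'a \<Rightarrow> nat) \<Rightarrow> nat \<Rightarrow> 'a \<Rightarrow> real measure" where
  "nbp_day \<omega> A d w = atomic_measure label_law (\<lambda>n. of_nat (A d n w)) (\<lambda>n. \<omega> n w)"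

definition observed_units :: "(nat \<Rightarrow> 'a \<Rightarrow> real measure) \<Rightarrow> nat \<Rightarrow> 'a \<Rightarrow> real set" where
  "observed_units Z D0 w = {x \<in> space label_law. \<exists>d\<in>{1..D0}. 0 < emeasure (Z d w) {x}}"

definition new_units :: "(nat \<Rightarrow> nat \<Rightarrow> 'a \<Rightarrow> nat) \<Rightarrow> nat \<Rightarrow> nat \<Rightarrow> nat \<Rightarrow> 'a \<Rightarrow> ennreal" where
  "new_units A D0 D1 j w =
     (\<Sum>n. of_bool ((\<Sum>d=1..D0. A d n w) = 0) * of_bool ((\<Sum>d=1..D1. A (D0 + d) n w) = j))"

definition psi :: "real \<Rightarrow> real \<Rightarrow> real \<Rightarrow> real \<Rightarrow> real" where
  "psi \<sigma> r x y = \<sigma> * (Beta (r * x + 1) (- \<sigma>) - Beta (r * (x + y) + 1) (- \<sigma>))"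

definition rho :: "real \<Rightarrow> real \<Rightarrow> nat \<Rightarrow> nat \<Rightarrow> nat \<Rightarrow> real" where
  "rho \<sigma> r D0 D1 j =
     ((real j + r * real D1 - 1) gchoose j) * \<sigma> * Beta (r * real (D0 + D1) + 1) (real j - \<sigma>)"

definition p_new :: "real \<Rightarrow> real \<Rightarrow> real \<Rightarrow> nat \<Rightarrow> nat \<Rightarrow> nat \<Rightarrow> real" where
  "p_new \<beta> \<sigma> r D0 D1 j =
     rho \<sigma> r D0 D1 j / (\<beta> + psi \<sigma> r 0 (real D0) + rho \<sigma> r D0 D1 j)"

end

theory Submission
  imports Defs
begin

text \<open>
  Multiply over all units a weight that depends on the label and the daily counts of the unit.  With
  \<open>\<gamma> = D\<^sup>-\<^sup>\<sigma>\<close>, the expectation of such a product given \<open>D\<close> is \<open>exp (- \<gamma> \<kappa>)\<close>, where \<open>\<kappa>\<close> is the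
  integral of one minus the mean weight against the stable intensity on \<open>(0, 1)\<close>; as \<open>\<gamma>\<close> is
  Gamma distributed, the expectation is \<open>(\<beta> / (\<beta> + \<kappa>))\<^sup>c\<^sup>+\<^sup>1\<close>.  A suitable weight makes this the joint
  generating function of the new units (variable \<open>u\<close>), of the number of observed units
  (variable \<open>v\<close>) and of the counts observed in any finite family of sets of labels, with
  \<open>\<kappa> = \<psi> + (1 - u) \<rho> - v K\<close> and \<open>K\<close> depending only on the observed counts.  Replacing \<open>u\<close> by the
  generating function of the negative binomial law amounts to the choice \<open>u = 1\<close>,
  \<open>v = (1 - p) / (1 - p u)\<close>, up to the factor \<open>v\<^sup>c\<^sup>+\<^sup>1\<close>, and gives the same value.  Coefficients of
  generating functions are unique, so the two sides agree on all events generated by the observed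
  counts.
\<close>

text \<open>The observed days are random measures whose atoms carry no order, so the conditioning is
  on the masses they give to label sets, not on the array \<open>A\<close>. Working with generating
  functions of such masses avoids describing the posterior law of the atoms. Two obstacles shape the
  intermediate results. The law \<open>G\<close> of the ratios is fixed only up to null sets of the
  largest point, while a Poisson process is known only through its counts; the Laplace functional
  must therefore be disintegrated along \<open>\<Delta> 0\<close>. And the formula for
  \<open>negbin_pmf\<close> holds only for parameters in (0, 1), so the kernel in
  \<open>iid_nbp\<close> is not known to be measurable; counts are summed array by array over a
  countable set. The value of \<open>p\<close> is forced: \<open>(1 - p) / (1 - p * u)\<close> must
  be the ratio of \<open>\<beta> + \<psi>\<close> to
  \<open>\<beta> + \<psi> + (1 - u) * \<rho>\<close>. The size parameter collects one factor
  \<open>v\<close> per observed unit, plus \<open>c + 1\<close>, the shape of the Gamma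
  variable.\<close>

section \<open>Infinite products and generating functions\<close>

text \<open>Unlike \<^const>\<open>prodinf\<close>, this is meaningful for products that converge to \<open>0\<close>.\<close>

definition iprod :: "(nat \<Rightarrow> real) \<Rightarrow> real" where
  "iprod a = lim (\<lambda>N. \<Prod>i<N. a i)"

lemma prod_in_unit_interval:
  fixes a :: "'i \<Rightarrow> real"
  assumes "\<And>i. i \<in> I \<Longrightarrow> a i \<in> {0..1}"
  shows "(\<Prod>i\<in>I. a i) \<in> {0..1}"
  using assms by (auto intro!: prod_nonneg prod_le_1)

lemma iprod_LIMSEQ:
  assumes a: "\<And>i. a i \<in> {0..1}"
  shows "(\<lambda>N. \<Prod>i<N. a i) \<longlonglongrightarrow> iprod a"
proof -
  have "decseq (\<lambda>N. \<Prod>i<N. a i)"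
    using a prod_in_unit_interval[of _ a] by (intro decseq_SucI) (auto intro!: mult_left_le)
  moreover have "0 \<le> (\<Prod>i<N. a i)" for N
    using a by (auto intro!: prod_nonneg)
  ultimately obtain L where "(\<lambda>N. \<Prod>i<N. a i) \<longlonglongrightarrow> L"
    by (metis decseq_convergent)
  then show ?thesis
    unfolding iprod_def by (simp add: limI)
qed

lemma iprod_le_prod:
  assumes a: "\<And>i. a i \<in> {0..1}"
  shows "iprod a \<le> (\<Prod>i<N. a i)"
proof -
  have "decseq (\<lambda>N. \<Prod>i<N. a i)"
    using a prod_in_unit_interval[of _ a] by (intro decseq_SucI) (auto intro!: mult_left_le)
  from decseq_ge[OF this iprod_LIMSEQ[OF a]] show ?thesis .
qed

lemma iprod_in_unit_interval:
  assumes a: "\<And>i. a i \<in> {0..1}"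
  shows "iprod a \<in> {0..1}"
proof -
  have "0 \<le> iprod a"
    using a by (intro LIMSEQ_le_const[OF iprod_LIMSEQ[OF a]]) (auto intro!: prod_nonneg)
  moreover have "iprod a \<le> (\<Prod>i<0::nat. a i)"
    by (rule iprod_le_prod[OF a])
  ultimately show ?thesis
    by simp
qed

lemma borel_measurable_iprod [measurable (raw)]:
  assumes [measurable]: "\<And>i. (\<lambda>x. a x i) \<in> borel_measurable M"
  shows "(\<lambda>x. iprod (a x)) \<in> borel_measurable M"
  unfolding iprod_def by measurable

lemma iprod_mult:
  assumes "\<And>i. a i \<in> {0..1}" "\<And>i. b i \<in> {0..1}"
  shows "iprod (\<lambda>i. a i * b i) = iprod a * iprod b"
proof -
  have "(\<lambda>N. \<Prod>i<N. a i * b i) \<longlonglongrightarrow> iprod a * iprod b"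
    unfolding prod.distrib by (intro tendsto_mult iprod_LIMSEQ assms)
  then show ?thesis
    unfolding iprod_def[of "\<lambda>i. a i * b i"] by (rule limI)
qed

lemma iprod_Suc:
  assumes "\<And>i. a i \<in> {0..1}"
  shows "iprod a = a 0 * iprod (\<lambda>i. a (Suc i))"
proof -
  have "(\<lambda>N. a 0 * (\<Prod>i<N. a (Suc i))) \<longlonglongrightarrow> a 0 * iprod (\<lambda>i. a (Suc i))"
    by (intro tendsto_mult iprod_LIMSEQ assms tendsto_const)
  then have "(\<lambda>N. \<Prod>i<Suc N. a i) \<longlonglongrightarrow> a 0 * iprod (\<lambda>i. a (Suc i))"
    by (simp only: prod.lessThan_Suc_shift o_def)
  then show ?thesis
    unfolding iprod_def[of a] using filterlim_sequentially_Suc limI by blast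
qed

lemma iprod_eq_prod:
  assumes "finite S" "\<And>i. i \<notin> S \<Longrightarrow> a i = 1"
  shows "iprod a = (\<Prod>i\<in>S. a i)"
proof -
  obtain N where N: "S \<subseteq> {..<N}"
    using assms(1) finite_nat_bounded by blast
  have "(\<Prod>i<n. a i) = (\<Prod>i\<in>S. a i)" if "n \<ge> N" for n
    using N that assms(2) by (intro prod.mono_neutral_right) auto
  then have "\<forall>\<^sub>F n in sequentially. (\<Prod>i<n. a i) = (\<Prod>i\<in>S. a i)"
    unfolding eventually_sequentially by blast
  then have "(\<lambda>n. \<Prod>i<n. a i) \<longlonglongrightarrow> (\<Prod>i\<in>S. a i)"
    by (rule tendsto_eventually)
  then show ?thesis
    unfolding iprod_def by (rule limI)
qed

lemma iprod_const_1 [simp]: "iprod (\<lambda>i. 1) = 1"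
  using iprod_eq_prod[of "{}" "\<lambda>_. 1"] by simp

lemma iprod_zero:
  assumes a: "\<And>i. a i \<in> {0..1}" and "a n = 0"
  shows "iprod a = 0"
proof -
  have "iprod a \<le> (\<Prod>i<Suc n. a i)"
    by (rule iprod_le_prod[OF a])
  also have "\<dots> = 0"
    using \<open>a n = 0\<close> by simp
  finally show ?thesis
    using iprod_in_unit_interval[of a, OF a] by simp
qed

text \<open>Any \<open>k\<close> of the small factors already bound the product by
  \<open>c ^ k\<close>. Through this, configurations with infinitely many observed or new units
  contribute nothing to the generating function, which later yields almost sure finiteness.\<close>

lemma iprod_infinite_eq_0:
  assumes a: "\<And>i. a i \<in> {0..1}" and S: "infinite S" "\<And>i. i \<in> S \<Longrightarrow> a i \<le> c" and c: "c < 1"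
  shows "iprod a = 0"
proof -
  have c0: "0 \<le> c"
    using a S by (metis atLeastAtMost_iff infinite_imp_nonempty order_trans ex_in_conv)
  have "iprod a \<le> c ^ k" for k
  proof -
    obtain T where T: "finite T" "card T = k" "T \<subseteq> S"
      using S(1) infinite_arbitrarily_large by blast
    obtain N where N: "T \<subseteq> {..<N}"
      using T(1) finite_nat_bounded by blast
    have "iprod a \<le> (\<Prod>i<N. a i)"
      by (rule iprod_le_prod[OF a])
    also have "\<dots> \<le> (\<Prod>i<N. if i \<in> T then c else 1)"
      using a T S by (intro prod_mono) auto
    also have "\<dots> = (\<Prod>i\<in>T. c)"
      using N by (subst prod.inter_restrict[symmetric]) (auto simp: Int_absorb1)
    finally show ?thesis
      using T by simp
  qed
  moreover have "(\<lambda>k. c ^ k) \<longlonglongrightarrow> 0"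
    using c0 c by (intro LIMSEQ_power_zero) auto
  ultimately have "iprod a \<le> 0"
    by (meson LIMSEQ_le_const)
  then show ?thesis
    using iprod_in_unit_interval[of a, OF a] by simp
qed

text \<open>Domination gives the lower bound and a finite partial product the upper bound.
  Approximation from above is essential: if \<open>b k i\<close> is 0 for \<open>i = k\<close> and 1
  otherwise, every factor tends to 1 but every product is 0.\<close>

lemma iprod_tendsto_above:
  assumes a: "\<And>i. a i \<in> {0..1}" and b: "\<And>k i. b k i \<in> {0..1}"
    and ge: "\<And>k i. a i \<le> b k i" and lim: "\<And>i. (\<lambda>k. b k i) \<longlonglongrightarrow> a i"
  shows "(\<lambda>k. iprod (b k)) \<longlonglongrightarrow> iprod a"
proof (rule order_tendstoI)
  fix y assume "y < iprod a"
  moreover have "iprod a \<le> iprod (b k)" for k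
    using a b by (intro LIMSEQ_le[OF iprod_LIMSEQ[OF a] iprod_LIMSEQ[OF b]] exI allI impI prod_mono)
      (auto simp: ge)
  ultimately show "\<forall>\<^sub>F k in sequentially. y < iprod (b k)"
    by (auto intro!: always_eventually intro: less_le_trans)
next
  fix y assume "iprod a < y"
  then have "\<forall>\<^sub>F N in sequentially. (\<Prod>i<N. a i) < y"
    by (rule order_tendstoD(2)[OF iprod_LIMSEQ[OF a]])
  then obtain N where N: "(\<Prod>i<N. a i) < y"
    by (auto simp: eventually_sequentially)
  have "(\<lambda>k. \<Prod>i<N. b k i) \<longlonglongrightarrow> (\<Prod>i<N. a i)"
    by (intro tendsto_prod lim)
  then have "\<forall>\<^sub>F k in sequentially. (\<Prod>i<N. b k i) < y"
    using N by (rule order_tendstoD(2))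
  moreover have "iprod (b k) \<le> (\<Prod>i<N. b k i)" for k
    using b by (rule iprod_le_prod)
  ultimately show "\<forall>\<^sub>F k in sequentially. iprod (b k) < y"
    by (auto elim!: eventually_mono intro: le_less_trans)
qed

lemma (in finite_measure) integral_iprod_LIMSEQ:
  assumes [measurable]: "\<And>i. (\<lambda>x. a x i) \<in> borel_measurable M"
    and a: "\<And>x i. x \<in> space M \<Longrightarrow> a x i \<in> {0..1}"
  shows "(\<lambda>N. \<integral>x. (\<Prod>i<N. a x i) \<partial>M) \<longlonglongrightarrow> (\<integral>x. iprod (a x) \<partial>M)"
proof (rule integral_dominated_convergence)
  show "AE x in M. norm (\<Prod>i<N. a x i) \<le> 1" for N
  proof (rule AE_I2)
    fix x assume "x \<in> space M"
    then have "(\<Prod>i<N. a x i) \<in> {0..1}"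
      by (intro prod_in_unit_interval a)
    then show "norm (\<Prod>i<N. a x i) \<le> 1"
      by simp
  qed
  show "AE x in M. (\<lambda>N. \<Prod>i<N. a x i) \<longlonglongrightarrow> iprod (a x)"
    using a by (auto intro!: AE_I2 iprod_LIMSEQ)
qed auto

section \<open>Uniqueness of coefficients and of weighted laws\<close>

lemma power_series_coeffs_eq_0:
  fixes d :: "nat \<Rightarrow> real"
  assumes C: "\<And>k. \<bar>d k\<bar> \<le> C" and 0: "\<And>u. 0 < u \<Longrightarrow> u < 1 \<Longrightarrow> (\<lambda>k. d k * u ^ k) sums 0"
  shows "d k = 0"
proof (induction k rule: less_induct)
  case (less k)
  \<comment> \<open>As the lower coefficients vanish, dividing the series by \<open>u ^ k\<close>
    exhibits \<open>d k\<close> as minus a tail of size at most \<open>C * u / (1 - u)\<close>,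
    which disappears as \<open>u\<close> tends to 0 from the right.\<close>
  have "\<bar>d k\<bar> * (1 - u) \<le> C * u" if u: "0 < u" "u < 1" for u
  proof -
    have "(\<lambda>i. d (i + k) * u ^ (i + k)) sums (0 - (\<Sum>i<k. d i * u ^ i))"
      by (rule sums_split_initial_segment[OF 0[OF u]])
    then have "(\<lambda>i. inverse (u ^ k) * (d (i + k) * u ^ (i + k))) sums (inverse (u ^ k) * 0)"
      using less by (intro sums_mult) simp
    then have "(\<lambda>i. d (i + k) * u ^ i) sums 0"
      using u by (simp add: power_add field_simps)
    then have s: "(\<lambda>i. d (Suc i + k) * u ^ Suc i) sums (- d k)"
      using sums_Suc_iff[of "\<lambda>i. d (i + k) * u ^ i" "- d k"] by simp
    have g: "(\<lambda>i. C * u * u ^ i) sums (C * u * (1 / (1 - u)))"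
      using u by (intro sums_mult geometric_sums) auto
    have "\<bar>d k\<bar> \<le> C * u * (1 / (1 - u))"
    proof -
      have "norm (\<Sum>i. d (Suc i + k) * u ^ Suc i) \<le> (\<Sum>i. C * u * u ^ i)"
        using g u C by (intro norm_suminf_le) (auto simp: sums_iff abs_mult mult_right_mono)
      then show ?thesis
        using s g by (simp only: sums_iff) simp
    qed
    then show ?thesis
      using u by (simp add: field_simps)
  qed
  then have ev: "\<forall>\<^sub>F u in at_right 0. \<bar>d k\<bar> * (1 - u) \<le> C * u"
    unfolding eventually_at_right_field by (intro exI[of _ 1]) auto
  have "((\<lambda>u. \<bar>d k\<bar> * (1 - u)) \<longlongrightarrow> \<bar>d k\<bar> * (1 - 0)) (at_right 0)"
    "((\<lambda>u. C * u) \<longlongrightarrow> C * 0) (at_right 0)"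
    by (intro tendsto_intros)+
  then have "\<bar>d k\<bar> * (1 - 0) \<le> C * 0"
    using ev by (intro tendsto_le[of "at_right (0::real)"]) auto
  then show ?case
    by simp
qed

lemma power_series_coeffs_unique:
  fixes a b :: "nat \<Rightarrow> real"
  assumes "\<And>k. \<bar>a k\<bar> \<le> C" "\<And>k. \<bar>b k\<bar> \<le> C"
    and "\<And>u. 0 < u \<Longrightarrow> u < 1 \<Longrightarrow> (\<lambda>k. a k * u ^ k) sums s u"
    and "\<And>u. 0 < u \<Longrightarrow> u < 1 \<Longrightarrow> (\<lambda>k. b k * u ^ k) sums s u"
  shows "a k = b k"
proof -
  have "a k - b k = 0"
  proof (rule power_series_coeffs_eq_0[where C = "2 * C"])
    show "\<bar>a k - b k\<bar> \<le> 2 * C" for k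
      using assms(1,2)[of k] by linarith
    show "(\<lambda>k. (a k - b k) * u ^ k) sums 0" if "0 < u" "u < 1" for u
      using sums_diff[OF assms(3,4)[OF that]] by (simp add: left_diff_distrib)
  qed
  then show ?thesis
    by simp
qed

text \<open>Splits an integral along the values of \<open>X\<close>. With \<open>c k = u ^ k\<close>
  the sum is a generating function, with \<open>c\<close> an indicator it is the weight of an event;
  both readings are used below.\<close>

lemma sums_integral_nat_fibres:
  fixes W :: "'a \<Rightarrow> real" and c :: "nat \<Rightarrow> real"
  assumes [measurable]: "integrable M W" "X \<in> M \<rightarrow>\<^sub>M count_space UNIV"
    and c: "\<And>k. \<bar>c k\<bar> \<le> 1"
  shows "(\<lambda>k. (\<integral>x. W x * indicator {k} (X x) \<partial>M) * c k) sums (\<integral>x. W x * c (X x) \<partial>M)"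
proof -
  let ?f = "\<lambda>k x. W x * indicator {k} (X x) * c k"
  have int: "integrable M (?f k)" for k
    using assms(1) by (rule Bochner_Integration.integrable_bound)
      (use c in \<open>auto simp: abs_mult indicator_def intro!: AE_I2 mult_left_le\<close>)
  have fin: "(\<lambda>k. ?f k x) sums (W x * c (X x))" for x
  proof -
    have "(\<lambda>k. ?f k x) sums (\<Sum>k\<in>{X x}. ?f k x)"
      by (rule sums_finite) (auto simp: indicator_def)
    then show ?thesis by simp
  qed
  have finn: "(\<lambda>k. norm (?f k x)) sums (norm (W x * c (X x)))" for x
  proof -
    have "(\<lambda>k. norm (?f k x)) sums (\<Sum>k\<in>{X x}. norm (?f k x))"
      by (rule sums_finite) (auto simp: indicator_def)
    then show ?thesis by simp
  qed
  have int2: "integrable M (\<lambda>x. W x * c (X x))"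
    using assms(1) by (rule Bochner_Integration.integrable_bound)
      (use c in \<open>auto simp: abs_mult intro!: AE_I2 mult_left_le\<close>)
  have summ: "summable (\<lambda>k. \<integral>x. norm (?f k x) \<partial>M)"
  proof (rule bounded_imp_summable)
    show "0 \<le> (\<integral>x. norm (?f k x) \<partial>M)" for k by simp
    show "(\<Sum>k\<le>n. \<integral>x. norm (?f k x) \<partial>M) \<le> (\<integral>x. norm (W x * c (X x)) \<partial>M)" for n
    proof -
      have "(\<Sum>k\<le>n. \<integral>x. norm (?f k x) \<partial>M) = (\<integral>x. (\<Sum>k\<le>n. norm (?f k x)) \<partial>M)"
        using int by (intro Bochner_Integration.integral_sum[symmetric] integrable_norm)
      also have "\<dots> \<le> (\<integral>x. norm (W x * c (X x)) \<partial>M)"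
      proof (rule integral_mono)
        show "integrable M (\<lambda>x. \<Sum>k\<le>n. norm (?f k x))"
          using int by (intro Bochner_Integration.integrable_sum integrable_norm)
        show "integrable M (\<lambda>x. norm (W x * c (X x)))"
          using int2 by (rule integrable_norm)
        show "(\<Sum>k\<le>n. norm (?f k x)) \<le> norm (W x * c (X x))" for x
          using finn[of x] sum_le_suminf[of "\<lambda>k. norm (?f k x)" "{..n}"] by (auto simp: sums_iff)
      qed
      finally show ?thesis .
    qed
  qed
  have "(\<lambda>k. \<integral>x. ?f k x \<partial>M) sums (\<integral>x. (\<Sum>k. ?f k x) \<partial>M)"
    using int finn summ by (intro sums_integral) (auto simp: sums_iff)
  then show ?thesis
    using fin by (simp add: sums_iff)
qed

lemma pgf_determines_weighted_law:
  fixes W1 :: "'a \<Rightarrow> real" and W2 :: "'b \<Rightarrow> real"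
  assumes W: "integrable M1 W1" "integrable M2 W2"
    and X: "X1 \<in> M1 \<rightarrow>\<^sub>M count_space UNIV" "X2 \<in> M2 \<rightarrow>\<^sub>M count_space UNIV"
    and eq: "\<And>u::real. 0 < u \<Longrightarrow> u < 1 \<Longrightarrow>
      (\<integral>x. W1 x * u ^ X1 x \<partial>M1) = (\<integral>x. W2 x * u ^ X2 x \<partial>M2)"
  shows "(\<integral>x. W1 x * indicator C (X1 x) \<partial>M1) = (\<integral>x. W2 x * indicator C (X2 x) \<partial>M2)"
proof -
  let ?a = "\<lambda>k. \<integral>x. W1 x * indicator {k} (X1 x) \<partial>M1"
  let ?b = "\<lambda>k. \<integral>x. W2 x * indicator {k} (X2 x) \<partial>M2"
  have bound: "\<bar>\<integral>x. W x * indicator {k} (X x) \<partial>M\<bar> \<le> (\<integral>x. \<bar>W x\<bar> \<partial>M)"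
    if "integrable M W" "X \<in> M \<rightarrow>\<^sub>M count_space UNIV"
    for M :: "'c measure" and W :: "'c \<Rightarrow> real" and X :: "'c \<Rightarrow> nat" and k
  proof -
    have "norm (\<integral>x. W x * indicator {k} (X x) \<partial>M) \<le> (\<integral>x. norm (W x * indicator {k} (X x)) \<partial>M)"
      by (rule integral_norm_bound)
    also have "\<dots> \<le> (\<integral>x. \<bar>W x\<bar> \<partial>M)"
      using that by (intro integral_mono_AE') (auto simp: indicator_def)
    finally show ?thesis by simp
  qed
  have "?a k = ?b k" for k
  proof (rule power_series_coeffs_unique[where C = "max (\<integral>x. \<bar>W1 x\<bar> \<partial>M1) (\<integral>x. \<bar>W2 x\<bar> \<partial>M2)"])
    show "\<bar>?a k\<bar> \<le> max (\<integral>x. \<bar>W1 x\<bar> \<partial>M1) (\<integral>x. \<bar>W2 x\<bar> \<partial>M2)" for k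
      using bound[OF W(1) X(1)] by (simp add: le_max_iff_disj)
    show "\<bar>?b k\<bar> \<le> max (\<integral>x. \<bar>W1 x\<bar> \<partial>M1) (\<integral>x. \<bar>W2 x\<bar> \<partial>M2)" for k
      using bound[OF W(2) X(2)] by (simp add: le_max_iff_disj)
    fix u :: real assume u: "0 < u" "u < 1"
    show "(\<lambda>k. ?a k * u ^ k) sums (\<integral>x. W1 x * u ^ X1 x \<partial>M1)"
      using u by (intro sums_integral_nat_fibres W X) (simp add: power_le_one)
    show "(\<lambda>k. ?b k * u ^ k) sums (\<integral>x. W1 x * u ^ X1 x \<partial>M1)"
      unfolding eq[OF u] using u by (intro sums_integral_nat_fibres W X) (simp add: power_le_one)
  qed
  then have "(\<lambda>k. ?a k * indicator C k) = (\<lambda>k. ?b k * indicator C k)"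
    by simp
  moreover have "(\<lambda>k. ?a k * indicator C k) sums (\<integral>x. W1 x * indicator C (X1 x) \<partial>M1)"
    by (intro sums_integral_nat_fibres W X) (simp add: indicator_def)
  moreover have "(\<lambda>k. ?b k * indicator C k) sums (\<integral>x. W2 x * indicator C (X2 x) \<partial>M2)"
    by (intro sums_integral_nat_fibres W X) (simp add: indicator_def)
  ultimately show ?thesis
    by (simp only: sums_iff)
qed

section \<open>Conditional laws\<close>

lemma (in prob_space) sigma_finite_subalgebra_vimage:
  assumes "X \<in> M \<rightarrow>\<^sub>M S"
  shows "sigma_finite_subalgebra M (vimage_algebra (space M) X S)"
proof (rule finite_measure_subalgebra_is_sigma_finite)
  have "sets (vimage_algebra (space M) X S) \<subseteq> sets M"
    using assms by (simp add: measurable_iff_sets)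
  then show "finite_measure_subalgebra M (vimage_algebra (space M) X S)"
    by unfold_locales (simp add: subalgebra_def)
qed

text \<open>The function \<open>g\<close> stands in for the kernel mass because no measurability of
  the kernel is assumed. For the counts, \<open>g\<close> will be built from the explicit mass
  function at clamped atoms.\<close>

lemma (in prob_space) has_cond_law_integral_mult_indicator:
  assumes law: "has_cond_law M X S Y T \<kappa>" and E: "E \<in> sets T"
    and f[measurable]: "f \<in> borel_measurable S" and int: "integrable M (\<lambda>w. f (X w))"
    and g[measurable]: "g \<in> borel_measurable M" and g_eq: "AE w in M. measure (\<kappa> (X w)) E = g w"
  shows "(\<integral>w. f (X w) * indicator E (Y w) \<partial>M) = (\<integral>w. f (X w) * g w \<partial>M)"
proof -
  let ?F = "vimage_algebra (space M) X S" and ?E = "Y -` E \<inter> space M"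
  have X[measurable]: "X \<in> M \<rightarrow>\<^sub>M S" and Y[measurable]: "Y \<in> M \<rightarrow>\<^sub>M T"
    using law by (auto simp: has_cond_law_def)
  interpret sigma_finite_subalgebra M ?F
    by (rule sigma_finite_subalgebra_vimage) fact
  have [measurable]: "?E \<in> sets M"
    using E by simp
  have X'[measurable]: "X \<in> ?F \<rightarrow>\<^sub>M S"
    using measurable_space[OF X] by (intro measurable_vimage_algebra1) auto
  have fX[measurable]: "(\<lambda>w. f (X w)) \<in> borel_measurable ?F"
    by measurable
  have int': "integrable M (\<lambda>w. f (X w) * indicator ?E w)"
    using int by (intro integrable_real_mult_indicator) auto
  have "AE w in M. real_cond_exp M ?F (indicator ?E) w = measure (\<kappa> (X w)) E"
    using law E by (auto simp: has_cond_law_def)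
  then have AE_eq: "AE w in M. f (X w) * real_cond_exp M ?F (indicator ?E) w = f (X w) * g w"
    using g_eq by eventually_elim simp
  have "(\<integral>w. f (X w) * indicator E (Y w) \<partial>M) = (\<integral>w. f (X w) * indicator ?E w \<partial>M)"
    by (intro Bochner_Integration.integral_cong) (auto simp: indicator_def)
  also have "\<dots> = (\<integral>w. f (X w) * real_cond_exp M ?F (indicator ?E) w \<partial>M)"
    using real_cond_exp_intg(2)[OF int' fX] by simp
  also have "\<dots> = (\<integral>w. f (X w) * g w \<partial>M)"
    using AE_eq by (intro integral_cong_AE) auto
  finally show ?thesis .
qed

text \<open>\<open>has_cond_law\<close> is an almost sure identity for each event separately.
  Integrated over rectangles, these identities determine the joint law of \<open>X\<close> and
  \<open>Y\<close>; the kernel \<open>K\<close> keeps the value of \<open>X\<close> as first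
  coordinate, so that this joint law becomes a bind.\<close>

lemma (in prob_space) has_cond_law_nn_integral:
  assumes law: "has_cond_law M X S Y T \<kappa>"
    and \<kappa>[measurable]: "\<kappa> \<in> S \<rightarrow>\<^sub>M prob_algebra T"
    and F[measurable]: "(\<lambda>(x, y). F x y) \<in> borel_measurable (S \<Otimes>\<^sub>M T)"
  shows "(\<integral>\<^sup>+w. F (X w) (Y w) \<partial>M) = (\<integral>\<^sup>+w. (\<integral>\<^sup>+y. F (X w) y \<partial>\<kappa> (X w)) \<partial>M)"
proof -
  have X[measurable]: "X \<in> M \<rightarrow>\<^sub>M S" and Y[measurable]: "Y \<in> M \<rightarrow>\<^sub>M T"
    using law by (auto simp: has_cond_law_def)
  define K where "K = (\<lambda>x. distr (\<kappa> x) (S \<Otimes>\<^sub>M T) (Pair x))"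
  have K[measurable]: "K \<in> S \<rightarrow>\<^sub>M prob_algebra (S \<Otimes>\<^sub>M T)"
    unfolding K_def by measurable
  have K'[measurable]: "K \<in> S \<rightarrow>\<^sub>M subprob_algebra (S \<Otimes>\<^sub>M T)"
    using K by (rule measurable_prob_algebraD)
  have \<kappa>_space: "sets (\<kappa> x) = sets T" "prob_space (\<kappa> x)" if "x \<in> space S" for x
    using measurable_space[OF \<kappa> that] by (auto simp: space_prob_algebra)
  let ?Q = "distr M (S \<Otimes>\<^sub>M T) (\<lambda>w. (X w, Y w))" and ?R = "distr M S X \<bind> K"
  have setsR: "sets ?R = sets (S \<Otimes>\<^sub>M T)"
    using not_empty measurable_space[OF X] by (intro sets_bind[where N = "S \<Otimes>\<^sub>M T"])
      (use measurable_space[OF K] in \<open>auto simp: space_prob_algebra\<close>)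
  have "?Q = ?R"
  proof (rule measure_eqI_generator_eq[OF Int_stable_pair_measure_generator[of S T]])
    show "{a \<times> b |a b. a \<in> sets S \<and> b \<in> sets T} \<subseteq> Pow (space S \<times> space T)"
      by (auto dest: sets.sets_into_space)
    show "sets ?Q = sigma_sets (space S \<times> space T) {a \<times> b |a b. a \<in> sets S \<and> b \<in> sets T}"
      by (simp add: sets_pair_measure)
    show "sets ?R = sigma_sets (space S \<times> space T) {a \<times> b |a b. a \<in> sets S \<and> b \<in> sets T}"
      unfolding setsR by (simp add: sets_pair_measure)
    show "range (\<lambda>_::nat. space S \<times> space T) \<subseteq> {a \<times> b |a b. a \<in> sets S \<and> b \<in> sets T}"
      by auto
    show "(\<Union>i::nat. space S \<times> space T) = space S \<times> space T"
      by simp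
    show "emeasure ?Q (space S \<times> space T) \<noteq> \<infinity>"
      by (subst emeasure_distr) auto
    fix Z assume "Z \<in> {a \<times> b |a b. a \<in> sets S \<and> b \<in> sets T}"
    then obtain A B where Z: "Z = A \<times> B" and [measurable]: "A \<in> sets S" "B \<in> sets T"
      by auto
    have "emeasure ?Q Z = emeasure M {w\<in>space M. X w \<in> A \<and> Y w \<in> B}"
      unfolding Z by (subst emeasure_distr) (auto intro!: arg_cong[where f = "emeasure M"])
    also have "\<dots> = (\<integral>w. indicator A (X w) * indicator B (Y w) \<partial>M)"
    proof -
      have "(\<integral>w. indicator A (X w) * indicator B (Y w) \<partial>M)
          = (\<integral>w. (indicator {w\<in>space M. X w \<in> A \<and> Y w \<in> B} w :: real) \<partial>M)"
        by (intro Bochner_Integration.integral_cong) (auto simp: indicator_def)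
      also have "\<dots> = prob {w\<in>space M. X w \<in> A \<and> Y w \<in> B}"
        by simp
      finally show ?thesis
        by (simp add: emeasure_eq_measure)
    qed
    also have "\<dots> = (\<integral>w. indicator A (X w) * measure (\<kappa> (X w)) B \<partial>M)"
      by (intro arg_cong[where f = ennreal] has_cond_law_integral_mult_indicator[OF law])
        (auto intro!: integrable_const_bound[where B = 1])
    also have "\<dots> = (\<integral>\<^sup>+w. ennreal (indicator A (X w) * measure (\<kappa> (X w)) B) \<partial>M)"
    proof (intro nn_integral_eq_integral[symmetric] integrable_const_bound[where B = 1] AE_I2)
      fix w assume "w \<in> space M"
      then interpret k: prob_space "\<kappa> (X w)"
        using measurable_space[OF X] \<kappa>_space by auto
      show "norm (indicator A (X w) * measure (\<kappa> (X w)) B) \<le> 1"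
        by (auto simp: indicator_def)
    qed auto
    also have "\<dots> = (\<integral>\<^sup>+w. emeasure (K (X w)) Z \<partial>M)"
    proof (intro nn_integral_cong)
      fix w assume "w \<in> space M"
      then have x: "X w \<in> space S"
        using measurable_space[OF X] by auto
      then interpret k: prob_space "\<kappa> (X w)"
        using \<kappa>_space by auto
      have [measurable_cong]: "sets (\<kappa> (X w)) = sets T"
        using x \<kappa>_space by auto
      have "emeasure (K (X w)) Z = emeasure (\<kappa> (X w)) (Pair (X w) -` Z \<inter> space (\<kappa> (X w)))"
        unfolding K_def Z using x by (intro emeasure_distr) measurable
      also have "Pair (X w) -` Z \<inter> space (\<kappa> (X w)) = (if X w \<in> A then B else {})"
        using sets.sets_into_space[of B T] sets_eq_imp_space_eq[OF \<kappa>_space(1)[OF x]] by (auto simp: Z)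
      finally show "ennreal (indicator A (X w) * measure (\<kappa> (X w)) B) = emeasure (K (X w)) Z"
        by (simp add: k.emeasure_eq_measure)
    qed
    also have "\<dots> = (\<integral>\<^sup>+x. emeasure (K x) Z \<partial>distr M S X)"
      unfolding Z by (subst nn_integral_distr) auto
    also have "\<dots> = emeasure ?R Z"
      unfolding Z using not_empty measurable_space[OF X]
      by (intro emeasure_bind[symmetric, where N = "S \<Otimes>\<^sub>M T"]) auto
    finally show "emeasure ?Q Z = emeasure ?R Z" .
  qed
  have "(\<integral>\<^sup>+w. F (X w) (Y w) \<partial>M) = (\<integral>\<^sup>+p. (case p of (x, y) \<Rightarrow> F x y) \<partial>?Q)"
    by (subst nn_integral_distr) auto
  also have "\<dots> = (\<integral>\<^sup>+x. (\<integral>\<^sup>+p. (case p of (x, y) \<Rightarrow> F x y) \<partial>K x) \<partial>distr M S X)"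
    unfolding \<open>?Q = ?R\<close> by (rule nn_integral_bind[where B = "S \<Otimes>\<^sub>M T"]) auto
  also have "\<dots> = (\<integral>\<^sup>+w. (\<integral>\<^sup>+p. (case p of (x, y) \<Rightarrow> F x y) \<partial>K (X w)) \<partial>M)"
    using nn_integral_measurable_subprob_algebra[OF F]
    by (intro nn_integral_distr) (auto intro: measurable_compose[OF K'])
  also have "\<dots> = (\<integral>\<^sup>+w. (\<integral>\<^sup>+y. F (X w) y \<partial>\<kappa> (X w)) \<partial>M)"
  proof (intro nn_integral_cong)
    fix w assume "w \<in> space M"
    then have x: "X w \<in> space S"
      using measurable_space[OF X] by auto
    have [measurable_cong]: "sets (\<kappa> (X w)) = sets T"
      using x \<kappa>_space by auto
    show "(\<integral>\<^sup>+p. (case p of (x, y) \<Rightarrow> F x y) \<partial>K (X w)) = (\<integral>\<^sup>+y. F (X w) y \<partial>\<kappa> (X w))"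
      unfolding K_def using x by (subst nn_integral_distr) auto
  qed
  finally show ?thesis .
qed

section \<open>The Laplace functional of a Poisson process\<close>

lemma iprod_prod:
  assumes "finite I" "\<And>i n. i \<in> I \<Longrightarrow> a i n \<in> {0..1}"
  shows "iprod (\<lambda>n. \<Prod>i\<in>I. a i n) = (\<Prod>i\<in>I. iprod (a i))"
  using assms
proof (induction I)
  case (insert i I)
  then have "iprod (\<lambda>n. a i n * (\<Prod>i\<in>I. a i n)) = iprod (a i) * iprod (\<lambda>n. \<Prod>i\<in>I. a i n)"
    by (intro iprod_mult prod_in_unit_interval) auto
  with insert show ?case
    by simp
qed simp

text \<open>\<open>enn2real\<close> maps infinity to 0, so an infinite exponent gives the value 1.
  This is harmless for sets of finite intensity, whose counts are almost surely finite.\<close>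

definition ennreal_power :: "real \<Rightarrow> ennreal \<Rightarrow> real" where
  "ennreal_power c x = c ^ nat \<lfloor>enn2real x\<rfloor>"

lemma borel_measurable_ennreal_power [measurable]: "ennreal_power c \<in> borel_measurable borel"
  unfolding ennreal_power_def by measurable

lemma points_in_eq:
  "points_in X B w = (if finite {n. X n w \<in> B} then of_nat (card {n. X n w \<in> B}) else \<infinity>)"
  by (simp add: points_in_def)

lemma borel_measurable_points_in:
  assumes [measurable]: "\<And>n. X n \<in> P \<rightarrow>\<^sub>M \<mu>" "B \<in> sets \<mu>"
  shows "points_in X B \<in> borel_measurable P"
proof -
  have "points_in X B w = (\<Sum>n. indicator B (X n w))" for w
  proof -
    have "points_in X B w = (\<integral>\<^sup>+n. indicator {n. X n w \<in> B} n \<partial>count_space UNIV)"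
      unfolding points_in_def by simp
    also have "\<dots> = (\<Sum>n. indicator {n. X n w \<in> B} n)"
      by (rule nn_integral_count_space_nat)
    finally show ?thesis
      by (simp add: indicator_def)
  qed
  then have "points_in X B = (\<lambda>w. \<Sum>n. indicator B (X n w))"
    by blast
  then show ?thesis
    by simp
qed

text \<open>The Poisson probabilities of the finite values sum to 1, which leaves no probability for
  an infinite count.\<close>

lemma poisson_points_AE_finite:
  assumes pp: "poisson_points P \<mu> X" and B: "B \<in> sets \<mu>" "emeasure \<mu> B < \<infinity>"
  shows "AE w in P. points_in X B w \<noteq> \<infinity>"
proof -
  interpret prob_space P
    using pp by (simp add: poisson_points_def)
  have [measurable]: "\<And>n. X n \<in> P \<rightarrow>\<^sub>M \<mu>"
    using pp by (simp add: poisson_points_def)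
  note [measurable] = borel_measurable_points_in[of X P \<mu> B, OF _ B(1)]
  let ?E = "\<lambda>k::nat. {w \<in> space P. points_in X B w = of_nat k}"
  have [measurable]: "?E k \<in> sets P" for k
    by measurable
  have "(\<lambda>k. prob (?E k)) sums prob (\<Union>k. ?E k)"
    by (intro finite_measure_UNION) (auto simp: disjoint_family_on_def)
  moreover have "(\<lambda>k. prob (?E k)) sums 1"
  proof -
    have "(\<lambda>k. (measure \<mu> B ^ k / fact k) * exp (- measure \<mu> B)) sums (exp (measure \<mu> B) * exp (- measure \<mu> B))"
      using exp_converges[of "measure \<mu> B"] by (intro sums_mult2) (simp add: divide_inverse mult.commute)
    then show ?thesis
      using pp B by (simp add: poisson_points_def exp_minus_inverse)
  qed
  ultimately have "prob (\<Union>k. ?E k) = 1"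
    by (rule sums_unique2)
  moreover have "(\<Union>k. ?E k) \<in> sets P"
    by measurable
  ultimately have "AE w in P. w \<in> (\<Union>k. ?E k)"
    by (simp add: prob_eq_1)
  then show ?thesis
    by eventually_elim auto
qed

lemma poisson_points_pgf:
  assumes pp: "poisson_points P \<mu> X" and B: "B \<in> sets \<mu>" "emeasure \<mu> B < \<infinity>" and c: "c \<in> {0..1}"
  shows "(\<integral>w. ennreal_power c (points_in X B w) \<partial>P) = exp (- ((1 - c) * measure \<mu> B))"
proof -
  interpret prob_space P
    using pp by (simp add: poisson_points_def)
  have [measurable]: "\<And>n. X n \<in> P \<rightarrow>\<^sub>M \<mu>"
    using pp by (simp add: poisson_points_def)
  note [measurable] = borel_measurable_points_in[of X P \<mu> B, OF _ B(1)]
  let ?N = "\<lambda>w. nat \<lfloor>enn2real (points_in X B w)\<rfloor>" and ?m = "measure \<mu> B"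
  have "(\<lambda>k. (\<integral>w. 1 * indicator {k} (?N w) \<partial>P) * c ^ k) sums (\<integral>w. 1 * c ^ ?N w \<partial>P)"
    using c by (intro sums_integral_nat_fibres) (auto simp: power_le_one)
  moreover have "(\<integral>w. 1 * indicator {k} (?N w) \<partial>P) = ?m ^ k / fact k * exp (- ?m)" for k
  proof -
    have "(\<integral>w. 1 * indicator {k} (?N w) \<partial>P) = (\<integral>w. (indicator {w \<in> space P. points_in X B w = of_nat k} w :: real) \<partial>P)"
    proof (rule integral_cong_AE)
      show "AE w in P. 1 * indicator {k} (?N w) = (indicator {w \<in> space P. points_in X B w = of_nat k} w :: real)"
        using poisson_points_AE_finite[OF pp B] AE_space
      proof eventually_elim
        case (elim w)
        then have "points_in X B w = of_nat (card {n. X n w \<in> B})"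
          by (auto simp: points_in_eq split: if_splits)
        then show ?case
          using elim by (auto simp: indicator_def enn2real_eq_posreal_iff simp flip: ennreal_of_nat_eq_real_of_nat)
      qed
    qed auto
    also have "\<dots> = measure P {w \<in> space P. points_in X B w = of_nat k}"
      by simp
    finally show ?thesis
      using pp B by (simp add: poisson_points_def)
  qed
  ultimately have "(\<lambda>k. ?m ^ k / fact k * exp (- ?m) * c ^ k) sums (\<integral>w. c ^ ?N w \<partial>P)"
    by simp
  moreover have "(\<lambda>k. (c * ?m) ^ k / fact k * exp (- ?m)) sums (exp (c * ?m) * exp (- ?m))"
    using exp_converges[of "c * ?m"] by (intro sums_mult2) (simp add: divide_inverse mult.commute)
  ultimately have "(\<integral>w. c ^ ?N w \<partial>P) = exp (c * ?m) * exp (- ?m)"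
    by (intro sums_unique2[of "\<lambda>k. (c * ?m) ^ k / fact k * exp (- ?m)"]) (simp_all add: power_mult_distrib mult_ac)
  then show ?thesis
    by (simp add: ennreal_power_def mult_exp_exp algebra_simps)
qed

lemma iprod_if_eq_ennreal_power:
  assumes "points_in X B w \<noteq> \<infinity>"
  shows "iprod (\<lambda>n. if X n w \<in> B then c else 1) = ennreal_power c (points_in X B w)"
proof -
  let ?S = "{n. X n w \<in> B}"
  have fin: "finite ?S"
    using assms by (auto simp: points_in_eq split: if_splits)
  have "iprod (\<lambda>n. if X n w \<in> B then c else 1) = (\<Prod>n\<in>?S. if X n w \<in> B then c else 1)"
    using fin by (intro iprod_eq_prod) auto
  also have "\<dots> = c ^ card ?S"
    by simp
  also have "\<dots> = ennreal_power c (points_in X B w)"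
    using fin by (simp add: points_in_eq ennreal_power_def flip: ennreal_of_nat_eq_real_of_nat)
  finally show ?thesis .
qed

text \<open>On the level sets of \<open>f\<close> the factor \<open>1 - f\<close> is constant, so
  the product over points becomes a product of powers whose exponents are the counts of disjoint
  sets. These counts are independent and each has the Poisson generating function.\<close>

lemma poisson_points_laplace_simple:
  assumes pp: "poisson_points P \<mu> X" and f: "simple_function \<mu> f" "integrable \<mu> f"
    and f01: "\<And>x. f x \<in> {0..1::real}"
  shows "(\<integral>w. iprod (\<lambda>n. 1 - f (X n w)) \<partial>P) = exp (- (\<integral>x. f x \<partial>\<mu>))"
proof -
  interpret prob_space P
    using pp by (simp add: poisson_points_def)
  have X[measurable]: "\<And>n. X n \<in> P \<rightarrow>\<^sub>M \<mu>"
    using pp by (simp add: poisson_points_def)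
  have fm[measurable]: "f \<in> borel_measurable \<mu>"
    using f(2) by auto
  define Y where "Y = f ` space \<mu> - {0}"
  have finY: "finite Y"
    using f(1) by (auto simp: Y_def simple_function_def)
  have Y01: "y \<in> {0..1}" "0 < y" if "y \<in> Y" for y
    using that f01 by (auto simp: Y_def) (metis atLeastAtMost_iff order_le_imp_less_or_eq)
  define B where "B y = f -` {y} \<inter> space \<mu>" for y
  have [measurable]: "B y \<in> sets \<mu>" for y
    unfolding B_def by measurable
  have finB: "emeasure \<mu> (B y) < \<infinity>" if "y \<in> Y" for y
  proof -
    have "ennreal y * emeasure \<mu> (B y) = (\<integral>\<^sup>+x. ennreal y * indicator (B y) x \<partial>\<mu>)"
      by (simp add: nn_integral_cmult_indicator)
    also have "\<dots> \<le> (\<integral>\<^sup>+x. ennreal (norm (f x)) \<partial>\<mu>)"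
      using f01 by (intro nn_integral_mono) (auto simp: B_def indicator_def)
    also have "\<dots> < \<infinity>"
      using f(2) by (simp add: integrable_iff_bounded)
    finally show ?thesis
      using Y01[OF that] by (auto simp: ennreal_mult_less_top)
  qed
  have f_eq: "f x = (\<Sum>y\<in>Y. y * indicator (B y) x)" if "x \<in> space \<mu>" for x
  proof (cases "f x = 0")
    case True
    then show ?thesis
      by (auto simp: B_def Y_def indicator_def intro!: sum.neutral[symmetric])
  next
    case False
    then have "f x \<in> Y"
      using that by (auto simp: Y_def)
    then have "(\<Sum>y\<in>Y. y * indicator (B y) x) = (\<Sum>y\<in>{f x}. y * indicator (B y) x)"
      using finY by (intro sum.mono_neutral_right) (auto simp: B_def indicator_def)
    then show ?thesis
      using that by (simp add: B_def)
  qed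
  have prod_eq: "1 - f x = (\<Prod>y\<in>Y. if x \<in> B y then 1 - y else 1)" if "x \<in> space \<mu>" for x
  proof (cases "f x = 0")
    case True
    then show ?thesis
      by (auto simp: B_def Y_def intro!: prod.neutral[symmetric])
  next
    case False
    then have "f x \<in> Y"
      using that by (auto simp: Y_def)
    then have "(\<Prod>y\<in>Y. if x \<in> B y then 1 - y else 1) = (\<Prod>y\<in>{f x}. if x \<in> B y then 1 - y else 1)"
      using finY by (intro prod.mono_neutral_right) (auto simp: B_def)
    then show ?thesis
      using that by (simp add: B_def)
  qed
  \<comment> \<open>\<open>poisson_points\<close> speaks of infinite disjoint sequences, so the
    finitely many level sets are enumerated and padded with empty sets.\<close>
  obtain \<phi> where \<phi>: "bij_betw \<phi> {..<card Y} Y"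
    using finY ex_bij_betw_nat_finite by (metis lessThan_atLeast0)
  define B' where "B' i = (if i < card Y then B (\<phi> i) else {})" for i
  have \<phi>Y: "i < card Y \<Longrightarrow> \<phi> i \<in> Y" for i
    using \<phi> by (auto simp: bij_betw_def)
  have \<phi>_inj: "i < card Y \<Longrightarrow> k < card Y \<Longrightarrow> \<phi> i = \<phi> k \<longleftrightarrow> i = k" for i k
    using \<phi> by (auto simp: bij_betw_def inj_on_def)
  have disj: "disjoint_family B'"
    using \<phi>_inj by (auto simp: disjoint_family_on_def B'_def B_def)
  have B'_sets: "B' i \<in> sets \<mu>" for i
    by (simp add: B'_def)
  have indep: "indep_vars (\<lambda>_. borel) (\<lambda>i. points_in X (B' i)) UNIV"
    using pp disj B'_sets unfolding poisson_points_def by blast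
  have "indep_vars (\<lambda>_. borel) (\<lambda>i w. ennreal_power (1 - \<phi> i) (points_in X (B' i) w)) UNIV"
    by (rule indep_vars_compose2[OF indep]) measurable
  then have indep': "indep_vars (\<lambda>_. borel) (\<lambda>i w. ennreal_power (1 - \<phi> i) (points_in X (B' i) w)) {..<card Y}"
    by (rule indep_vars_subset) auto
  have meas: "(\<lambda>w. ennreal_power c (points_in X (B y) w)) \<in> borel_measurable P" for c y
    using borel_measurable_points_in[of X P \<mu> "B y"] by measurable
  have bound: "\<bar>ennreal_power (1 - y) x\<bar> \<le> 1" if "y \<in> Y" for y x
    using Y01(1)[OF that] by (auto simp: ennreal_power_def power_le_one)
  have "AE w in P. \<forall>y\<in>Y. points_in X (B y) w \<noteq> \<infinity>"
    using finY poisson_points_AE_finite[OF pp _ finB] by (intro AE_finite_allI) auto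
  then have "AE w in P. iprod (\<lambda>n. 1 - f (X n w)) = (\<Prod>y\<in>Y. ennreal_power (1 - y) (points_in X (B y) w))"
    using AE_space
  proof eventually_elim
    case (elim w)
    have "iprod (\<lambda>n. 1 - f (X n w)) = iprod (\<lambda>n. \<Prod>y\<in>Y. if X n w \<in> B y then 1 - y else 1)"
      using measurable_space[OF X elim(2)] by (simp add: prod_eq)
    also have "\<dots> = (\<Prod>y\<in>Y. iprod (\<lambda>n. if X n w \<in> B y then 1 - y else 1))"
      using finY Y01 by (intro iprod_prod) auto
    also have "\<dots> = (\<Prod>y\<in>Y. ennreal_power (1 - y) (points_in X (B y) w))"
      using elim by (intro prod.cong refl iprod_if_eq_ennreal_power) auto
    finally show ?case .
  qed
  then have "(\<integral>w. iprod (\<lambda>n. 1 - f (X n w)) \<partial>P) = (\<integral>w. (\<Prod>y\<in>Y. ennreal_power (1 - y) (points_in X (B y) w)) \<partial>P)"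
    using meas by (intro integral_cong_AE) auto
  also have "\<dots> = (\<integral>w. (\<Prod>i<card Y. ennreal_power (1 - \<phi> i) (points_in X (B' i) w)) \<partial>P)"
    by (intro Bochner_Integration.integral_cong refl)
      (subst prod.reindex_bij_betw[OF \<phi>, symmetric], simp add: B'_def)
  also have "\<dots> = (\<Prod>i<card Y. \<integral>w. ennreal_power (1 - \<phi> i) (points_in X (B' i) w) \<partial>P)"
    using meas bound \<phi>Y
    by (intro indep_vars_lebesgue_integral indep') (auto simp: B'_def intro!: integrable_const_bound[where B = 1])
  also have "\<dots> = (\<Prod>i<card Y. exp (- (\<phi> i * measure \<mu> (B (\<phi> i)))))"
    using \<phi>Y Y01 finB by (intro prod.cong refl) (simp add: B'_def poisson_points_pgf[OF pp])
  also have "\<dots> = (\<Prod>y\<in>Y. exp (- (y * measure \<mu> (B y))))"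
    by (rule prod.reindex_bij_betw[OF \<phi>])
  also have "\<dots> = exp (- (\<Sum>y\<in>Y. y * measure \<mu> (B y)))"
    using finY by (simp add: exp_sum sum_negf[symmetric])
  also have "(\<Sum>y\<in>Y. y * measure \<mu> (B y)) = (\<integral>x. (\<Sum>y\<in>Y. y * indicator (B y) x) \<partial>\<mu>)"
  proof -
    have "B y \<inter> space \<mu> = B y" for y
      by (auto simp: B_def)
    then show ?thesis
      using finB by (subst Bochner_Integration.integral_sum) auto
  qed
  also have "\<dots> = (\<integral>x. f x \<partial>\<mu>)"
    by (intro Bochner_Integration.integral_cong) (auto simp: f_eq)
  finally show ?thesis .
qed

text \<open>Simple functions increasing to \<open>f\<close> make the factors \<open>1 - h i\<close>
  approach \<open>1 - f\<close> from above, exactly the situation of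
  \<open>iprod_tendsto_above\<close>; the exponents converge with \<open>f\<close> as dominating
  function.\<close>

theorem poisson_points_laplace:
  assumes pp: "poisson_points P \<mu> X" and f: "integrable \<mu> f"
    and f01: "\<And>x. f x \<in> {0..1::real}"
  shows "(\<integral>w. iprod (\<lambda>n. 1 - f (X n w)) \<partial>P) = exp (- (\<integral>x. f x \<partial>\<mu>))"
proof -
  interpret prob_space P
    using pp by (simp add: poisson_points_def)
  have X[measurable]: "\<And>n. X n \<in> P \<rightarrow>\<^sub>M \<mu>"
    using pp by (simp add: poisson_points_def)
  have [measurable]: "f \<in> borel_measurable \<mu>"
    using f by auto
  obtain g where g: "\<And>i. simple_function \<mu> (g i)" "incseq g" "\<And>i x. g i x < top"
      "\<And>x. (SUP i. g i x) = ennreal (f x)"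
    using borel_measurable_implies_simple_function_sequence'[of "\<lambda>x. ennreal (f x)" \<mu>] by auto
  define h where "h i x = enn2real (g i x)" for i x
  have g_le: "g i x \<le> ennreal (f x)" for i x
    unfolding g(4)[symmetric] by (rule SUP_upper) simp
  have h_le: "h i x \<le> f x" for i x
    using enn2real_mono[OF g_le[of i x]] f01[of x] by (simp add: h_def)
  have h01: "h i x \<in> {0..1}" for i x
    using h_le[of i x] f01[of x] by (auto simp: h_def)
  have h_simple: "simple_function \<mu> (h i)" for i
    unfolding h_def using g(1) by (rule simple_function_compose1)
  note [measurable] = borel_measurable_simple_function[OF h_simple]
  have h_int: "integrable \<mu> (h i)" for i
    using f by (rule Bochner_Integration.integrable_bound) (use h_le h01 f01 in auto)
  have h_lim: "(\<lambda>i. h i x) \<longlonglongrightarrow> f x" for x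
  proof -
    have "(\<lambda>i. g i x) \<longlonglongrightarrow> ennreal (f x)"
      unfolding g(4)[symmetric] using g(2) by (intro LIMSEQ_SUP) (auto simp: incseq_def le_fun_def)
    then have "(\<lambda>i. h i x) \<longlonglongrightarrow> enn2real (ennreal (f x))"
      unfolding h_def by (intro tendsto_enn2real) auto
    then show ?thesis
      using f01[of x] by simp
  qed
  have "(\<lambda>i. \<integral>w. iprod (\<lambda>n. 1 - h i (X n w)) \<partial>P) \<longlonglongrightarrow> (\<integral>w. iprod (\<lambda>n. 1 - f (X n w)) \<partial>P)"
  proof (rule integral_dominated_convergence)
    show "AE w in P. (\<lambda>i. iprod (\<lambda>n. 1 - h i (X n w))) \<longlonglongrightarrow> iprod (\<lambda>n. 1 - f (X n w))"
      using h01 f01 h_le h_lim by (intro AE_I2 iprod_tendsto_above) (auto intro!: tendsto_intros)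
    show "AE w in P. norm (iprod (\<lambda>n. 1 - h i (X n w))) \<le> 1" for i
      using iprod_in_unit_interval[of "\<lambda>n. 1 - h i (X n _)"] h01 by (intro AE_I2) auto
  qed auto
  moreover have "(\<lambda>i. exp (- (\<integral>x. h i x \<partial>\<mu>))) \<longlonglongrightarrow> exp (- (\<integral>x. f x \<partial>\<mu>))"
    by (intro tendsto_intros integral_dominated_convergence[where w = f])
      (use f h_le h01 h_lim in auto)
  ultimately show ?thesis
    using LIMSEQ_unique by (simp add: poisson_points_laplace_simple[OF pp h_simple h_int h01])
qed

section \<open>The largest point of the stable process and the ratios to it\<close>

abbreviation stable_rate :: "real \<Rightarrow> real \<Rightarrow> real" where
  "stable_rate \<sigma> x \<equiv> \<sigma> * x powr (- 1 - \<sigma>)"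

text \<open>The integrand may be singular at 0, so the fundamental theorem is applied only from
  \<open>x / 2\<close> onwards; the integral up to \<open>x / 2\<close> is a constant.\<close>

lemma has_real_derivative_integral_Ioc:
  fixes f :: "real \<Rightarrow> real"
  assumes cont: "continuous_on {0<..} f"
    and int: "\<And>u. set_integrable lborel {0<..u} f" and x: "0 < x"
  shows "((\<lambda>u. LBINT t:{0<..u}. f t) has_real_derivative f x) (at x)"
proof -
  define a where "a = x / 2"
  have a: "0 < a" "a < x"
    using x by (auto simp: a_def)
  have split: "(LBINT t:{0<..u}. f t) = (LBINT t:{0<..a}. f t) + (LBINT t=a..u. f t)" if "a \<le> u" for u
  proof -
    have "{0<..u} = {0<..a} \<union> {a<..u}"
      using a that by auto
    then have "(LBINT t:{0<..u}. f t) = (LBINT t:{0<..a}. f t) + (LBINT t:{a<..u}. f t)"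
      using a int[of u] by (simp, intro set_integral_Un) (auto intro: set_integrable_subset)
    also have "(LBINT t:{a<..u}. f t) = (LBINT t=a..u. f t)"
      using that by (simp add: interval_integral_Ioc)
    finally show ?thesis .
  qed
  have "((\<lambda>u. LBINT t=a..u. f t) has_vector_derivative f x) (at x within {a..x + 1})"
    using a by (intro interval_integral_FTC2 continuous_on_subset[OF cont]) auto
  then have "((\<lambda>u. LBINT t=a..u. f t) has_real_derivative f x) (at x within {a<..<x + 1})"
    unfolding has_real_derivative_iff_has_vector_derivative
    by (rule has_vector_derivative_within_subset) auto
  then have "((\<lambda>u. LBINT t=a..u. f t) has_real_derivative f x) (at x)"
    using a by (subst (asm) at_within_open) auto
  then have "((\<lambda>u. (LBINT t:{0<..a}. f t) + (LBINT t=a..u. f t)) has_real_derivative f x) (at x)"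
    by (auto intro!: derivative_eq_intros)
  then show ?thesis
  proof (rule has_field_derivative_transform_within_open[of _ _ _ "{a<..}"])
    show "(LBINT t:{0<..a}. f t) + (LBINT t=a..u. f t) = (LBINT t:{0<..u}. f t)" if "u \<in> {a<..}" for u
      using split[of u] that by simp
  qed (use a in auto)
qed

lemma filterlim_powr_minus_at_right_0:
  assumes "0 < \<sigma>"
  shows "filterlim (\<lambda>x::real. x powr (- \<sigma>)) at_top (at_right 0)"
proof -
  have "filterlim (\<lambda>x::real. - ln x) at_top (at_right 0)"
    using ln_at_0 by (simp add: filterlim_uminus_at_bot)
  then have "filterlim (\<lambda>x::real. exp (\<sigma> * (- ln x))) at_top (at_right 0)"
    using assms by (intro filterlim_compose[OF exp_at_top] filterlim_tendsto_pos_mult_at_top[OF tendsto_const])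
  moreover have "\<forall>\<^sub>F x::real in at_right 0. exp (\<sigma> * (- ln x)) = x powr (- \<sigma>)"
    unfolding eventually_at_right_field by (intro exI[of _ 1]) (simp add: powr_def)
  ultimately show ?thesis
    by (rule filterlim_cong[OF refl refl, THEN iffD1, rotated])
qed

lemma has_real_derivative_powr_minus:
  "0 < x \<Longrightarrow> ((\<lambda>x::real. x powr (- \<sigma>)) has_real_derivative (- (stable_rate \<sigma> x))) (at x)"
  using has_real_derivative_powr[of x "- \<sigma>"] by (simp add: minus_diff_commute)

lemma emeasure_stable_intensity_greaterThan:
  assumes "0 < \<sigma>" "0 < s"
  shows "emeasure (stable_intensity \<sigma>) {s<..} = ennreal (s powr (- \<sigma>))"
proof -
  have "emeasure (stable_intensity \<sigma>) {s<..}
      = (\<integral>\<^sup>+x. ennreal (stable_rate \<sigma> x * indicator {0<..} x) * indicator {s<..} x \<partial>lborel)"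
    unfolding stable_intensity_def by (subst emeasure_density) auto
  also have "\<dots> = (\<integral>\<^sup>+x. ennreal (stable_rate \<sigma> x) * indicator {s..} x \<partial>lborel)"
  proof (rule nn_integral_cong_AE)
    show "AE x in lborel. ennreal (stable_rate \<sigma> x * indicator {0<..} x) * indicator {s<..} x
        = ennreal (stable_rate \<sigma> x) * indicator {s..} x"
      using AE_lborel_singleton[of s] by eventually_elim (use assms in \<open>auto simp: indicator_def\<close>)
  qed
  also have "\<dots> = 0 - (- (s powr (- \<sigma>)))"
  proof (rule nn_integral_FTC_atLeast)
    show "((\<lambda>x. - (x powr (- \<sigma>))) has_real_derivative stable_rate \<sigma> x) (at x)" if "s \<le> x" for x
      using DERIV_minus[OF has_real_derivative_powr_minus[of x \<sigma>]] assms that by simp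
    have "((\<lambda>x::real. x powr (- \<sigma>)) \<longlongrightarrow> 0) at_top"
      using assms by (intro tendsto_neg_powr filterlim_ident) auto
    then show "((\<lambda>x::real. - (x powr (- \<sigma>))) \<longlongrightarrow> 0) at_top"
      using tendsto_minus by fastforce
  qed (use assms in auto)
  finally show ?thesis
    by simp
qed

lemma integrable_stable_intensity:
  fixes f :: "real \<Rightarrow> real"
  assumes "0 < \<sigma>"
  shows "integrable (stable_intensity \<sigma>) f \<longleftrightarrow> f \<in> borel_measurable borel \<and>
      set_integrable lborel {0<..} (\<lambda>x. f x * stable_rate \<sigma> x)"
    and "f \<in> borel_measurable borel \<Longrightarrow>
      (\<integral>x. f x \<partial>stable_intensity \<sigma>) = (LBINT x:{0<..}. f x * stable_rate \<sigma> x)"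
proof -
  have *: "(\<lambda>x. stable_rate \<sigma> x * indicator {0<..} x * f x) =
      (\<lambda>x. indicator {0<..} x * (f x * stable_rate \<sigma> x))"
    by (auto simp: fun_eq_iff)
  show "integrable (stable_intensity \<sigma>) f \<longleftrightarrow> f \<in> borel_measurable borel \<and>
      set_integrable lborel {0<..} (\<lambda>x. f x * stable_rate \<sigma> x)"
  proof (cases "f \<in> borel_measurable borel")
    case True
    then show ?thesis
      unfolding stable_intensity_def set_integrable_def using assms
      by (subst integrable_density) (auto simp: *)
  next
    case False
    then have "\<not> integrable (stable_intensity \<sigma>) f"
      by (metis borel_measurable_integrable measurable_cong_sets sets_density sets_lborel stable_intensity_def)
    with False show ?thesis by simp
  qed
  show "f \<in> borel_measurable borel \<Longrightarrow>
      (\<integral>x. f x \<partial>stable_intensity \<sigma>) = (LBINT x:{0<..}. f x * stable_rate \<sigma> x)"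
    unfolding stable_intensity_def set_lebesgue_integral_def using assms
    by (subst integral_density) (auto simp: *)
qed

lemma set_integrable_stable_tail:
  fixes \<sigma> :: real
  assumes "0 < \<sigma>" "0 < e"
  shows "set_integrable lborel {e<..} (\<lambda>x. stable_rate \<sigma> x)"
proof -
  have "integrable (stable_intensity \<sigma>) (indicator {e<..} :: real \<Rightarrow> real)"
    using emeasure_stable_intensity_greaterThan[OF assms]
    by (intro integrable_real_indicator) (auto simp: stable_intensity_def)
  moreover have "(\<lambda>x. indicator {0<..} x *\<^sub>R (indicator {e<..} x * stable_rate \<sigma> x))
      = (\<lambda>x. indicator {e<..} x *\<^sub>R (stable_rate \<sigma> x))"
    using assms by (auto simp: fun_eq_iff indicator_def)
  ultimately show ?thesis
    unfolding integrable_stable_intensity(1)[OF \<open>0 < \<sigma>\<close>] set_integrable_def by simp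
qed

section \<open>The ordered points of the stable process\<close>

locale stable_points =
  fixes P :: "'p measure" and \<Delta> :: "nat \<Rightarrow> 'p \<Rightarrow> real" and \<sigma> :: real
  assumes \<sigma>: "0 < \<sigma>"
    and pp: "poisson_points P (stable_intensity \<sigma>) \<Delta>"
    and decreasing: "AE w in P. \<forall>n. \<Delta> (Suc n) w < \<Delta> n w"
begin

sublocale prob_space P
  using pp by (simp add: poisson_points_def)

lemma \<Delta>_measurable [measurable]: "\<Delta> n \<in> borel_measurable P"
proof -
  have "\<Delta> n \<in> P \<rightarrow>\<^sub>M stable_intensity \<sigma>"
    using pp by (simp add: poisson_points_def)
  then show ?thesis
    by (simp add: stable_intensity_def cong: measurable_cong_sets)
qed

lemma AE_antimono: "AE w in P. \<forall>m n. m \<le> n \<longrightarrow> \<Delta> n w \<le> \<Delta> m w"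
  using decreasing
proof eventually_elim
  case (elim w)
  then have "decseq (\<lambda>n. \<Delta> n w)"
    by (intro decseq_SucI) (auto intro: less_imp_le)
  then show ?case
    by (auto simp: decseq_def)
qed

lemma AE_positive: "AE w in P. \<forall>n. 0 < \<Delta> n w"
proof -
  have "emeasure (stable_intensity \<sigma>) {..0}
      = (\<integral>\<^sup>+x. ennreal (stable_rate \<sigma> x * indicator {0<..} x) * indicator {..0} x \<partial>lborel)"
    unfolding stable_intensity_def by (intro emeasure_density) auto
  also have "\<dots> = (\<integral>\<^sup>+x. 0 \<partial>(lborel :: real measure))"
    by (intro nn_integral_cong) (auto split: split_indicator)
  finally have "emeasure (stable_intensity \<sigma>) {..0} = 0"
    by simp
  moreover have "\<forall>B\<in>sets (stable_intensity \<sigma>). emeasure (stable_intensity \<sigma>) B < \<infinity> \<longrightarrow>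
      (\<forall>k::nat. measure P {w \<in> space P. points_in \<Delta> B w = of_nat k}
        = measure (stable_intensity \<sigma>) B ^ k / fact k * exp (- measure (stable_intensity \<sigma>) B))"
    using pp unfolding poisson_points_def by blast
  from this[rule_format, of "{..0}" 0] have
    "emeasure (stable_intensity \<sigma>) {..0} = 0 \<Longrightarrow> measure P {w \<in> space P. points_in \<Delta> {..0} w = 0} = 1"
    by (simp add: stable_intensity_def measure_def)
  ultimately have "measure P {w \<in> space P. points_in \<Delta> {..0} w = 0} = 1"
    by blast
  moreover have [measurable]: "points_in \<Delta> {..0} \<in> borel_measurable P"
    by (rule borel_measurable_points_in[where \<mu> = borel]) auto
  ultimately have "AE w in P. points_in \<Delta> {..0} w = 0"
    by (subst (asm) prob_Collect_eq_1) auto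
  then show ?thesis
  proof eventually_elim
    case (elim w)
    then have "{n. \<Delta> n w \<in> {..0}} = {}"
      by (auto simp: points_in_eq split: if_splits)
    then show ?case
      by (auto simp: not_le[symmetric])
  qed
qed

text \<open>Every half-line above a positive level has finite intensity, hence contains almost
  surely only finitely many points.\<close>

lemma AE_tendsto_0: "AE w in P. (\<lambda>n. \<Delta> n w) \<longlonglongrightarrow> 0"
proof -
  have "AE w in P. \<forall>k. points_in \<Delta> {1 / real (Suc k)<..} w \<noteq> \<infinity>"
    unfolding AE_all_countable
    using emeasure_stable_intensity_greaterThan[OF \<sigma>]
    by (intro allI poisson_points_AE_finite[OF pp]) (auto simp: stable_intensity_def)
  with AE_positive show ?thesis
  proof eventually_elim
    case (elim w)
    show ?case
    proof (rule LIMSEQ_I)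
      fix e :: real assume "0 < e"
      then obtain k where k: "1 / real (Suc k) < e"
        using nat_approx_posE by blast
      have "finite {n. \<Delta> n w \<in> {1 / real (Suc k)<..}}"
        using elim by (auto simp: points_in_eq split: if_splits)
      then obtain N where N: "{n. \<Delta> n w \<in> {1 / real (Suc k)<..}} \<subseteq> {..<N}"
        using finite_nat_bounded by blast
      have "\<Delta> n w \<le> 1 / real (Suc k)" if "n \<ge> N" for n
      proof (rule ccontr)
        assume "\<not> \<Delta> n w \<le> 1 / real (Suc k)"
        then have "n \<in> {..<N}"
          by (intro subsetD[OF N]) simp
        with that show False
          by simp
      qed
      then show "\<exists>no. \<forall>n\<ge>no. norm (\<Delta> n w - 0) < e"
        using elim k by (intro exI[of _ N]) (auto simp: abs_of_pos intro: le_less_trans)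
    qed
  qed
qed

section \<open>The Laplace functional jointly with the largest point\<close>

context
  fixes g :: "real \<Rightarrow> real"
  assumes g_meas [measurable]: "g \<in> borel_measurable borel"
    and g01: "\<And>x. g x \<in> {0<..1}"
    and g_cont: "continuous_on {0<..} g"
    and g_int: "\<And>u. set_integrable lborel {0<..u} (\<lambda>x. (1 - g x) * stable_rate \<sigma> x)"
begin

text \<open>If a point at \<open>x\<close> is kept with probability \<open>g x\<close>, this is the
  mean number of deleted points up to \<open>u\<close>.\<close>

abbreviation "thinned_mass u \<equiv> LBINT x:{0<..u}. (1 - g x) * stable_rate \<sigma> x"

abbreviation "max_laplace u \<equiv> exp (- (thinned_mass u + u powr (- \<sigma>)))"

text \<open>Giving weight 0 to all points above \<open>s\<close> encodes the event that the largest
  point is at most \<open>s\<close>, so one Laplace functional covers both factors. Its exponent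
  splits at \<open>s\<close>: below, the thinned mass; above, the whole tail
  \<open>s powr (- \<sigma>)\<close>.\<close>

lemma laplace_max_le:
  assumes s: "0 < s"
  shows "(\<integral>w. indicator {..s} (\<Delta> 0 w) * iprod (\<lambda>n. g (\<Delta> n w)) \<partial>P) = max_laplace s"
proof -
  let ?f = "\<lambda>x. 1 - g x * indicator {..s} x"
  let ?r = "\<lambda>x. stable_rate \<sigma> x"
  have tail: "set_integrable lborel {s<..} ?r" "(LBINT x:{s<..}. ?r x) = s powr (- \<sigma>)"
  proof -
    have *: "(\<lambda>x. indicator {0<..} x *\<^sub>R (indicator {s<..} x * ?r x)) = (\<lambda>x. indicator {s<..} x *\<^sub>R ?r x)"
      using s by (auto simp: fun_eq_iff indicator_def)
    show "set_integrable lborel {s<..} ?r"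
      using set_integrable_stable_tail[OF \<sigma> s] .
    have "measure (stable_intensity \<sigma>) {s<..} = (\<integral>x. indicator {s<..} x \<partial>stable_intensity \<sigma>)"
      by (simp add: stable_intensity_def)
    also have "\<dots> = (LBINT x:{s<..}. ?r x)"
      unfolding set_lebesgue_integral_def *[symmetric]
      by (subst integrable_stable_intensity(2)[OF \<sigma>]) (auto simp: set_lebesgue_integral_def)
    finally show "(LBINT x:{s<..}. ?r x) = s powr (- \<sigma>)"
      by (simp add: emeasure_stable_intensity_greaterThan[OF \<sigma> s] measure_def)
  qed
  have split: "{0<..} = {0<..s} \<union> {s<..}"
    using s by auto
  have int1: "set_integrable lborel {0<..s} (\<lambda>x. ?f x * ?r x)"
    using g_int[of s] by (rule set_integrable_cong[THEN iffD1, rotated -1]) (auto simp: indicator_def)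
  have int2: "set_integrable lborel {s<..} (\<lambda>x. ?f x * ?r x)"
    using tail(1) by (rule set_integrable_cong[THEN iffD1, rotated -1]) (auto simp: indicator_def)
  have f_int: "integrable (stable_intensity \<sigma>) ?f"
    unfolding integrable_stable_intensity(1)[OF \<sigma>] split
    using int1 int2 by (auto intro!: set_integrable_Un)
  have "(\<integral>x. ?f x \<partial>stable_intensity \<sigma>) = (LBINT x:{0<..s} \<union> {s<..}. ?f x * ?r x)"
    unfolding split[symmetric] by (rule integrable_stable_intensity(2)[OF \<sigma>]) measurable
  also have "\<dots> = (LBINT x:{0<..s}. ?f x * ?r x) + (LBINT x:{s<..}. ?f x * ?r x)"
    using int1 int2 by (intro set_integral_Un) auto
  also have "(LBINT x:{0<..s}. ?f x * ?r x) = thinned_mass s"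
    by (intro set_lebesgue_integral_cong) auto
  also have "(LBINT x:{s<..}. ?f x * ?r x) = (LBINT x:{s<..}. ?r x)"
    by (intro set_lebesgue_integral_cong) auto
  finally have f_eq: "(\<integral>x. ?f x \<partial>stable_intensity \<sigma>) = thinned_mass s + s powr (- \<sigma>)"
    using tail(2) by simp
  have "(\<integral>w. indicator {..s} (\<Delta> 0 w) * iprod (\<lambda>n. g (\<Delta> n w)) \<partial>P) = (\<integral>w. iprod (\<lambda>n. 1 - ?f (\<Delta> n w)) \<partial>P)"
  proof (rule integral_cong_AE)
    show "AE w in P. indicator {..s} (\<Delta> 0 w) * iprod (\<lambda>n. g (\<Delta> n w)) = iprod (\<lambda>n. 1 - ?f (\<Delta> n w))"
      using AE_antimono
    proof eventually_elim
      case (elim w)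
      show ?case
      proof (cases "\<Delta> 0 w \<le> s")
        case True
        then have "\<Delta> n w \<le> s" for n
          using elim by (meson le0 order_trans)
        with True show ?thesis
          by simp
      next
        case False
        then have "iprod (\<lambda>n. 1 - ?f (\<Delta> n w)) = 0"
          using g01 by (intro iprod_zero[of _ 0]) (auto simp: indicator_def intro: less_imp_le)
        with False show ?thesis
          by simp
      qed
    qed
  qed auto
  also have "\<dots> = exp (- (\<integral>x. ?f x \<partial>stable_intensity \<sigma>))"
    using g01 by (intro poisson_points_laplace[OF pp f_int]) (auto simp: indicator_def intro: less_imp_le)
  finally show ?thesis
    by (simp only: f_eq)
qed

lemma thinned_mass_nonneg: "0 \<le> thinned_mass u"
  using g01 \<sigma> by (auto simp: set_lebesgue_integral_def intro!: integral_nonneg_AE)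

text \<open>The thinned mass contributes \<open>- (1 - g x)\<close> and the shrinking tail
  \<open>+ 1\<close> times the rate; together they leave the factor \<open>g x\<close>.\<close>

lemma max_laplace_derivative:
  assumes "0 < x"
  shows "(max_laplace has_real_derivative g x * stable_rate \<sigma> x * max_laplace x) (at x)"
proof -
  have "continuous_on {0<..} (\<lambda>x. (1 - g x) * stable_rate \<sigma> x)"
    by (intro continuous_intros g_cont) auto
  from has_real_derivative_integral_Ioc[OF this g_int assms] has_real_derivative_powr_minus[OF assms, of \<sigma>]
  have "((\<lambda>u. - (thinned_mass u + u powr (- \<sigma>))) has_real_derivative
      - ((1 - g x) * stable_rate \<sigma> x + - (stable_rate \<sigma> x))) (at x)"
    by (intro DERIV_minus DERIV_add)
  from DERIV_fun_exp[OF this] show ?thesis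
    by (rule DERIV_cong) (simp add: left_diff_distrib mult.commute)
qed

text \<open>The fundamental theorem on (0, s). There is no boundary term at 0: the thinned mass is
  nonnegative and the tail mass tends to infinity, so \<open>max_laplace\<close> tends to 0.\<close>

lemma nn_integral_max_laplace_derivative:
  assumes s: "0 < s"
  shows "(\<integral>\<^sup>+x. ennreal (g x * (stable_rate \<sigma> x * indicator {0<..} x) * max_laplace x) * indicator {..s} x \<partial>lborel)
    = ennreal (max_laplace s)"
proof -
  let ?l = "\<lambda>x. g x * stable_rate \<sigma> x * max_laplace x"
  have cL: "isCont max_laplace x" if "0 < x" for x
    using max_laplace_derivative[OF that] by (rule DERIV_isCont)
  have lim0: "(max_laplace \<longlongrightarrow> 0) (at_right 0)"
  proof (rule tendsto_sandwich[of "\<lambda>_. 0" _ _ "\<lambda>x. exp (- (x powr (- \<sigma>)))"])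
    have "filterlim (\<lambda>x::real. - (x powr (- \<sigma>))) at_bot (at_right 0)"
      using filterlim_powr_minus_at_right_0[OF \<sigma>] by (simp add: filterlim_uminus_at_bot)
    then show "((\<lambda>x. exp (- (x powr (- \<sigma>)))) \<longlongrightarrow> 0) (at_right 0)"
      by (rule filterlim_compose[OF exp_at_bot])
  qed (use thinned_mass_nonneg in auto)
  have e: "einterval (ereal 0) (ereal s) = {0<..<s}"
    by (auto simp: einterval_def)
  have cl: "isCont ?l x" if "ereal 0 < ereal x" for x
  proof (intro isCont_mult cL)
    show "isCont g x"
      using g_cont that by (simp add: continuous_on_eq_continuous_at)
    show "isCont (\<lambda>x. x powr (- 1 - \<sigma>)) x"
      using that by (intro continuous_intros) auto
  qed (use that in auto)
  have lim1: "((max_laplace \<circ> real_of_ereal) \<longlongrightarrow> 0) (at_right (ereal 0))"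
    using lim0 unfolding ereal_tendsto_simps by simp
  have lim2: "((max_laplace \<circ> real_of_ereal) \<longlongrightarrow> max_laplace s) (at_left (ereal s))"
    using cL[OF s] unfolding ereal_tendsto_simps by (simp add: isCont_def filterlim_at_split)
  have "0 \<le> ?l x" for x
    using g01[of x] \<sigma> by (auto intro!: mult_nonneg_nonneg)
  then have nn: "AE x in lborel. ereal 0 < ereal x \<longrightarrow> ereal x < ereal s \<longrightarrow> 0 \<le> ?l x"
    by simp
  have "ereal 0 < ereal s"
    using s by simp
  note FTC = interval_integral_FTC_nonneg[OF this _ _ nn lim1 lim2]
  have *: "set_integrable lborel (einterval (ereal 0) (ereal s)) ?l"
    using cl by (intro FTC(1) max_laplace_derivative) auto
  have **: "(LBINT x=ereal 0..ereal s. ?l x) = max_laplace s - 0"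
    using cl by (intro FTC(2) max_laplace_derivative) auto
  have "(\<integral>\<^sup>+x. ennreal (g x * (stable_rate \<sigma> x * indicator {0<..} x) * max_laplace x) * indicator {..s} x \<partial>lborel)
      = (\<integral>\<^sup>+x. ennreal (indicator {0<..<s} x * ?l x) \<partial>lborel)"
  proof (rule nn_integral_cong_AE)
    show "AE x in lborel. ennreal (g x * (stable_rate \<sigma> x * indicator {0<..} x) * max_laplace x) * indicator {..s} x
        = ennreal (indicator {0<..<s} x * ?l x)"
      using AE_lborel_singleton[of s] by eventually_elim (auto simp: indicator_def)
  qed
  also have "\<dots> = ennreal (\<integral>x. indicator {0<..<s} x * ?l x \<partial>lborel)"
    using * g01 \<sigma> unfolding e set_integrable_def
    by (intro nn_integral_eq_integral) (auto intro!: AE_I2 mult_nonneg_nonneg intro: less_imp_le)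
  also have "(\<integral>x. indicator {0<..<s} x * ?l x \<partial>lborel) = max_laplace s"
    using ** s by (simp add: interval_lebesgue_integral_def e set_lebesgue_integral_def)
  finally show ?thesis .
qed

lemma borel_measurable_thinned_mass [measurable]: "thinned_mass \<in> borel_measurable borel"
proof -
  have "thinned_mass = (\<lambda>u. \<integral>x. (if 0 < x \<and> x \<le> u then (1 - g x) * stable_rate \<sigma> x else 0) \<partial>lborel)"
    by (auto simp: set_lebesgue_integral_def fun_eq_iff intro!: Bochner_Integration.integral_cong)
  then show ?thesis
    by simp
qed

text \<open>The Laplace functional of \<open>g\<close> restricted to \<open>(0, s]\<close> is a distribution function in \<open>s\<close>.
  Dividing its density by \<open>g (\<Delta> 0)\<close> gives the Laplace functional of the remaining points jointly
  with \<open>\<Delta> 0\<close>.\<close>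

lemma distr_max_weighted:
  "distr (density P (\<lambda>w. ennreal (iprod (\<lambda>n. g (\<Delta> n w))))) borel (\<Delta> 0)
    = density lborel (\<lambda>x. ennreal (g x * (stable_rate \<sigma> x * indicator {0<..} x) * max_laplace x))"
  (is "?Q = ?R")
proof (rule measure_eqI_generator_eq[where E = "range atMost" and \<Omega> = UNIV and A = "\<lambda>n. {..real n}"])
  have g01': "g x \<in> {0..1}" for x
    using g01[of x] by auto
  have eq: "emeasure ?Q {..s} = emeasure ?R {..s} \<and> emeasure ?Q {..s} \<noteq> \<infinity>" for s
  proof -
    have "emeasure ?Q {..s} = (\<integral>\<^sup>+w. ennreal (iprod (\<lambda>n. g (\<Delta> n w))) * indicator (\<Delta> 0 -` {..s} \<inter> space P) w \<partial>P)"
      by (simp add: emeasure_distr emeasure_density)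
    also have "\<dots> = (\<integral>\<^sup>+w. ennreal (indicator {..s} (\<Delta> 0 w) * iprod (\<lambda>n. g (\<Delta> n w))) \<partial>P)"
      by (intro nn_integral_cong) (auto simp: indicator_def)
    finally have Q: "emeasure ?Q {..s} = (\<integral>\<^sup>+w. ennreal (indicator {..s} (\<Delta> 0 w) * iprod (\<lambda>n. g (\<Delta> n w))) \<partial>P)" .
    have R: "emeasure ?R {..s} = (\<integral>\<^sup>+x. ennreal (g x * (stable_rate \<sigma> x * indicator {0<..} x) * max_laplace x) * indicator {..s} x \<partial>lborel)"
      by (subst emeasure_density) auto
    show ?thesis
    proof (cases "0 < s")
      case True
      have "emeasure ?Q {..s} = ennreal (\<integral>w. indicator {..s} (\<Delta> 0 w) * iprod (\<lambda>n. g (\<Delta> n w)) \<partial>P)"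
        unfolding Q using iprod_in_unit_interval[OF g01']
        by (intro nn_integral_eq_integral integrable_const_bound[where B = 1]) (auto simp: indicator_def)
      then show ?thesis
        unfolding R nn_integral_max_laplace_derivative[OF True] laplace_max_le[OF True] by simp
    next
      case False
      have "emeasure ?Q {..s} = (\<integral>\<^sup>+w. 0 \<partial>P)"
        unfolding Q
      proof (rule nn_integral_cong_AE)
        show "AE w in P. ennreal (indicator {..s} (\<Delta> 0 w) * iprod (\<lambda>n. g (\<Delta> n w))) = 0"
          using AE_positive
        proof eventually_elim
          case (elim w)
          then have "s < \<Delta> 0 w"
            using False by (meson not_less order_le_less_trans)
          then show ?case by simp
        qed
      qed
      moreover have "emeasure ?R {..s} = (\<integral>\<^sup>+x. 0 \<partial>(lborel :: real measure))"
        unfolding R using False by (intro nn_integral_cong) (auto simp: indicator_def)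
      ultimately show ?thesis
        by simp
    qed
  qed
  show "emeasure ?Q X = emeasure ?R X" if "X \<in> range atMost" for X
    using eq that by auto
  show "emeasure ?Q {..real n} \<noteq> \<infinity>" for n
    using eq by blast
  show "(\<Union>i. {..real i}) = UNIV"
    using real_arch_simple by auto
  have "{..a} \<inter> {..b} = {..min a b}" for a b :: real
    by auto
  then show "Int_stable (range (atMost :: real \<Rightarrow> real set))"
    by (auto simp: Int_stable_def)
  show "sets ?Q = sigma_sets UNIV (range atMost)" "sets ?R = sigma_sets UNIV (range atMost)"
    by (simp_all add: borel_eq_atMost)
qed auto

text \<open>Here \<open>g\<close> has to be strictly positive: \<open>iprod_Suc\<close> splits off
  the factor of the largest point, which is then divided out on both sides.\<close>

lemma nn_integral_max_times_iprod_rest: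
  assumes [measurable]: "B \<in> sets borel"
  shows "(\<integral>\<^sup>+w. indicator B (\<Delta> 0 w) * ennreal (iprod (\<lambda>n. g (\<Delta> (Suc n) w))) \<partial>P)
    = (\<integral>\<^sup>+x. ennreal ((stable_rate \<sigma> x * indicator {0<..} x) * max_laplace x) * indicator B x \<partial>lborel)"
proof -
  have g01': "g x \<in> {0..1}" for x
    using g01[of x] by auto
  have "(\<integral>\<^sup>+w. indicator B (\<Delta> 0 w) * ennreal (iprod (\<lambda>n. g (\<Delta> (Suc n) w))) \<partial>P)
      = (\<integral>\<^sup>+w. ennreal (iprod (\<lambda>n. g (\<Delta> n w))) * (indicator B (\<Delta> 0 w) * ennreal (1 / g (\<Delta> 0 w))) \<partial>P)"
  proof (intro nn_integral_cong)
    fix w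
    have "ennreal (iprod (\<lambda>n. g (\<Delta> n w))) * ennreal (1 / g (\<Delta> 0 w)) = ennreal (iprod (\<lambda>n. g (\<Delta> (Suc n) w)))"
      using iprod_in_unit_interval[of "\<lambda>n. g (\<Delta> n w)"] g01'
      by (subst ennreal_mult'[symmetric])
        (use g01[of "\<Delta> 0 w"] in \<open>auto simp: iprod_Suc[of "\<lambda>n. g (\<Delta> n w)"]\<close>)
    then show "indicator B (\<Delta> 0 w) * ennreal (iprod (\<lambda>n. g (\<Delta> (Suc n) w)))
        = ennreal (iprod (\<lambda>n. g (\<Delta> n w))) * (indicator B (\<Delta> 0 w) * ennreal (1 / g (\<Delta> 0 w)))"
      by (metis mult.left_commute)
  qed
  also have "\<dots> = (\<integral>\<^sup>+x. indicator B x * ennreal (1 / g x)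
      \<partial>distr (density P (\<lambda>w. ennreal (iprod (\<lambda>n. g (\<Delta> n w))))) borel (\<Delta> 0))"
    by (simp add: nn_integral_distr nn_integral_density)
  also have "\<dots> = (\<integral>\<^sup>+x. ennreal (g x * (stable_rate \<sigma> x * indicator {0<..} x) * max_laplace x) *
      (indicator B x * ennreal (1 / g x)) \<partial>lborel)"
    unfolding distr_max_weighted by (subst nn_integral_density) auto
  also have "\<dots> = (\<integral>\<^sup>+x. ennreal ((stable_rate \<sigma> x * indicator {0<..} x) * max_laplace x) * indicator B x \<partial>lborel)"
  proof (intro nn_integral_cong)
    fix x
    let ?h = "(stable_rate \<sigma> x * indicator {0<..} x) * max_laplace x"
    have "ennreal (g x * ?h) * ennreal (1 / g x) = ennreal ?h"
      using g01[of x] \<sigma> by (subst ennreal_mult'[symmetric]) (auto simp: less_imp_neq)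
    then show "ennreal (g x * (stable_rate \<sigma> x * indicator {0<..} x) * max_laplace x) *
        (indicator B x * ennreal (1 / g x)) = ennreal ?h * indicator B x"
      by (simp only: mult.assoc mult.left_commute[of _ "indicator B x"]) (simp only: mult.commute[of _ "indicator B x"])
  qed
  finally show ?thesis .
qed

end

lemma distr_max: "distr P borel (\<Delta> 0) = density lborel (\<lambda>x. ennreal (f_jump \<sigma> x))"
proof -
  have "distr (density P (\<lambda>w. ennreal (iprod (\<lambda>n. 1)))) borel (\<Delta> 0)
      = density lborel (\<lambda>x. ennreal (1 * (stable_rate \<sigma> x * indicator {0<..} x) *
        exp (- ((LBINT t:{0<..x}. (1 - 1) * stable_rate \<sigma> t) + x powr (- \<sigma>)))))"
    by (rule distr_max_weighted) (auto simp: set_integrable_def)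
  moreover have "density P (\<lambda>w. ennreal (iprod (\<lambda>n. 1))) = P"
    by (simp add: density_1)
  ultimately show ?thesis
    by (simp add: f_jump_def mult_ac)
qed

lemma f_jump_pos: "0 < x \<Longrightarrow> 0 < f_jump \<sigma> x"
  using \<sigma> by (simp add: f_jump_def)

text \<open>Since a later point is \<open>\<Delta> 0\<close> times its ratio, the joint Laplace
  functional can be computed through \<open>G\<close> or through the previous lemma. This gives two
  densities of one measure, and \<open>f_jump\<close> cancels because it is positive. The
  exceptional null set depends on \<open>g\<close>.\<close>

lemma AE_kernel_iprod_scaled:
  fixes g :: "real \<Rightarrow> real"
  assumes [measurable]: "g \<in> borel_measurable borel"
    and g01: "\<And>x. g x \<in> {0<..1}"
    and g_cont: "continuous_on {0<..} g"
    and g_int: "\<And>u. set_integrable lborel {0<..u} (\<lambda>x. (1 - g x) * stable_rate \<sigma> x)"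
    and G[measurable]: "G \<in> borel \<rightarrow>\<^sub>M prob_algebra real_seq"
    and law: "has_cond_law P (\<Delta> 0) borel (\<lambda>w n. \<Delta> (Suc n) w / \<Delta> 0 w) real_seq G"
  shows "AE s in lborel. 0 < s \<longrightarrow> (\<integral>\<^sup>+x. ennreal (iprod (\<lambda>n. g (s * x n))) \<partial>G s)
    = ennreal (exp (- (LBINT x:{0<..s}. (1 - g x) * stable_rate \<sigma> x)))"
proof -
  let ?J = "\<lambda>s. LBINT x:{0<..s}. (1 - g x) * stable_rate \<sigma> x"
  let ?\<Phi> = "\<lambda>s. \<integral>\<^sup>+x. ennreal (iprod (\<lambda>n. g (s * x n))) \<partial>G s"
  have [measurable]: "?J \<in> borel_measurable borel"
    by (rule borel_measurable_thinned_mass) fact+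
  have F[measurable]: "(\<lambda>(s, x). ennreal (iprod (\<lambda>n. g (s * x n)))) \<in> borel_measurable (borel \<Otimes>\<^sub>M real_seq)"
    by measurable
  have [measurable]: "?\<Phi> \<in> borel_measurable borel"
    using nn_integral_measurable_subprob_algebra2[OF F measurable_prob_algebraD[OF G]] .
  have "density lborel (\<lambda>s. ennreal (f_jump \<sigma> s) * ?\<Phi> s)
      = density lborel (\<lambda>s. ennreal ((stable_rate \<sigma> s * indicator {0<..} s) * exp (- (?J s + s powr (- \<sigma>)))))"
  proof (rule measure_eqI)
    fix B assume "B \<in> sets (density lborel (\<lambda>s. ennreal (f_jump \<sigma> s) * ?\<Phi> s))"
    then have [measurable]: "B \<in> sets borel"
      by simp
    have FB: "(\<lambda>(s, x). indicator B s * ennreal (iprod (\<lambda>n. g (s * x n)))) \<in> borel_measurable (borel \<Otimes>\<^sub>M real_seq)"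
      by measurable
    have "emeasure (density lborel (\<lambda>s. ennreal (f_jump \<sigma> s) * ?\<Phi> s)) B
        = (\<integral>\<^sup>+s. ennreal (f_jump \<sigma> s) * (indicator B s * ?\<Phi> s) \<partial>lborel)"
      by (subst emeasure_density) (auto simp: f_jump_def mult_ac)
    also have "\<dots> = (\<integral>\<^sup>+s. indicator B s * ?\<Phi> s \<partial>distr P borel (\<Delta> 0))"
      unfolding distr_max by (subst nn_integral_density) (auto simp: f_jump_def)
    also have "\<dots> = (\<integral>\<^sup>+w. (\<integral>\<^sup>+x. indicator B (\<Delta> 0 w) * ennreal (iprod (\<lambda>n. g (\<Delta> 0 w * x n))) \<partial>G (\<Delta> 0 w)) \<partial>P)"
    proof (subst nn_integral_distr, simp, simp, intro nn_integral_cong)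
      fix w
      have [measurable_cong]: "sets (G (\<Delta> 0 w)) = sets real_seq"
        using measurable_space[OF G, of "\<Delta> 0 w"] by (simp add: space_prob_algebra)
      show "indicator B (\<Delta> 0 w) * ?\<Phi> (\<Delta> 0 w)
          = (\<integral>\<^sup>+x. indicator B (\<Delta> 0 w) * ennreal (iprod (\<lambda>n. g (\<Delta> 0 w * x n))) \<partial>G (\<Delta> 0 w))"
        by (intro nn_integral_cmult[symmetric]) measurable
    qed
    also have "\<dots> = (\<integral>\<^sup>+w. indicator B (\<Delta> 0 w) * ennreal (iprod (\<lambda>n. g (\<Delta> 0 w * (\<Delta> (Suc n) w / \<Delta> 0 w)))) \<partial>P)"
      by (rule has_cond_law_nn_integral[OF law G FB, symmetric])
    also have "\<dots> = (\<integral>\<^sup>+w. indicator B (\<Delta> 0 w) * ennreal (iprod (\<lambda>n. g (\<Delta> (Suc n) w))) \<partial>P)"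
    proof (rule nn_integral_cong_AE)
      show "AE w in P. indicator B (\<Delta> 0 w) * ennreal (iprod (\<lambda>n. g (\<Delta> 0 w * (\<Delta> (Suc n) w / \<Delta> 0 w))))
          = indicator B (\<Delta> 0 w) * ennreal (iprod (\<lambda>n. g (\<Delta> (Suc n) w)))"
        using AE_positive
      proof eventually_elim
        case (elim w)
        then have "\<Delta> 0 w \<noteq> 0"
          by (metis less_irrefl)
        then show ?case by simp
      qed
    qed
    also have "\<dots> = (\<integral>\<^sup>+s. ennreal ((stable_rate \<sigma> s * indicator {0<..} s) * exp (- (?J s + s powr (- \<sigma>)))) * indicator B s \<partial>lborel)"
      by (rule nn_integral_max_times_iprod_rest) (use assms in auto)
    also have "\<dots> = emeasure (density lborel (\<lambda>s. ennreal ((stable_rate \<sigma> s * indicator {0<..} s) * exp (- (?J s + s powr (- \<sigma>)))))) B"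
      by (subst emeasure_density) auto
    finally show "emeasure (density lborel (\<lambda>s. ennreal (f_jump \<sigma> s) * ?\<Phi> s)) B
        = emeasure (density lborel (\<lambda>s. ennreal ((stable_rate \<sigma> s * indicator {0<..} s) * exp (- (?J s + s powr (- \<sigma>)))))) B" .
  qed simp
  then have "AE s in lborel. ennreal (f_jump \<sigma> s) * ?\<Phi> s
      = ennreal ((stable_rate \<sigma> s * indicator {0<..} s) * exp (- (?J s + s powr (- \<sigma>))))"
    by (intro sigma_finite_measure.density_unique[OF sigma_finite_lborel]) (auto simp: f_jump_def)
  then show ?thesis
  proof eventually_elim
    case (elim s)
    show ?case
    proof
      assume s: "0 < s"
      have "(stable_rate \<sigma> s * indicator {0<..} s) * exp (- (?J s + s powr (- \<sigma>))) = f_jump \<sigma> s * exp (- ?J s)"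
        using s by (simp add: f_jump_def exp_add[symmetric] algebra_simps)
      then have "ennreal (f_jump \<sigma> s) * ?\<Phi> s = ennreal (f_jump \<sigma> s) * ennreal (exp (- ?J s))"
        using elim f_jump_pos[OF s] by (simp add: ennreal_mult)
      then show "?\<Phi> s = ennreal (exp (- ?J s))"
        using f_jump_pos[OF s] by (subst (asm) ennreal_mult_cancel_left) auto
    qed
  qed
qed

end

section \<open>Products over the ratios given the largest point\<close>

definition stable_mass :: "real \<Rightarrow> (real \<Rightarrow> real) \<Rightarrow> real" where
  "stable_mass \<sigma> f = (LBINT x:{0<..<1}. f x * stable_rate \<sigma> x)"

text \<open>The rate is homogeneous of degree \<open>- 1 - \<sigma>\<close> and the substitution
  \<open>x = s * y\<close> adds one. Hence the size of the largest point enters the exponent only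
  through \<open>s powr (- \<sigma>)\<close>.\<close>

lemma stable_mass_scale:
  assumes s: "0 < s"
  shows "(LBINT x:{0<..<s}. f (x / s) * stable_rate \<sigma> x) = s powr (- \<sigma>) * stable_mass \<sigma> f"
proof -
  have "(LBINT x:{0<..<s}. f (x / s) * stable_rate \<sigma> x)
      = s * (\<integral>y. indicator {0<..<s} (0 + s * y) * (f ((0 + s * y) / s) * (\<sigma> * (0 + s * y) powr (- 1 - \<sigma>))) \<partial>lborel)"
    unfolding set_lebesgue_integral_def using s
    by (subst lborel_integral_real_affine[where c = s and t = 0]) auto
  also have "\<dots> = s * (\<integral>y. s powr (- 1 - \<sigma>) * (indicator {0<..<1} y * (f y * stable_rate \<sigma> y)) \<partial>lborel)"
  proof -
    have "indicator {0<..<s} (0 + s * y) * (f ((0 + s * y) / s) * (\<sigma> * (0 + s * y) powr (- 1 - \<sigma>)))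
        = s powr (- 1 - \<sigma>) * (indicator {0<..<1} y * (f y * stable_rate \<sigma> y))" for y
      using s by (auto simp: indicator_def powr_mult zero_less_mult_iff)
    then show ?thesis
      by (simp only:)
  qed
  also have "\<dots> = (s * s powr (- 1 - \<sigma>)) * stable_mass \<sigma> f"
    by (simp add: stable_mass_def set_lebesgue_integral_def)
  also have "s * s powr (- 1 - \<sigma>) = s powr (- \<sigma>)"
  proof -
    have "s * s powr (- 1 - \<sigma>) = s powr 1 * s powr (- 1 - \<sigma>)"
      using s by simp
    then show ?thesis
      by (simp only: powr_add[symmetric]) simp
  qed
  finally show ?thesis .
qed

lemma ratio_kernelE:
  assumes "ratio_kernel \<sigma> G" "0 < \<sigma>"
  obtains P :: "(nat \<Rightarrow> real) measure" and \<Delta> where "stable_points P \<Delta> \<sigma>" "G \<in> borel \<rightarrow>\<^sub>M prob_algebra real_seq"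
    "has_cond_law P (\<Delta> 0) borel (\<lambda>w n. \<Delta> (Suc n) w / \<Delta> 0 w) real_seq G"
  using assms by (auto simp: ratio_kernel_def stable_points_def)

lemma sets_real_seq_null_sequences:
  "{x \<in> space real_seq. (\<forall>n. 0 < x n \<and> x n < 1) \<and> x \<longlonglongrightarrow> 0} \<in> sets real_seq"
proof -
  have "x \<longlonglongrightarrow> 0 \<longleftrightarrow> (\<forall>k. \<exists>N. \<forall>n. N \<le> n \<longrightarrow> \<bar>x n\<bar> < 1 / real (Suc k))" (is "_ \<longleftrightarrow> ?R x")
    for x :: "nat \<Rightarrow> real"
  proof
    show "x \<longlonglongrightarrow> 0 \<Longrightarrow> ?R x"
      unfolding lim_sequentially dist_real_def by auto
    assume R: "?R x"
    show "x \<longlonglongrightarrow> 0"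
      unfolding lim_sequentially dist_real_def
    proof (intro allI impI)
      fix r :: real assume "0 < r"
      then obtain k where "1 / real (Suc k) < r"
        using nat_approx_posE by blast
      then show "\<exists>no. \<forall>n\<ge>no. \<bar>x n - 0\<bar> < r"
        using R[rule_format, of k] by force
    qed
  qed
  then show ?thesis
    by simp
qed

text \<open>As \<open>f_jump\<close> is positive on the positive half-line, almost sure statements
  about the ratios hold under \<open>G s\<close> for Lebesgue almost every \<open>s > 0\<close>. In
  this form they apply to \<open>D\<close>, whose law is not that of \<open>\<Delta> 0\<close> but
  also has a Lebesgue density.\<close>

lemma ratio_kernel_AE_range:
  assumes "ratio_kernel \<sigma> G" "0 < \<sigma>"
  shows "AE s in lborel. 0 < s \<longrightarrow> (AE x in G s. (\<forall>n. 0 < x n \<and> x n < 1) \<and> x \<longlonglongrightarrow> 0)"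
proof -
  obtain P :: "(nat \<Rightarrow> real) measure" and \<Delta> where sp: "stable_points P \<Delta> \<sigma>" and G[measurable]: "G \<in> borel \<rightarrow>\<^sub>M prob_algebra real_seq"
    and law: "has_cond_law P (\<Delta> 0) borel (\<lambda>w n. \<Delta> (Suc n) w / \<Delta> 0 w) real_seq G"
    using ratio_kernelE[OF assms] .
  interpret stable_points P \<Delta> \<sigma> by fact
  let ?S = "{x \<in> space real_seq. (\<forall>n. 0 < x n \<and> x n < 1) \<and> x \<longlonglongrightarrow> 0}"
  have [measurable]: "?S \<in> sets real_seq"
    by (rule sets_real_seq_null_sequences)
  have S_compl: "- ?S \<in> sets real_seq"
  proof -
    have "- ?S = space real_seq - ?S"
      by (auto simp: space_PiM)
    then show ?thesis by simp
  qed
  have [measurable]: "(\<lambda>s. emeasure (G s) (- ?S)) \<in> borel_measurable borel"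
    using measurable_emeasure_kernel[OF measurable_prob_algebraD[OF G] S_compl] .
  have setsG: "sets (G s) = sets real_seq" for s
    using measurable_space[OF G, of s] by (simp add: space_prob_algebra)
  have "(\<integral>\<^sup>+s. ennreal (f_jump \<sigma> s) * emeasure (G s) (- ?S) \<partial>lborel) = (\<integral>\<^sup>+s. emeasure (G s) (- ?S) \<partial>distr P borel (\<Delta> 0))"
    unfolding distr_max by (subst nn_integral_density) (auto simp: f_jump_def)
  also have "\<dots> = (\<integral>\<^sup>+w. (\<integral>\<^sup>+x. indicator (- ?S) x \<partial>G (\<Delta> 0 w)) \<partial>P)"
    using S_compl by (subst nn_integral_distr) (auto simp: setsG)
  also have "\<dots> = (\<integral>\<^sup>+w. indicator (- ?S) (\<lambda>n. \<Delta> (Suc n) w / \<Delta> 0 w) \<partial>P)"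
    using S_compl by (intro has_cond_law_nn_integral[OF law G, symmetric]) measurable
  also have "\<dots> = (\<integral>\<^sup>+w. 0 \<partial>P)"
  proof (rule nn_integral_cong_AE)
    show "AE w in P. indicator (- ?S) (\<lambda>n. \<Delta> (Suc n) w / \<Delta> 0 w) = (0 :: ennreal)"
      using AE_positive AE_tendsto_0 AE_antimono decreasing
    proof eventually_elim
      case (elim w)
      have "\<Delta> (Suc n) w < \<Delta> 0 w" for n
        using elim(3,4) by (meson le0 order_less_le_trans)
      moreover have "(\<lambda>n. \<Delta> (Suc n) w / \<Delta> 0 w) \<longlonglongrightarrow> 0 / \<Delta> 0 w"
        using elim(1)[rule_format, of 0] elim(2) by (intro tendsto_intros LIMSEQ_Suc) auto
      ultimately have "(\<lambda>n. \<Delta> (Suc n) w / \<Delta> 0 w) \<in> ?S"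
        using elim(1) by (auto simp: space_PiM)
      then show ?case by simp
    qed
  qed
  finally have "(\<integral>\<^sup>+s. ennreal (f_jump \<sigma> s) * emeasure (G s) (- ?S) \<partial>lborel) = 0"
    by simp
  then have "AE s in lborel. ennreal (f_jump \<sigma> s) * emeasure (G s) (- ?S) = 0"
    by (subst (asm) nn_integral_0_iff_AE) (auto simp: f_jump_def)
  then show ?thesis
  proof eventually_elim
    case (elim s)
    show ?case
    proof
      assume "0 < s"
      then have "emeasure (G s) (- ?S) = 0"
        using elim f_jump_pos[of s] by auto
      then show "AE x in G s. (\<forall>n. 0 < x n \<and> x n < 1) \<and> x \<longlonglongrightarrow> 0"
        using S_compl by (intro AE_I[where N = "- ?S"]) (auto simp: setsG space_PiM)
    qed
  qed
qed

text \<open>The functions \<open>x \<mapsto> \<gamma> (x / b)\<close> with rational \<open>b\<close> form a countable family, so one null set of \<open>s\<close>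
  suffices for all of them; then \<open>b\<close> decreases to \<open>s\<close>.  The cutoff makes the products finite, so
  continuity of \<open>\<gamma>\<close> is enough for the limit.\<close>

lemma ratio_kernel_iprod_cutoff:
  assumes rk: "ratio_kernel \<sigma> G" and \<sigma>: "0 < \<sigma>"
    and [measurable]: "\<gamma> \<in> borel_measurable borel"
    and \<gamma>01: "\<And>x. \<gamma> x \<in> {0<..1}"
    and cont: "continuous_on {0<..<1} \<gamma>"
    and e: "0 < e" "\<And>x. x \<le> e \<Longrightarrow> \<gamma> x = 1"
  shows "AE s in lborel. 0 < s \<longrightarrow> (\<integral>\<^sup>+x. ennreal (iprod (\<lambda>n. \<gamma> (x n))) \<partial>G s)
    = ennreal (exp (- (s powr (- \<sigma>) * stable_mass \<sigma> (\<lambda>x. 1 - \<gamma> x))))"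
proof -
  obtain P :: "(nat \<Rightarrow> real) measure" and \<Delta> where sp: "stable_points P \<Delta> \<sigma>" and G[measurable]: "G \<in> borel \<rightarrow>\<^sub>M prob_algebra real_seq"
    and law: "has_cond_law P (\<Delta> 0) borel (\<lambda>w n. \<Delta> (Suc n) w / \<Delta> 0 w) real_seq G"
    using ratio_kernelE[OF rk \<sigma>] .
  interpret stable_points P \<Delta> \<sigma> by fact
  let ?r = "\<lambda>x. stable_rate \<sigma> x"
  have \<gamma>01': "\<gamma> x \<in> {0..1}" for x
    using \<gamma>01[of x] by auto
  have iprod01: "0 \<le> iprod (\<lambda>n. \<gamma> (h n))" "iprod (\<lambda>n. \<gamma> (h n)) \<le> 1" for h :: "nat \<Rightarrow> real"
    using iprod_in_unit_interval[of "\<lambda>n. \<gamma> (h n)"] \<gamma>01' by auto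
  \<comment> \<open>\<open>\<gamma>\<close> is continuous only on (0, 1), whereas the scaled
    statement wants continuity on the whole positive half-line. Truncating at \<open>c < b\<close>
    keeps the argument at most \<open>c / b < 1\<close>. Later \<open>s < c\<close>, and since the
    ratios are below 1 the truncation changes nothing.\<close>
  have scaled: "AE s in lborel. 0 < s \<longrightarrow> (\<integral>\<^sup>+x. ennreal (iprod (\<lambda>n. \<gamma> (min (s * x n) c / b))) \<partial>G s)
      = ennreal (exp (- (LBINT x:{0<..s}. (1 - \<gamma> (min x c / b)) * ?r x)))" if cb: "0 < c" "c < b" for c b
  proof (rule AE_kernel_iprod_scaled[of "\<lambda>x. \<gamma> (min x c / b)", OF _ \<gamma>01 _ _ G law])
    show "continuous_on {0<..} (\<lambda>x. \<gamma> (min x c / b))"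
      using cb by (intro continuous_on_compose2[OF cont] continuous_intros) auto
    show "set_integrable lborel {0<..u} (\<lambda>x. (1 - \<gamma> (min x c / b)) * ?r x)" for u
    proof -
      have "set_integrable lborel {e * b<..} ?r"
        using cb e \<sigma> by (intro set_integrable_stable_tail) auto
      then show ?thesis
        unfolding set_integrable_def
      proof (rule Bochner_Integration.integrable_bound)
        show "AE x in lborel. norm (indicator {0<..u} x *\<^sub>R ((1 - \<gamma> (min x c / b)) * ?r x)) \<le> norm (indicator {e * b<..} x *\<^sub>R ?r x)"
        proof (intro AE_I2)
          fix x
          have "\<gamma> (min x c / b) = 1" if "x \<le> e * b"
            using that cb by (intro e(2)) (auto simp: field_simps min_def)
          then show "norm (indicator {0<..u} x *\<^sub>R ((1 - \<gamma> (min x c / b)) * ?r x)) \<le> norm (indicator {e * b<..} x *\<^sub>R ?r x)"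
            using \<gamma>01[of "min x c / b"] \<sigma> by (auto simp: indicator_def abs_mult intro!: mult_left_le_one_le)
        qed
      qed measurable
    qed
  qed measurable
  have "AE s in lborel. \<forall>p::rat \<times> rat. 0 < fst p \<longrightarrow> fst p < snd p \<longrightarrow> 0 < s \<longrightarrow>
      (\<integral>\<^sup>+x. ennreal (iprod (\<lambda>n. \<gamma> (min (s * x n) (of_rat (fst p)) / of_rat (snd p)))) \<partial>G s)
      = ennreal (exp (- (LBINT x:{0<..s}. (1 - \<gamma> (min x (of_rat (fst p)) / of_rat (snd p))) * ?r x)))"
    unfolding AE_all_countable
  proof
    fix p :: "rat \<times> rat"
    show "AE s in lborel. 0 < fst p \<longrightarrow> fst p < snd p \<longrightarrow> 0 < s \<longrightarrow>
      (\<integral>\<^sup>+x. ennreal (iprod (\<lambda>n. \<gamma> (min (s * x n) (of_rat (fst p)) / of_rat (snd p)))) \<partial>G s)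
      = ennreal (exp (- (LBINT x:{0<..s}. (1 - \<gamma> (min x (of_rat (fst p)) / of_rat (snd p))) * ?r x)))"
    proof (cases "0 < fst p \<and> fst p < snd p")
      case True
      then have "0 < (of_rat (fst p) :: real)" "of_rat (fst p) < (of_rat (snd p) :: real)"
        by (auto simp: of_rat_less)
      from scaled[OF this] show ?thesis
        by eventually_elim simp
    qed auto
  qed
  with ratio_kernel_AE_range[OF rk \<sigma>] show ?thesis
  proof eventually_elim
    case (elim s)
    show ?case
    proof
      assume s: "0 < s"
      have "\<exists>c b :: rat. s < of_rat c \<and> (of_rat c :: real) < of_rat b \<and> of_rat b < s + 1 / real (Suc m)" for m
      proof -
        obtain b where b: "s < of_rat b" "of_rat b < s + 1 / real (Suc m)"
          using of_rat_dense[of s "s + 1 / real (Suc m)"] by auto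
        moreover obtain c where "s < of_rat c" "(of_rat c :: real) < of_rat b"
          using of_rat_dense[OF b(1)] by auto
        ultimately show ?thesis by auto
      qed
      then obtain c b :: "nat \<Rightarrow> rat" where cb: "\<And>m. s < of_rat (c m)" "\<And>m. (of_rat (c m) :: real) < of_rat (b m)"
          "\<And>m. of_rat (b m) < s + 1 / real (Suc m)"
        by metis
      define B where "B m = (of_rat (b m) :: real)" for m
      have B: "s < B m" "B m < s + 1 / real (Suc m)" for m
        using cb[of m] by (auto simp: B_def)
      have B_lim: "B \<longlonglongrightarrow> s"
      proof (rule tendsto_sandwich[of "\<lambda>_. s" B sequentially "\<lambda>m. s + 1 / real (Suc m)"])
        show "(\<lambda>m. s + 1 / real (Suc m)) \<longlonglongrightarrow> s"
          using tendsto_add[OF tendsto_const[of s] LIMSEQ_Suc[OF lim_1_over_n]] by simp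
      qed (use B in \<open>auto intro!: always_eventually less_imp_le\<close>)
      have G_space: "prob_space (G s)" and [measurable_cong]: "sets (G s) = sets real_seq"
        using measurable_space[OF G, of s] by (auto simp: space_prob_algebra)
      interpret Gs: prob_space "G s" by fact
      have AE_G: "AE x in G s. (\<forall>n. 0 < x n \<and> x n < 1) \<and> x \<longlonglongrightarrow> 0"
        using elim(1) s by blast
      have int_G: "(\<integral>\<^sup>+x. ennreal (iprod (\<lambda>n. \<gamma> (h (x n)))) \<partial>G s) = ennreal (\<integral>x. iprod (\<lambda>n. \<gamma> (h (x n))) \<partial>G s)"
        if [measurable]: "h \<in> borel_measurable borel" for h
        by (intro nn_integral_eq_integral Gs.integrable_const_bound[where B = 1]) (auto simp: iprod01)
      have eq: "(\<integral>x. iprod (\<lambda>n. \<gamma> (s * x n / B m)) \<partial>G s) = exp (- (LBINT x:{0<..s}. (1 - \<gamma> (x / B m)) * ?r x))" for m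
      proof -
        have rat: "0 < c m" "c m < b m"
        proof -
          have "(0 :: real) < of_rat (c m)"
            using cb(1)[of m] s by linarith
          then show "0 < c m"
            by simp
          show "c m < b m"
            using cb(2)[of m] by (simp add: of_rat_less)
        qed
        have "(\<integral>\<^sup>+x. ennreal (iprod (\<lambda>n. \<gamma> (s * x n / B m))) \<partial>G s)
            = (\<integral>\<^sup>+x. ennreal (iprod (\<lambda>n. \<gamma> (min (s * x n) (of_rat (c m)) / B m))) \<partial>G s)"
        proof (rule nn_integral_cong_AE)
          show "AE x in G s. ennreal (iprod (\<lambda>n. \<gamma> (s * x n / B m))) = ennreal (iprod (\<lambda>n. \<gamma> (min (s * x n) (of_rat (c m)) / B m)))"
            using AE_G
          proof eventually_elim
            case (elim x)
            have "s * x n \<le> of_rat (c m)" for n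
            proof -
              have "s * x n \<le> s"
                using s elim by (intro mult_left_le) (auto intro: less_imp_le)
              then show ?thesis
                using cb(1)[of m] by simp
            qed
            then show ?case
              by (simp add: min_absorb1)
          qed
        qed
        also have "\<dots> = ennreal (exp (- (LBINT x:{0<..s}. (1 - \<gamma> (min x (of_rat (c m)) / B m)) * ?r x)))"
          using elim(2)[rule_format, of "(c m, b m)"] rat s by (simp add: B_def)
        also have "(LBINT x:{0<..s}. (1 - \<gamma> (min x (of_rat (c m)) / B m)) * ?r x) = (LBINT x:{0<..s}. (1 - \<gamma> (x / B m)) * ?r x)"
          using cb(1)[of m] by (intro set_lebesgue_integral_cong) (auto simp: min_absorb1)
        finally show ?thesis
          using int_G[of "\<lambda>y. s * y / B m"] by (simp add: iprod01)
      qed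
      have "(\<lambda>m. \<integral>x. iprod (\<lambda>n. \<gamma> (s * x n / B m)) \<partial>G s) \<longlonglongrightarrow> (\<integral>x. iprod (\<lambda>n. \<gamma> (x n)) \<partial>G s)"
      proof (rule integral_dominated_convergence)
        show "AE x in G s. (\<lambda>m. iprod (\<lambda>n. \<gamma> (s * x n / B m))) \<longlonglongrightarrow> iprod (\<lambda>n. \<gamma> (x n))"
          using AE_G
        proof eventually_elim
          case (elim x)
          then have "\<forall>\<^sub>F n in sequentially. x n < e"
            using e(1) by (intro order_tendstoD) auto
          then obtain N where N: "\<And>n. n \<ge> N \<Longrightarrow> x n < e"
            by (auto simp: eventually_sequentially)
          have le: "s * x n / B m \<le> x n" for n m
          proof -
            have "x n * s \<le> x n * B m"
              using elim B(1)[of m] by (intro mult_left_mono) (auto intro: less_imp_le)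
            then show ?thesis
              using B(1)[of m] s by (simp add: divide_le_eq mult.commute)
          qed
          have 1: "iprod (\<lambda>n. \<gamma> (s * x n / B m)) = (\<Prod>n<N. \<gamma> (s * x n / B m))" for m
          proof (rule iprod_eq_prod)
            fix n assume "n \<notin> {..<N}"
            then have "s * x n / B m \<le> e"
              using le[of n m] N[of n] by simp
            then show "\<gamma> (s * x n / B m) = 1"
              by (rule e(2))
          qed simp
          have 2: "iprod (\<lambda>n. \<gamma> (x n)) = (\<Prod>n<N. \<gamma> (x n))"
            using N e(2) by (intro iprod_eq_prod) (auto simp: not_less intro: less_imp_le)
          have "(\<lambda>m. \<gamma> (s * x n / B m)) \<longlonglongrightarrow> \<gamma> (x n)" for n
          proof (rule isCont_tendsto_compose[where g = \<gamma>])
            show "isCont \<gamma> (x n)"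
              using cont elim by (simp add: continuous_on_eq_continuous_at)
            have "(\<lambda>m. s * x n / B m) \<longlonglongrightarrow> s * x n / s"
              using s by (intro tendsto_intros B_lim) auto
            then show "(\<lambda>m. s * x n / B m) \<longlonglongrightarrow> x n"
              using s by simp
          qed
          then show ?case
            unfolding 1 2 by (intro tendsto_prod)
        qed
        show "AE x in G s. norm (iprod (\<lambda>n. \<gamma> (s * x n / B m))) \<le> 1" for m
          by (simp add: iprod01)
      qed auto
      moreover have "(\<lambda>m. LBINT x:{0<..s}. (1 - \<gamma> (x / B m)) * ?r x) \<longlonglongrightarrow> (LBINT x:{0<..<s}. (1 - \<gamma> (x / s)) * ?r x)"
        unfolding set_lebesgue_integral_def
      proof (rule integral_dominated_convergence)
        \<comment> \<open>Below \<open>e * s\<close> all integrands vanish, because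
          \<open>B m\<close> exceeds \<open>s\<close> and so \<open>x / B m \<le> e\<close>. Away
          from 0 the rate itself is integrable.\<close>
        show "integrable lborel (\<lambda>x. indicator {e * s<..} x *\<^sub>R ?r x)"
          using set_integrable_stable_tail[OF \<sigma>, of "e * s"] e s by (simp add: set_integrable_def)
        show "AE x in lborel. norm (indicator {0<..s} x *\<^sub>R ((1 - \<gamma> (x / B m)) * ?r x)) \<le> indicator {e * s<..} x *\<^sub>R ?r x" for m
        proof (intro AE_I2)
          fix x
          have "\<gamma> (x / B m) = 1" if "x \<le> e * s"
          proof (rule e(2))
            have "x \<le> e * B m"
              using that e(1) B(1)[of m] by (meson less_imp_le mult_left_mono order_trans)
            then show "x / B m \<le> e"
              using B(1)[of m] s by (simp add: divide_le_eq)
          qed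
          then show "norm (indicator {0<..s} x *\<^sub>R ((1 - \<gamma> (x / B m)) * ?r x)) \<le> indicator {e * s<..} x *\<^sub>R ?r x"
            using \<gamma>01[of "x / B m"] \<sigma> by (auto simp: indicator_def abs_mult intro!: mult_left_le_one_le)
        qed
        show "AE x in lborel. (\<lambda>m. indicator {0<..s} x *\<^sub>R ((1 - \<gamma> (x / B m)) * ?r x)) \<longlonglongrightarrow> indicator {0<..<s} x *\<^sub>R ((1 - \<gamma> (x / s)) * ?r x)"
          using AE_lborel_singleton[of s]
        proof eventually_elim
          case (elim x)
          show ?case
          proof (cases "0 < x \<and> x < s")
            case True
            have "(\<lambda>m. \<gamma> (x / B m)) \<longlonglongrightarrow> \<gamma> (x / s)"
            proof (rule isCont_tendsto_compose[where g = \<gamma>])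
              show "isCont \<gamma> (x / s)"
                using cont True s by (simp add: continuous_on_eq_continuous_at)
              show "(\<lambda>m. x / B m) \<longlonglongrightarrow> x / s"
                using s by (intro tendsto_intros B_lim) auto
            qed
            then show ?thesis
              using True by (auto intro!: tendsto_intros)
          qed (use elim in \<open>auto simp: indicator_def\<close>)
        qed
      qed measurable
      then have "(\<lambda>m. exp (- (LBINT x:{0<..s}. (1 - \<gamma> (x / B m)) * ?r x))) \<longlonglongrightarrow> exp (- (LBINT x:{0<..<s}. (1 - \<gamma> (x / s)) * ?r x))"
        by (intro tendsto_intros)
      ultimately have "(\<integral>x. iprod (\<lambda>n. \<gamma> (x n)) \<partial>G s) = exp (- (LBINT x:{0<..<s}. (1 - \<gamma> (x / s)) * ?r x))"
        unfolding eq by (rule LIMSEQ_unique)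
      then show "(\<integral>\<^sup>+x. ennreal (iprod (\<lambda>n. \<gamma> (x n))) \<partial>G s) = ennreal (exp (- (s powr (- \<sigma>) * stable_mass \<sigma> (\<lambda>x. 1 - \<gamma> x))))"
        using int_G[of "\<lambda>y. y"] stable_mass_scale[OF s, of "\<lambda>x. 1 - \<gamma> x" \<sigma>] by simp
    qed
  qed
qed

text \<open>The cutoff is replaced by integrability: weights that are 1 near 0 approach
  \<open>\<gamma>\<close> from above, so the products converge by
  \<open>iprod_tendsto_above\<close>, and \<open>int\<close> dominates the exponents.\<close>

theorem ratio_kernel_iprod:
  assumes rk: "ratio_kernel \<sigma> G" and \<sigma>: "0 < \<sigma>"
    and [measurable]: "\<gamma> \<in> borel_measurable borel"
    and \<gamma>01: "\<And>x. \<gamma> x \<in> {0<..1}"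
    and cont: "continuous_on {0<..<1} \<gamma>"
    and int: "set_integrable lborel {0<..<1} (\<lambda>x. (1 - \<gamma> x) * stable_rate \<sigma> x)"
  shows "AE s in lborel. 0 < s \<longrightarrow> (\<integral>\<^sup>+x. ennreal (iprod (\<lambda>n. \<gamma> (x n))) \<partial>G s)
    = ennreal (exp (- (s powr (- \<sigma>) * stable_mass \<sigma> (\<lambda>x. 1 - \<gamma> x))))"
proof -
  have G[measurable]: "G \<in> borel \<rightarrow>\<^sub>M prob_algebra real_seq"
    using rk by (simp add: ratio_kernel_def)
  \<comment> \<open>A continuous ramp: 0 up to \<open>1 / (k + 1)\<close> and 1 from
    \<open>2 / (k + 1)\<close> on.\<close>
  define ct where "ct k x = min 1 (max 0 (real (Suc k) * x - 1))" for k and x :: real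
  have ct01: "0 \<le> ct k x" "ct k x \<le> 1" for k x
    by (auto simp: ct_def)
  have ct_lim: "(\<lambda>k. ct k x) \<longlonglongrightarrow> 1" if "0 < x" for x
  proof -
    obtain N where N: "2 / x < real N"
      using reals_Archimedean2 by blast
    have "ct k x = 1" if "k \<ge> N" for k
    proof -
      have "2 < real N * x"
        using N \<open>0 < x\<close> by (simp add: divide_less_eq)
      also have "\<dots> \<le> real (Suc k) * x"
        using that \<open>0 < x\<close> by (intro mult_right_mono) auto
      finally show ?thesis
        by (simp add: ct_def)
    qed
    then show ?thesis
      by (intro tendsto_eventually) (auto simp: eventually_sequentially)
  qed
  have [measurable]: "ct k \<in> borel_measurable borel" for k
    unfolding ct_def by measurable
  define \<gamma>' where "\<gamma>' k x = 1 - (1 - \<gamma> x) * ct k x" for k x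
  have \<gamma>'_ge: "\<gamma> x \<le> \<gamma>' k x" for k x
    using \<gamma>01[of x] ct01[where k = k and x = x] by (auto simp: \<gamma>'_def le_diff_eq add.commute dest: mult_left_le[of "ct k x" "1 - \<gamma> x"])
  have \<gamma>'01: "\<gamma>' k x \<in> {0<..1}" for k x
    using \<gamma>'_ge[of x k] \<gamma>01[of x] ct01[where k = k and x = x] by (auto simp: \<gamma>'_def)
  have \<gamma>'_lim: "(\<lambda>k. \<gamma>' k x) \<longlonglongrightarrow> \<gamma> x" if "0 < x" for x
  proof -
    have "(\<lambda>k. \<gamma>' k x) \<longlonglongrightarrow> 1 - (1 - \<gamma> x) * 1"
      unfolding \<gamma>'_def by (intro tendsto_intros ct_lim that)
    then show ?thesis by simp
  qed
  have [measurable]: "\<gamma>' k \<in> borel_measurable borel" for k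
    unfolding \<gamma>'_def by measurable
  have "AE s in lborel. \<forall>k. 0 < s \<longrightarrow> (\<integral>\<^sup>+x. ennreal (iprod (\<lambda>n. \<gamma>' k (x n))) \<partial>G s)
    = ennreal (exp (- (s powr (- \<sigma>) * stable_mass \<sigma> (\<lambda>x. 1 - \<gamma>' k x))))"
    unfolding AE_all_countable
  proof
    fix k
    show "AE s in lborel. 0 < s \<longrightarrow> (\<integral>\<^sup>+x. ennreal (iprod (\<lambda>n. \<gamma>' k (x n))) \<partial>G s)
      = ennreal (exp (- (s powr (- \<sigma>) * stable_mass \<sigma> (\<lambda>x. 1 - \<gamma>' k x))))"
    proof (rule ratio_kernel_iprod_cutoff[OF rk \<sigma> _ \<gamma>'01])
      show "continuous_on {0<..<1} (\<gamma>' k)"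
        unfolding \<gamma>'_def ct_def by (intro continuous_intros cont)
      show "0 < 1 / real (Suc k)"
        by simp
      show "\<gamma>' k x = 1" if "x \<le> 1 / real (Suc k)" for x
        using that by (simp add: \<gamma>'_def ct_def field_simps)
    qed measurable
  qed
  with ratio_kernel_AE_range[OF rk \<sigma>] show ?thesis
  proof eventually_elim
    case (elim s)
    show ?case
    proof
      assume s: "0 < s"
      have "prob_space (G s)" and [measurable_cong]: "sets (G s) = sets real_seq"
        using measurable_space[OF G, of s] by (auto simp: space_prob_algebra)
      interpret Gs: prob_space "G s" by fact
      have iprod01: "0 \<le> iprod (\<lambda>n. f (h n))" "iprod (\<lambda>n. f (h n)) \<le> 1"
        if "\<And>x. f x \<in> {0<..1}" for h :: "nat \<Rightarrow> real" and f :: "real \<Rightarrow> real"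
        using iprod_in_unit_interval[of "\<lambda>n. f (h n)"] that less_imp_le by auto
      have "(\<lambda>k. \<integral>\<^sup>+x. ennreal (iprod (\<lambda>n. \<gamma>' k (x n))) \<partial>G s) \<longlonglongrightarrow> (\<integral>\<^sup>+x. ennreal (iprod (\<lambda>n. \<gamma> (x n))) \<partial>G s)"
      proof (rule nn_integral_dominated_convergence[where w = "\<lambda>_. 1"])
        show "AE x in G s. (\<lambda>k. ennreal (iprod (\<lambda>n. \<gamma>' k (x n)))) \<longlonglongrightarrow> ennreal (iprod (\<lambda>n. \<gamma> (x n)))"
          using elim(1)[rule_format, OF s]
        proof eventually_elim
          case (elim x)
          have "\<gamma> y \<in> {0..1}" "\<gamma>' k y \<in> {0..1}" for k y
            using \<gamma>01[of y] \<gamma>'01[of k y] by auto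
          with elim show ?case
            by (intro tendsto_ennrealI iprod_tendsto_above \<gamma>'_ge \<gamma>'_lim) auto
        qed
        show "AE x in G s. ennreal (iprod (\<lambda>n. \<gamma>' k (x n))) \<le> 1" for k
          using iprod01(2)[OF \<gamma>'01] by (intro AE_I2) simp
      qed (auto simp: Gs.emeasure_space_1)
      moreover have "(\<lambda>k. stable_mass \<sigma> (\<lambda>x. 1 - \<gamma>' k x)) \<longlonglongrightarrow> stable_mass \<sigma> (\<lambda>x. 1 - \<gamma> x)"
        unfolding stable_mass_def set_lebesgue_integral_def
      proof (rule integral_dominated_convergence)
        let ?w = "\<lambda>x. indicator {0<..<1} x *\<^sub>R ((1 - \<gamma> x) * stable_rate \<sigma> x)"
        show "integrable lborel ?w"
          using int by (simp add: set_integrable_def)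
        show "AE x in lborel. norm (indicator {0<..<1} x *\<^sub>R ((1 - \<gamma>' k x) * stable_rate \<sigma> x)) \<le> ?w x" for k
          using \<gamma>'01 \<gamma>'_ge \<sigma> by (intro AE_I2) (auto simp: indicator_def abs_mult intro!: mult_right_mono)
        show "AE x in lborel. (\<lambda>k. indicator {0<..<1} x *\<^sub>R ((1 - \<gamma>' k x) * stable_rate \<sigma> x)) \<longlonglongrightarrow> ?w x"
        proof (intro AE_I2)
          fix x
          show "(\<lambda>k. indicator {0<..<1} x *\<^sub>R ((1 - \<gamma>' k x) * stable_rate \<sigma> x)) \<longlonglongrightarrow> ?w x"
            by (cases "0 < x") (auto intro!: tendsto_intros \<gamma>'_lim)
        qed
      qed measurable
      then have "(\<lambda>k. ennreal (exp (- (s powr (- \<sigma>) * stable_mass \<sigma> (\<lambda>x. 1 - \<gamma>' k x)))))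
          \<longlonglongrightarrow> ennreal (exp (- (s powr (- \<sigma>) * stable_mass \<sigma> (\<lambda>x. 1 - \<gamma> x))))"
        by (intro tendsto_intros tendsto_ennrealI)
      ultimately show "(\<integral>\<^sup>+x. ennreal (iprod (\<lambda>n. \<gamma> (x n))) \<partial>G s)
          = ennreal (exp (- (s powr (- \<sigma>) * stable_mass \<sigma> (\<lambda>x. 1 - \<gamma> x))))"
        unfolding elim(2)[rule_format, OF s] by (rule LIMSEQ_unique)
    qed
  qed
qed

section \<open>Mixing over the tilted largest point\<close>

text \<open>The substitution \<open>s = l t\<close> turns the rate \<open>\<beta> + \<kappa>\<close> of the tilted density back into \<open>\<beta>\<close>, so no Gamma
  integral has to be evaluated.\<close>

lemma tilted_density_scale:
  assumes \<sigma>: "0 < \<sigma>" and \<beta>: "0 < \<beta>" and \<kappa>: "0 \<le> \<kappa>" and l: "l = ((\<beta> + \<kappa>) / \<beta>) powr (1 / \<sigma>)"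
  shows "l * (h_tilt \<sigma> c \<beta> (l * t) * f_jump \<sigma> (l * t) * exp (- ((l * t) powr (- \<sigma>) * \<kappa>)))
    = (\<beta> / (\<beta> + \<kappa>)) powr (c + 1) * (h_tilt \<sigma> c \<beta> t * f_jump \<sigma> t)"
proof (cases "0 < t")
  case True
  have l0: "0 < l"
    using \<beta> \<kappa> by (simp add: l)
  let ?q = "(\<beta> + \<kappa>) / \<beta>"
  have q0: "0 < ?q"
    using \<beta> \<kappa> by simp
  have "(l * t) powr (- \<sigma>) = l powr (- \<sigma>) * t powr (- \<sigma>)"
    using l0 True by (simp add: powr_mult)
  also have "l powr (- \<sigma>) = \<beta> / (\<beta> + \<kappa>)"
    using \<sigma> q0 \<beta> \<kappa> by (simp add: l powr_powr powr_minus divide_powr_uminus)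
  finally have 1: "(l * t) powr (- \<sigma>) = \<beta> / (\<beta> + \<kappa>) * t powr (- \<sigma>)" .
  have 2: "(l * t) powr (- c * \<sigma>) = l powr (- c * \<sigma>) * t powr (- c * \<sigma>)"
    "(l * t) powr (- 1 - \<sigma>) = l powr (- 1 - \<sigma>) * t powr (- 1 - \<sigma>)"
    using l0 True by (simp_all add: powr_mult)
  \<comment> \<open>Jacobian, tilt and jump density contribute the exponents \<open>1\<close>,
    \<open>- c * \<sigma>\<close> and \<open>- 1 - \<sigma>\<close> of \<open>l\<close>. They add up
    to \<open>- \<sigma> * (c + 1)\<close>, which is where the power \<open>c + 1\<close> comes
    from.\<close>
  have 3: "l * l powr (- c * \<sigma>) * l powr (- 1 - \<sigma>) = (\<beta> / (\<beta> + \<kappa>)) powr (c + 1)"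
  proof -
    have "l * l powr (- c * \<sigma>) * l powr (- 1 - \<sigma>) = l powr (1 + (- c * \<sigma>) + (- 1 - \<sigma>))"
      using l0 by (simp only: powr_add) simp
    also have "1 + (- c * \<sigma>) + (- 1 - \<sigma>) = \<sigma> * (- (c + 1))"
      by (simp add: algebra_simps)
    also have "l powr (\<sigma> * (- (c + 1))) = ?q powr (- (c + 1))"
      using \<sigma> by (simp add: l powr_powr)
    also have "\<dots> = (\<beta> / (\<beta> + \<kappa>)) powr (c + 1)"
    proof -
      have "?q powr (- (c + 1)) = inverse ?q powr (c + 1)"
        using q0 by (simp only: powr_minus inverse_powr less_imp_le)
      then show ?thesis
        by simp
    qed
    finally show ?thesis .
  qed
  \<comment> \<open>The three rates are \<open>\<beta> - 1\<close> from the tilt, 1 from the jump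
    density and \<open>\<kappa>\<close> from the Laplace functional. Their sum
    \<open>\<beta> + \<kappa>\<close> is multiplied by \<open>b\<close>, which brings it back to
    \<open>\<beta>\<close>.\<close>
  have 4: "exp (- (\<beta> - 1) * (b * T)) * exp (- (b * T)) * exp (- (b * T * \<kappa>)) = exp (- (\<beta> - 1) * T) * exp (- T)"
    if "b * (\<beta> + \<kappa>) = \<beta>" for b T :: real
  proof -
    have "- (\<beta> - 1) * (b * T) + - (b * T) + - (b * T * \<kappa>) = - ((b * (\<beta> + \<kappa>)) * T)"
      by (simp add: algebra_simps)
    also have "\<dots> = - (\<beta> - 1) * T + - T"
      unfolding that by (simp add: algebra_simps)
    finally show ?thesis
      by (simp only: exp_add[symmetric])
  qed
  have "\<beta> / (\<beta> + \<kappa>) * (\<beta> + \<kappa>) = \<beta>"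
    using \<beta> \<kappa> by simp
  note 4 = 4[OF this, of "t powr (- \<sigma>)"]
  let ?C = "\<beta> powr (c + 1) / Gamma (c + 1)"
  have "l * (h_tilt \<sigma> c \<beta> (l * t) * f_jump \<sigma> (l * t) * exp (- ((l * t) powr (- \<sigma>) * \<kappa>)))
    = ?C * \<sigma> * (l * l powr (- c * \<sigma>) * l powr (- 1 - \<sigma>)) * (t powr (- c * \<sigma>) * t powr (- 1 - \<sigma>)) *
      (exp (- (\<beta> - 1) * (\<beta> / (\<beta> + \<kappa>) * t powr (- \<sigma>))) * exp (- (\<beta> / (\<beta> + \<kappa>) * t powr (- \<sigma>)))
        * exp (- (\<beta> / (\<beta> + \<kappa>) * t powr (- \<sigma>) * \<kappa>)))"
    using True l0 by (simp only: h_tilt_def f_jump_def 1 2) (simp add: mult_ac)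
  also have "\<dots> = (\<beta> / (\<beta> + \<kappa>)) powr (c + 1) * (h_tilt \<sigma> c \<beta> t * f_jump \<sigma> t)"
    unfolding 3 4 using True by (simp add: h_tilt_def f_jump_def mult_ac)
  finally show ?thesis .
next
  case False
  moreover have "0 < l"
    using \<beta> \<kappa> by (simp add: l)
  ultimately show ?thesis
    by (auto simp: f_jump_def indicator_def zero_less_mult_iff)
qed

lemma f_jump_nonneg: "0 \<le> \<sigma> \<Longrightarrow> 0 \<le> f_jump \<sigma> s"
  by (simp add: f_jump_def)

lemma h_tilt_nonneg: "0 < c \<Longrightarrow> 0 \<le> h_tilt \<sigma> c \<beta> s"
  by (simp add: h_tilt_def Gamma_real_pos less_imp_le)

lemma borel_measurable_f_jump [measurable]: "f_jump \<sigma> \<in> borel_measurable borel"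
  unfolding f_jump_def by measurable

lemma borel_measurable_h_tilt [measurable]: "h_tilt \<sigma> c \<beta> \<in> borel_measurable borel"
  unfolding h_tilt_def by measurable

theorem sbsp_series_iprod:
  assumes "prob_space M" and S: "sbsp_series M \<beta> \<sigma> c D \<theta> \<omega>"
    and \<sigma>: "0 < \<sigma>" and \<beta>: "0 < \<beta>" and c: "0 < c"
    and [measurable]: "\<gamma> \<in> borel_measurable borel"
    and \<gamma>01: "\<And>x. \<gamma> x \<in> {0<..1}"
    and cont: "continuous_on {0<..<1} \<gamma>"
    and int: "set_integrable lborel {0<..<1} (\<lambda>x. (1 - \<gamma> x) * stable_rate \<sigma> x)"
  shows "(\<integral>w. iprod (\<lambda>n. \<gamma> (\<theta> n w)) \<partial>M)
    = (\<beta> / (\<beta> + stable_mass \<sigma> (\<lambda>x. 1 - \<gamma> x))) powr (c + 1)"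
proof -
  interpret prob_space M by fact
  let ?\<kappa> = "stable_mass \<sigma> (\<lambda>x. 1 - \<gamma> x)"
  have \<kappa>: "0 \<le> ?\<kappa>"
    using \<gamma>01 \<sigma> unfolding stable_mass_def set_lebesgue_integral_def
    by (intro integral_nonneg_AE AE_I2) (auto simp: indicator_def)
  obtain G where rk: "ratio_kernel \<sigma> G" and law: "has_cond_law M D borel (\<lambda>w n. \<theta> n w) real_seq G"
    using S by (auto simp: sbsp_series_def)
  have dens: "distributed M lborel D (\<lambda>s. ennreal (h_tilt \<sigma> c \<beta> s * f_jump \<sigma> s))"
    using S by (simp add: sbsp_series_def)
  then have [measurable]: "D \<in> borel_measurable M"
    by (auto simp: distributed_def)
  have G[measurable]: "G \<in> borel \<rightarrow>\<^sub>M prob_algebra real_seq"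
    using rk by (simp add: ratio_kernel_def)
  have seq: "(\<lambda>w n. \<theta> n w) \<in> M \<rightarrow>\<^sub>M real_seq"
    using law by (simp add: has_cond_law_def)
  have [measurable]: "\<theta> n \<in> borel_measurable M" for n
    using measurable_compose[OF seq measurable_component_singleton[of n]] by simp
  have iprod01: "0 \<le> iprod (\<lambda>n. \<gamma> (h n))" "iprod (\<lambda>n. \<gamma> (h n)) \<le> 1" for h :: "nat \<Rightarrow> real"
    using iprod_in_unit_interval[of "\<lambda>n. \<gamma> (h n)"] \<gamma>01 less_imp_le by auto
  have F: "(\<lambda>(s :: real, x). ennreal (iprod (\<lambda>n. \<gamma> (x n)))) \<in> borel_measurable (borel \<Otimes>\<^sub>M real_seq)"
    by measurable
  have \<Phi>[measurable]: "(\<lambda>s. \<integral>\<^sup>+x. ennreal (iprod (\<lambda>n. \<gamma> (x n))) \<partial>G s) \<in> borel_measurable borel"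
    using nn_integral_measurable_subprob_algebra2[OF F measurable_prob_algebraD[OF G]] .
  define l where "l = ((\<beta> + ?\<kappa>) / \<beta>) powr (1 / \<sigma>)"
  have l0: "0 < l"
    using \<beta> \<kappa> by (simp add: l_def)
  let ?p = "\<lambda>s. h_tilt \<sigma> c \<beta> s * f_jump \<sigma> s"
  have p0: "0 \<le> ?p s" for s
    using \<sigma> c by (simp add: f_jump_nonneg h_tilt_nonneg)
  have "ennreal (\<integral>w. iprod (\<lambda>n. \<gamma> (\<theta> n w)) \<partial>M) = (\<integral>\<^sup>+w. ennreal (iprod (\<lambda>n. \<gamma> (\<theta> n w))) \<partial>M)"
    by (intro nn_integral_eq_integral[symmetric] integrable_const_bound[where B = 1]) (auto simp: iprod01)
  also have "\<dots> = (\<integral>\<^sup>+w. (\<integral>\<^sup>+x. ennreal (iprod (\<lambda>n. \<gamma> (x n))) \<partial>G (D w)) \<partial>M)"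
    by (rule has_cond_law_nn_integral[OF law G F])
  also have "\<dots> = (\<integral>\<^sup>+s. ennreal (?p s) * (\<integral>\<^sup>+x. ennreal (iprod (\<lambda>n. \<gamma> (x n))) \<partial>G s) \<partial>lborel)"
    by (rule distributed_nn_integral[OF dens, symmetric]) simp
  also have "\<dots> = (\<integral>\<^sup>+s. ennreal (?p s * exp (- (s powr (- \<sigma>) * ?\<kappa>))) \<partial>lborel)"
  proof (rule nn_integral_cong_AE)
    show "AE s in lborel. ennreal (?p s) * (\<integral>\<^sup>+x. ennreal (iprod (\<lambda>n. \<gamma> (x n))) \<partial>G s)
        = ennreal (?p s * exp (- (s powr (- \<sigma>) * ?\<kappa>)))"
      using ratio_kernel_iprod[OF rk \<sigma> _ \<gamma>01 cont int, simplified]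
    proof eventually_elim
      case (elim s)
      show ?case
      proof (cases "0 < s")
        case True
        then show ?thesis
          using elim p0[of s] by (simp add: ennreal_mult)
      qed (simp add: f_jump_def)
    qed
  qed
  also have "\<dots> = ennreal l * (\<integral>\<^sup>+t. ennreal (?p (0 + l * t) * exp (- ((0 + l * t) powr (- \<sigma>) * ?\<kappa>))) \<partial>lborel)"
    using l0 by (subst nn_integral_real_affine[where c = l and t = 0]) auto
  also have "\<dots> = (\<integral>\<^sup>+t. ennreal (l * (?p (l * t) * exp (- ((l * t) powr (- \<sigma>) * ?\<kappa>)))) \<partial>lborel)"
    using l0 p0 by (subst nn_integral_cmult[symmetric]) (auto simp: ennreal_mult' mult.assoc)
  also have "\<dots> = (\<integral>\<^sup>+t. ennreal ((\<beta> / (\<beta> + ?\<kappa>)) powr (c + 1)) * ennreal (?p t) \<partial>lborel)"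
    unfolding tilted_density_scale[OF \<sigma> \<beta> \<kappa> l_def] using p0 by (intro nn_integral_cong) (simp add: ennreal_mult)
  also have "\<dots> = ennreal ((\<beta> / (\<beta> + ?\<kappa>)) powr (c + 1)) * (\<integral>\<^sup>+t. ennreal (?p t) \<partial>lborel)"
    by (intro nn_integral_cmult) auto
  \<comment> \<open>The normalisation is not computed: the integrand is the density of
    \<open>D\<close>, hence has mass 1.\<close>
  also have "(\<integral>\<^sup>+t. ennreal (?p t) \<partial>lborel) = 1"
    using distributed_emeasure[OF dens, of UNIV] by (simp add: emeasure_space_1 space_PiM)
  finally show ?thesis
    by (simp add: integral_nonneg_AE iprod01)
qed

text \<open>Transfers the range of the ratios from the kernel to the atoms. It guarantees that the
  parameters of the counts almost surely lie in (0, 1), where the negative binomial formula is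
  valid.\<close>

lemma sbsp_series_AE_range:
  assumes "prob_space M" and S: "sbsp_series M \<beta> \<sigma> c D \<theta> \<omega>" and \<sigma>: "0 < \<sigma>"
  shows "AE w in M. \<forall>n. 0 < \<theta> n w \<and> \<theta> n w < 1"
proof -
  interpret prob_space M by fact
  obtain G where rk: "ratio_kernel \<sigma> G" and law: "has_cond_law M D borel (\<lambda>w n. \<theta> n w) real_seq G"
    using S by (auto simp: sbsp_series_def)
  have dens: "distributed M lborel D (\<lambda>s. ennreal (h_tilt \<sigma> c \<beta> s * f_jump \<sigma> s))"
    using S by (simp add: sbsp_series_def)
  have G[measurable]: "G \<in> borel \<rightarrow>\<^sub>M prob_algebra real_seq"
    using rk by (simp add: ratio_kernel_def)
  let ?S = "{x \<in> space real_seq. \<forall>n. 0 < x n \<and> x n < 1}"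
  have S_meas[measurable]: "?S \<in> sets real_seq"
    by measurable
  have F: "(\<lambda>(s :: real, x). indicator (space real_seq - ?S) x :: ennreal) \<in> borel_measurable (borel \<Otimes>\<^sub>M real_seq)"
    by measurable
  have seq[measurable]: "(\<lambda>w n. \<theta> n w) \<in> M \<rightarrow>\<^sub>M real_seq"
    using law by (simp add: has_cond_law_def)
  have \<Phi>[measurable]: "(\<lambda>s. \<integral>\<^sup>+x. indicator (space real_seq - ?S) x \<partial>G s) \<in> borel_measurable borel"
    using nn_integral_measurable_subprob_algebra2[OF F measurable_prob_algebraD[OF G]] .
  have "(\<integral>\<^sup>+w. indicator (space real_seq - ?S) (\<lambda>n. \<theta> n w) \<partial>M) = (\<integral>\<^sup>+w. (\<integral>\<^sup>+x. indicator (space real_seq - ?S) x \<partial>G (D w)) \<partial>M)"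
    by (rule has_cond_law_nn_integral[OF law G F])
  also have "\<dots> = (\<integral>\<^sup>+s. ennreal (h_tilt \<sigma> c \<beta> s * f_jump \<sigma> s) * (\<integral>\<^sup>+x. indicator (space real_seq - ?S) x \<partial>G s) \<partial>lborel)"
    by (rule distributed_nn_integral[OF dens, symmetric]) simp
  also have "\<dots> = (\<integral>\<^sup>+s. 0 \<partial>(lborel :: real measure))"
  proof (rule nn_integral_cong_AE)
    show "AE s in lborel. ennreal (h_tilt \<sigma> c \<beta> s * f_jump \<sigma> s) * (\<integral>\<^sup>+x. indicator (space real_seq - ?S) x \<partial>G s) = 0"
      using ratio_kernel_AE_range[OF rk \<sigma>]
    proof eventually_elim
      case (elim s)
      show ?case
      proof (cases "0 < s")
        case True
        have "(\<integral>\<^sup>+x. indicator (space real_seq - ?S) x \<partial>G s) = (\<integral>\<^sup>+x. 0 \<partial>G s)"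
          using elim[rule_format, OF True] by (intro nn_integral_cong_AE) (auto elim!: eventually_mono simp: indicator_def)
        then show ?thesis
          by simp
      qed (simp add: f_jump_def)
    qed
  qed
  finally have "(\<integral>\<^sup>+w. indicator (space real_seq - ?S) (\<lambda>n. \<theta> n w) \<partial>M) = 0"
    by simp
  then have "AE w in M. indicator (space real_seq - ?S) (\<lambda>n. \<theta> n w) = (0 :: ennreal)"
    by (subst (asm) nn_integral_0_iff_AE) auto
  then show ?thesis
    by eventually_elim (auto simp: indicator_def space_PiM split: if_splits)
qed

section \<open>Weights of marked units\<close>

text \<open>Newton's binomial series with exponent \<open>- a\<close> at
  \<open>- (t * z)\<close>.\<close>

lemma negbin_pgf:
  assumes "0 < a" "0 < t" "t < 1" and z: "z \<in> {0..1}"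
  shows "measure_pmf.expectation (negbin_pmf a t) (\<lambda>k. z ^ k) = ((1 - t) / (1 - t * z)) powr a"
proof -
  have tz: "\<bar>t * z\<bar> < 1" "t * z < 1"
    using assms by (auto simp: abs_mult mult_le_one intro: le_less_trans[OF mult_left_le])
  have neg: "((- a) gchoose n) * (- (t * z)) ^ n = ((real n + a - 1) gchoose n) * (t * z) ^ n" for n
  proof -
    have "(- (t * z)) ^ n = (- 1) ^ n * (t * z) ^ n"
      by (rule power_minus)
    moreover have "(- 1 :: real) ^ n * (- 1) ^ n = 1"
      by (metis minus_one_mult_self)
    ultimately show ?thesis
      unfolding gbinomial_minus by (simp add: add.commute mult.left_commute)
  qed
  have "(\<lambda>n. ((- a) gchoose n) * (- (t * z)) ^ n) sums (1 + - (t * z)) powr (- a)"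
    using tz by (intro gen_binomial_real) simp
  then have 1: "(\<lambda>n. ((real n + a - 1) gchoose n) * (t * z) ^ n * (1 - t) powr a) sums ((1 - t * z) powr (- a) * (1 - t) powr a)"
    unfolding neg by (intro sums_mult2) simp
  have "(\<lambda>k. measure_pmf.expectation (negbin_pmf a t) (\<lambda>x. 1 * indicator {k} x) * z ^ k)
      sums measure_pmf.expectation (negbin_pmf a t) (\<lambda>k. 1 * z ^ k)"
    using z by (intro sums_integral_nat_fibres[where X = "\<lambda>x. x"]) (auto simp: power_le_one)
  then have "(\<lambda>k. pmf (negbin_pmf a t) k * z ^ k) sums measure_pmf.expectation (negbin_pmf a t) (\<lambda>k. z ^ k)"
    by (simp add: measure_pmf_single)
  then have "(\<lambda>n. ((real n + a - 1) gchoose n) * (t * z) ^ n * (1 - t) powr a) sums measure_pmf.expectation (negbin_pmf a t) (\<lambda>k. z ^ k)"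
    using assms by (simp add: pmf_negbin power_mult_distrib mult_ac)
  from this 1 have "measure_pmf.expectation (negbin_pmf a t) (\<lambda>k. z ^ k) = (1 - t * z) powr (- a) * (1 - t) powr a"
    by (rule sums_unique2)
  also have "\<dots> = ((1 - t) / (1 - t * z)) powr a"
    using tz assms by (subst powr_divide) (simp_all add: powr_minus divide_inverse)
  finally show ?thesis .
qed

text \<open>The counts of one unit with atom \<open>t\<close> on days 1 to \<open>n\<close>, as a
  discrete law; days outside this range carry the default 0.\<close>

definition mark_pmf :: "real \<Rightarrow> nat \<Rightarrow> real \<Rightarrow> (nat \<Rightarrow> nat) pmf" where
  "mark_pmf r n t = Pi_pmf {1..n} 0 (\<lambda>_. negbin_pmf r t)"

lemma mark_pmf_pgf:
  assumes "0 < r" "0 < t" "t < 1" and z: "\<And>d. z d \<in> {0..1}"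
  shows "measure_pmf.expectation (mark_pmf r n t) (\<lambda>a. \<Prod>d=1..n. z d ^ a d)
    = (\<Prod>d=1..n. ((1 - t) / (1 - t * z d)) powr r)"
proof -
  have "measure_pmf.expectation (mark_pmf r n t) (\<lambda>a. \<Prod>d=1..n. z d ^ a d)
      = (\<Prod>d=1..n. measure_pmf.expectation (negbin_pmf r t) (\<lambda>k. z d ^ k))"
    unfolding mark_pmf_def using z
    by (intro expectation_prod_Pi_pmf measure_pmf.integrable_const_bound[where B = 1])
      (auto simp: power_le_one)
  then show ?thesis
    using assms by (simp add: negbin_pgf)
qed

text \<open>Each unit contributes at most one of the factors \<open>u\<close> and \<open>v\<close>,
  since \<open>u\<close> is tested only on unobserved units. In the application \<open>z d\<close>
  is evaluated at the label of the unit.\<close>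

definition unit_weight ::
    "nat \<Rightarrow> nat \<Rightarrow> nat \<Rightarrow> real \<Rightarrow> real \<Rightarrow> (nat \<Rightarrow> real) \<Rightarrow> (nat \<Rightarrow> nat) \<Rightarrow> real" where
  "unit_weight D0 D1 j u v z a =
     (if (\<Sum>d=1..D0. a d) = 0 then (if (\<Sum>d=1..D1. a (D0 + d)) = j then u else 1)
      else v * (\<Prod>d=1..D0. z d ^ a d))"

text \<open>As \<open>0 ^ 0 = 1\<close>, being unobserved is the monomial in the counts at
  \<open>z = 0\<close>, so it is covered by the generating function of the counts.\<close>

lemma prod_zero_power_eq: "(\<Prod>d\<in>I. 0 ^ a d) = (of_bool ((\<Sum>d\<in>I. a d) = 0) :: real)" if "finite I" for a :: "'i \<Rightarrow> nat"
  using that by (auto simp: power_0_left)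

lemma unit_weight_in_unit_interval:
  assumes "u \<in> {0..1}" "v \<in> {0..1}" "\<And>d. z d \<in> {0..1}"
  shows "unit_weight D0 D1 j u v z a \<in> {0..1}"
proof -
  have "(\<Prod>d=1..D0. z d ^ a d) \<in> {0..1}"
    using assms(3) by (intro prod_in_unit_interval) (auto simp: power_le_one)
  then show ?thesis
    using assms by (auto simp: unit_weight_def mult_le_one)
qed

text \<open>With \<open>I0\<close> the indicator of an unobserved unit and \<open>S\<close> its
  later total, the weight is \<open>I0\<close>, minus \<open>1 - u\<close> times \<open>I0\<close>
  on the event \<open>S = j\<close>, plus \<open>v\<close> times the difference of the monomial in
  \<open>z\<close> and \<open>I0\<close>. The single formula \<open>E\<close> supplies the
  monomials, at \<open>y = 0\<close> for \<open>I0\<close> and at \<open>y = z\<close> for the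
  observed part.\<close>

lemma expectation_unit_weight:
  assumes r: "0 < r" and t: "0 < t" "t < 1" and D1: "1 \<le> D1"
    and u: "u \<in> {0..1}" and v: "v \<in> {0..1}" and z: "\<And>d. z d \<in> {0..1}"
  shows "measure_pmf.expectation (mark_pmf r (D0 + D1) t) (unit_weight D0 D1 j u v z)
    = (1 - t) powr (r * real D0) * (1 - (1 - u) * pmf (negbin_pmf (r * real D1) t) j)
      + v * ((\<Prod>d=1..D0. ((1 - t) / (1 - t * z d)) powr r) - (1 - t) powr (r * real D0))"
proof -
  let ?Q = "mark_pmf r (D0 + D1) t"
  define I0 where "I0 a = (of_bool ((\<Sum>d=1..D0. a d) = 0) :: real)" for a :: "nat \<Rightarrow> nat"
  define S where "S a = (\<Sum>d=1..D1. a (D0 + d))" for a :: "nat \<Rightarrow> nat"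
  have split: "(\<Prod>d=1..D0 + D1. h d) = (\<Prod>d=1..D0. h d) * (\<Prod>d=1..D1. h (D0 + d))" for h :: "nat \<Rightarrow> real"
    using prod.ub_add_nat[of 1 D0 h D1] prod.shift_bounds_cl_nat_ivl[of h 1 D0 D1] by (simp add: add.commute)
  have E: "measure_pmf.expectation ?Q (\<lambda>a. (\<Prod>d=1..D0. y d ^ a d) * x ^ S a)
      = (\<Prod>d=1..D0. ((1 - t) / (1 - t * y d)) powr r) * ((1 - t) / (1 - t * x)) powr (r * real D1)"
    if y: "\<And>d. y d \<in> {0..1}" and x: "x \<in> {0..1}" for y x
  proof -
    have tx: "0 < (1 - t) / (1 - t * x)"
      using t x by (intro divide_pos_pos) (auto intro: le_less_trans[OF mult_left_le])
    have "measure_pmf.expectation ?Q (\<lambda>a. \<Prod>d=1..D0 + D1. (if d \<le> D0 then y d else x) ^ a d)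
        = (\<Prod>d=1..D0 + D1. ((1 - t) / (1 - t * (if d \<le> D0 then y d else x))) powr r)"
      using y x by (intro mark_pmf_pgf r t) auto
    moreover have "(\<Prod>d=1..D0 + D1. (if d \<le> D0 then y d else x) ^ a d) = (\<Prod>d=1..D0. y d ^ a d) * x ^ S a" for a
      unfolding split S_def power_sum by (intro arg_cong2[where f = "(*)"] prod.cong) auto
    moreover have "(\<Prod>d=1..D0 + D1. ((1 - t) / (1 - t * (if d \<le> D0 then y d else x))) powr r)
        = (\<Prod>d=1..D0. ((1 - t) / (1 - t * y d)) powr r) * (\<Prod>d=1..D1. ((1 - t) / (1 - t * x)) powr r)"
      unfolding split by (intro arg_cong2[where f = "(*)"] prod.cong) auto
    moreover have "(\<Prod>d=1..D1. ((1 - t) / (1 - t * x)) powr r) = ((1 - t) / (1 - t * x)) powr (r * real D1)"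
    proof -
      have "(((1 - t) / (1 - t * x)) powr r) ^ D1 = (((1 - t) / (1 - t * x)) powr r) powr real D1"
        using tx by (subst powr_realpow) auto
      then show ?thesis
        by (simp add: powr_powr)
    qed
    ultimately show ?thesis
      by simp
  qed
  have bnd: "(\<Prod>d=1..D0. y d ^ a d) \<in> {0..1}" if "\<And>d. y d \<in> {0..1}" for y :: "nat \<Rightarrow> real" and a :: "nat \<Rightarrow> nat"
    using that by (intro prod_in_unit_interval) (auto simp: power_le_one)
  have EW: "measure_pmf.expectation ?Q (\<lambda>a. \<Prod>d=1..D0. y d ^ a d) = (\<Prod>d=1..D0. ((1 - t) / (1 - t * y d)) powr r)"
    if "\<And>d. y d \<in> {0..1}" for y
    using E[of y 1] that t by simp
  have I0_eq: "I0 a = (\<Prod>d=1..D0. 0 ^ a d)" for a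
    by (simp only: I0_def prod_zero_power_eq finite_atLeastAtMost)
  have P0: "(\<Prod>d=1..D0. ((1 - t) / (1 - t * 0)) powr r) = (1 - t) powr (r * real D0)"
    using t by (simp add: powr_powr powr_realpow[symmetric] del: powr_realpow)
  have EI0: "measure_pmf.expectation ?Q I0 = (1 - t) powr (r * real D0)"
    using EW[of "\<lambda>_. 0"] P0 unfolding I0_eq[abs_def] by simp
  have EIj: "measure_pmf.expectation ?Q (\<lambda>a. I0 a * indicator {j} (S a))
      = (1 - t) powr (r * real D0) * pmf (negbin_pmf (r * real D1) t) j"
  proof -
    have "measure_pmf.expectation ?Q (\<lambda>a. I0 a * indicator {j} (S a))
        = measure_pmf.expectation (negbin_pmf (r * real D1) t) (\<lambda>k. (1 - t) powr (r * real D0) * indicator {j} k)"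
    \<comment> \<open>Over \<open>D1\<close> days the generating functions multiply to the power
      \<open>r * D1\<close>, so on the unobserved event \<open>S\<close> has the law
      \<open>negbin_pmf (r * real D1) t\<close>, weighted by the chance of being unobserved.\<close>
    proof (rule pgf_determines_weighted_law[of _ I0 _ "\<lambda>_. (1 - t) powr (r * real D0)" S "\<lambda>k. k"])
      fix x :: real assume x: "0 < x" "x < 1"
      have "measure_pmf.expectation ?Q (\<lambda>a. I0 a * x ^ S a)
          = (1 - t) powr (r * real D0) * ((1 - t) / (1 - t * x)) powr (r * real D1)"
        using E[of "\<lambda>_. 0" x] x P0 unfolding I0_eq by simp
      also have "\<dots> = measure_pmf.expectation (negbin_pmf (r * real D1) t) (\<lambda>k. (1 - t) powr (r * real D0) * x ^ k)"
        using negbin_pgf[of "r * real D1" t x] r t D1 x by simp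
      finally show "measure_pmf.expectation ?Q (\<lambda>a. I0 a * x ^ S a)
          = measure_pmf.expectation (negbin_pmf (r * real D1) t) (\<lambda>k. (1 - t) powr (r * real D0) * x ^ k)" .
    next
      show "integrable (measure_pmf ?Q) I0"
        by (intro measure_pmf.integrable_const_bound[where B = 1]) (auto simp: I0_def)
    qed auto
    also have "\<dots> = (1 - t) powr (r * real D0) * pmf (negbin_pmf (r * real D1) t) j"
      by (simp add: measure_pmf_single)
    finally show ?thesis .
  qed
  have int: "integrable ?Q I0" "integrable ?Q (\<lambda>a. I0 a * indicator {j} (S a))" "integrable ?Q (\<lambda>a. \<Prod>d=1..D0. z d ^ a d)"
    using bnd[OF z] by (auto simp: I0_def indicator_def intro!: measure_pmf.integrable_const_bound[where B = 1])
  have "unit_weight D0 D1 j u v z a = I0 a - (1 - u) * (I0 a * indicator {j} (S a)) + v * ((\<Prod>d=1..D0. z d ^ a d) - I0 a)" for a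
  proof (cases "(\<Sum>d=1..D0. a d) = 0")
    case True
    then have "(\<Prod>d=1..D0. z d ^ a d) = 1"
      by (intro prod.neutral) auto
    with True show ?thesis
      by (auto simp: unit_weight_def I0_def S_def)
  next
    case False
    then have "I0 a = 0"
      by (simp only: I0_def) simp
    moreover have "unit_weight D0 D1 j u v z a = v * (\<Prod>d=1..D0. z d ^ a d)"
      using False by (simp only: unit_weight_def if_False)
    ultimately show ?thesis
      by simp
  qed
  then have weight_eq: "unit_weight D0 D1 j u v z
      = (\<lambda>a. I0 a - (1 - u) * (I0 a * indicator {j} (S a)) + v * ((\<Prod>d=1..D0. z d ^ a d) - I0 a))"
    by blast
  have "measure_pmf.expectation ?Q (unit_weight D0 D1 j u v z)
      = measure_pmf.expectation ?Q I0 - (1 - u) * measure_pmf.expectation ?Q (\<lambda>a. I0 a * indicator {j} (S a))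
        + v * (measure_pmf.expectation ?Q (\<lambda>a. \<Prod>d=1..D0. z d ^ a d) - measure_pmf.expectation ?Q I0)"
    unfolding weight_eq using int by simp
  then show ?thesis
    unfolding EI0 EIj EW[OF z] by (simp add: algebra_simps)
qed

section \<open>Beta integrals against the stable rate\<close>

lemma set_integral_Ioo_of_has_integral:
  fixes f :: "real \<Rightarrow> real"
  assumes f: "f \<in> borel_measurable borel" "\<And>x. x \<in> {0<..<1} \<Longrightarrow> 0 \<le> f x"
    and I: "(f has_integral I) {0..1}"
  shows "set_integrable lborel {0<..<1} f" "(LBINT x:{0<..<1}. f x) = I"
proof -
  let ?g = "\<lambda>x. indicator {0<..<1} x * f x"
  have "(f has_integral I) {0<..<1}"
    using I by (simp add: has_integral_Icc_iff_Ioo)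
  then have "((\<lambda>x. if x \<in> {0<..<1} then f x else 0) has_integral I) UNIV"
    by (simp only: has_integral_restrict_UNIV)
  also have "(\<lambda>x. if x \<in> {0<..<1} then f x else 0) = ?g"
    by (auto simp: fun_eq_iff)
  finally have g: "(?g has_integral I) UNIV" .
  have g0: "0 \<le> ?g x" for x
    using f(2)[of x] by (auto simp: indicator_def)
  have I0: "0 \<le> I"
    using g g0 by (rule has_integral_nonneg)
  have gm: "?g \<in> borel_measurable borel"
    using f(1) by simp
  have nn: "(\<integral>\<^sup>+x. ennreal (?g x) \<partial>lborel) = ennreal I"
    using gm g0 g by (rule nn_integral_has_integral_lborel)
  then show int: "set_integrable lborel {0<..<1} f"
    unfolding set_integrable_def using gm g0 by (intro integrableI_nonneg) auto
  show "(LBINT x:{0<..<1}. f x) = I"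
    using nn I0 g0 gm unfolding set_lebesgue_integral_def
    by (subst integral_eq_nn_integral) auto
qed

text \<open>Bernoulli's inequality for an integer exponent above \<open>a\<close>. Vanishing
  linearly at 0 beats the singularity \<open>t powr (- \<sigma>)\<close> in the next lemma.\<close>

lemma one_minus_powr_le:
  fixes a :: real
  assumes "0 \<le> a"
  obtains C where "0 \<le> C" "\<And>t. 0 \<le> t \<Longrightarrow> t \<le> 1 \<Longrightarrow> 1 - (1 - t) powr a \<le> C * t"
proof -
  obtain n :: nat where n: "a \<le> real n" "0 < n"
    by (metis gr0I less_eq_real_def less_le_not_le linorder_not_less of_nat_0 order_trans real_arch_simple reals_Archimedean2)
  have "1 - (1 - t) powr a \<le> real n * t" if "0 \<le> t" "t \<le> 1" for t
  proof (cases "t = 1")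
    case True
    then show ?thesis
      using n by (cases "a = 0") auto
  next
    case False
    have "1 + real n * (- t) \<le> (1 + (- t)) ^ n"
      using that by (intro Bernoulli_inequality) auto
    also have "\<dots> = (1 - t) powr real n"
      using that False by (simp add: powr_realpow)
    also have "\<dots> \<le> (1 - t) powr a"
      using that False n by (intro powr_mono') auto
    finally show ?thesis by simp
  qed
  then show thesis
    using that[of "real n"] by simp
qed

text \<open>Integration by parts moves the singularity onto a convergent Beta integral, giving
  \<open>a * Beta (1 - \<sigma>) a - 1\<close>. The Beta values at \<open>- \<sigma>\<close> arise
  afterwards by the recursion of the Gamma function; no integral with that parameter occurs.\<close>

lemma stable_mass_observed:
  assumes \<sigma>: "0 < \<sigma>" "\<sigma> < 1" and a: "0 < a"
  shows "set_integrable lborel {0<..<1} (\<lambda>t. (1 - (1 - t) powr a) * stable_rate \<sigma> t)"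
    and "stable_mass \<sigma> (\<lambda>t. 1 - (1 - t) powr a) = \<sigma> * (Beta 1 (- \<sigma>) - Beta (a + 1) (- \<sigma>))"
proof -
  \<comment> \<open>\<open>F\<close> is the boundary function of the integration by parts:
    \<open>F 0 = 0\<close> and \<open>F 1 = - 1\<close>. Its derivative is the wanted integrand
    minus a Beta integrand.\<close>
  define F where "F t = - ((1 - (1 - t) powr a) * t powr (- \<sigma>))" for t :: real
  define F' where "F' t = (1 - (1 - t) powr a) * stable_rate \<sigma> t - a * (t powr (- \<sigma>) * (1 - t) powr (a - 1))" for t :: real
  obtain C where C: "0 \<le> C" "\<And>t. 0 \<le> t \<Longrightarrow> t \<le> 1 \<Longrightarrow> 1 - (1 - t) powr a \<le> C * t"
    using one_minus_powr_le[of a] a by auto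
  have F_bound: "norm (F t) \<le> C * t powr (1 - \<sigma>)" if "t \<in> {0..1}" for t
  proof -
    have "(1 - t) powr a \<le> 1"
      using that a by (intro powr_le1) auto
    then have "norm (F t) = (1 - (1 - t) powr a) * t powr (- \<sigma>)"
      by (simp add: F_def abs_mult)
    also have "\<dots> \<le> C * t * t powr (- \<sigma>)"
      using C(2)[of t] that by (intro mult_right_mono) auto
    also have "\<dots> = C * t powr (1 - \<sigma>)"
      using that by (cases "t = 0") (simp_all add: powr_diff powr_minus divide_inverse)
    finally show ?thesis .
  qed
  have cont: "continuous_on {0..1} F"
    unfolding continuous_on_eq_continuous_within
  proof
    fix x :: real assume x: "x \<in> {0..1}"
    show "continuous (at x within {0..1}) F"
    proof (cases "x = 0")
      case True
      have "((\<lambda>t. C * t powr (1 - \<sigma>)) \<longlongrightarrow> C * 0 powr (1 - \<sigma>)) (at 0 within {0..1})"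
        using \<sigma> by (intro tendsto_intros tendsto_powr2 tendsto_powr') (auto simp: eventually_at_filter)
      then have "((\<lambda>t. C * t powr (1 - \<sigma>)) \<longlongrightarrow> 0) (at 0 within {0..1})"
        by simp
      moreover have "\<forall>\<^sub>F t in at 0 within {0..1}. norm (F t) \<le> C * t powr (1 - \<sigma>)"
        using F_bound by (auto simp: eventually_at_filter)
      ultimately have "(F \<longlongrightarrow> 0) (at 0 within {0..1})"
        by (rule Lim_null_comparison[rotated])
      then show ?thesis
        using True by (simp add: continuous_within F_def)
    next
      case False
      then have "continuous_on {0<..1} F"
        unfolding F_def using a by (intro continuous_intros continuous_on_powr') auto
      then have "continuous (at x within {0<..1}) F"
        using x False by (auto simp: continuous_on_eq_continuous_within)
      moreover have "at x within {0<..1} = at x within {0..1}"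
        using x False by (intro at_within_nhd[of x "{0<..}"]) auto
      ultimately show ?thesis
        by simp
    qed
  qed
  have "(F' has_integral (F 1 - F 0)) {0..1}"
  proof (rule fundamental_theorem_of_calculus_interior)
    show "(F has_vector_derivative F' t) (at t)" if t: "t \<in> {0<..<1}" for t
    proof -
      have 1: "((\<lambda>t. (1 - t) powr a) has_real_derivative - (a * (1 - t) powr (a - 1))) (at t)"
        using t by (auto intro!: derivative_eq_intros)
      have "(F has_real_derivative
          - ((0 - - (a * (1 - t) powr (a - 1))) * t powr (- \<sigma>) + (- (stable_rate \<sigma> t)) * (1 - (1 - t) powr a))) (at t)"
        unfolding F_def using t
        by (intro DERIV_minus DERIV_mult DERIV_diff DERIV_const 1 has_real_derivative_powr_minus) auto
      then show ?thesis
        unfolding has_real_derivative_iff_has_vector_derivative[symmetric]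
        by (rule DERIV_cong) (simp add: F'_def algebra_simps)
    qed
  qed (use cont in auto)
  moreover have "((\<lambda>t. t powr ((1 - \<sigma>) - 1) * (1 - t) powr (a - 1)) has_integral Beta (1 - \<sigma>) a) {0..1}"
    using \<sigma> a by (intro has_integral_Beta_real) auto
  ultimately have "((\<lambda>t. F' t + a * (t powr (- \<sigma>) * (1 - t) powr (a - 1))) has_integral (F 1 - F 0) + a * Beta (1 - \<sigma>) a) {0..1}"
    by (intro has_integral_add has_integral_mult_right) auto
  then have int: "((\<lambda>t. (1 - (1 - t) powr a) * stable_rate \<sigma> t) has_integral (a * Beta (1 - \<sigma>) a - 1)) {0..1}"
    by (simp add: F'_def F_def)
  have nn: "0 \<le> (1 - (1 - t) powr a) * stable_rate \<sigma> t" if "t \<in> {0<..<1}" for t :: real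
    using that \<sigma> a powr_le1[of a "1 - t"] by auto
  note * = set_integral_Ioo_of_has_integral[OF _ nn int]
  show "set_integrable lborel {0<..<1} (\<lambda>t. (1 - (1 - t) powr a) * stable_rate \<sigma> t)"
    by (rule *(1)) measurable
  \<comment> \<open>One recursion step from \<open>- \<sigma>\<close> to
    \<open>1 - \<sigma>\<close>, legitimate because \<open>- \<sigma>\<close> lies strictly between
    -1 and 0 and so is not a pole.\<close>
  have g1: "Gamma (1 - \<sigma>) = - \<sigma> * Gamma (- \<sigma>)"
  proof -
    have "- \<sigma> \<notin> \<int>\<^sub>\<le>\<^sub>0"
    proof
      assume "- \<sigma> \<in> \<int>\<^sub>\<le>\<^sub>0"
      then obtain n where "- \<sigma> = real_of_int n"
        by (auto elim!: nonpos_Ints_cases)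
      then have "-1 < n" "n < 0"
        using \<sigma> by linarith+
      then show False
        by simp
    qed
    from Gamma_plus1[OF this] show ?thesis
      by simp
  qed
  have g2: "Gamma (a + 1) = a * Gamma a"
    using a by (intro Gamma_plus1) (auto elim!: nonpos_Ints_cases)
  have "0 < Gamma (1 - \<sigma>)"
    using \<sigma> by (intro Gamma_real_pos) simp
  then have B1: "\<sigma> * Beta 1 (- \<sigma>) = - 1"
    using \<sigma> by (auto simp: Beta_def g1)
  have B2: "\<sigma> * Beta (a + 1) (- \<sigma>) = - (a * Beta (1 - \<sigma>) a)"
  proof -
    have "Gamma (1 - \<sigma> + a) = Gamma (a + 1 + - \<sigma>)"
      by (simp add: algebra_simps)
    then show ?thesis
      unfolding Beta_def g1 g2 by simp
  qed
  show "stable_mass \<sigma> (\<lambda>t. 1 - (1 - t) powr a) = \<sigma> * (Beta 1 (- \<sigma>) - Beta (a + 1) (- \<sigma>))"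
    unfolding stable_mass_def by (subst *(2)) (simp_all add: right_diff_distrib B1 B2)
qed

text \<open>A plain Beta integral: \<open>j \<ge> 1\<close> makes the parameter
  \<open>j - \<sigma>\<close> positive, since the factor \<open>t ^ j\<close> absorbs the
  singularity of the rate.\<close>

lemma stable_mass_new:
  assumes \<sigma>: "0 < \<sigma>" "\<sigma> < 1" and b: "0 \<le> b" and e: "0 < e" and j: "1 \<le> j"
  shows "set_integrable lborel {0<..<1} (\<lambda>t. (1 - t) powr b * pmf (negbin_pmf e t) j * stable_rate \<sigma> t)"
    and "stable_mass \<sigma> (\<lambda>t. (1 - t) powr b * pmf (negbin_pmf e t) j)
      = ((real j + e - 1) gchoose j) * \<sigma> * Beta (b + e + 1) (real j - \<sigma>)"
proof -
  let ?K = "((real j + e - 1) gchoose j) * \<sigma>"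
  let ?f = "\<lambda>t. ?K * (t powr ((real j - \<sigma>) - 1) * (1 - t) powr ((b + e + 1) - 1))"
  have K: "0 \<le> ?K"
  proof -
    have "((real j + e - 1) gchoose j) = pochhammer e j / fact j"
      unfolding gbinomial_pochhammer' by (rule arg_cong2[where f = "\<lambda>u v. pochhammer u j / v"]) simp_all
    then show ?thesis
      using \<sigma> e by (simp add: pochhammer_nonneg)
  qed
  have I: "(?f has_integral ?K * Beta (real j - \<sigma>) (b + e + 1)) {0..1}"
    using \<sigma> b e j by (intro has_integral_mult_right has_integral_Beta_real) auto
  have eq: "(1 - t) powr b * pmf (negbin_pmf e t) j * stable_rate \<sigma> t = ?f t" if "t \<in> {0<..<1}" for t
  proof -
    have "t ^ j * t powr (- 1 - \<sigma>) = t powr (real j - \<sigma> - 1)"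
      using that by (simp add: powr_realpow[symmetric] powr_add[symmetric] algebra_simps)
    moreover have "(1 - t) powr b * (1 - t) powr e = (1 - t) powr (b + e)"
      by (simp add: powr_add)
    ultimately have "t ^ j * t powr (- 1 - \<sigma>) * ((1 - t) powr b * (1 - t) powr e) = t powr (real j - \<sigma> - 1) * (1 - t) powr (b + e)"
      by simp
    then show ?thesis
      using that e by (simp add: pmf_negbin mult_ac)
  qed
  have nn: "0 \<le> ?f t" if "t \<in> {0<..<1}" for t
    using K by (intro mult_nonneg_nonneg[OF K] mult_nonneg_nonneg) simp_all
  note * = set_integral_Ioo_of_has_integral[OF _ nn I]
  have "set_integrable lborel {0<..<1} ?f"
    by (rule *(1)) measurable
  then show "set_integrable lborel {0<..<1} (\<lambda>t. (1 - t) powr b * pmf (negbin_pmf e t) j * stable_rate \<sigma> t)"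
    using eq by (subst set_integrable_cong[where f' = ?f]) auto
  have "stable_mass \<sigma> (\<lambda>t. (1 - t) powr b * pmf (negbin_pmf e t) j) = (LBINT t:{0<..<1}. ?f t)"
    unfolding stable_mass_def using eq by (intro set_lebesgue_integral_cong) auto
  also have "\<dots> = ?K * Beta (real j - \<sigma>) (b + e + 1)"
    by (rule *(2)) measurable
  finally show "stable_mass \<sigma> (\<lambda>t. (1 - t) powr b * pmf (negbin_pmf e t) j)
      = ((real j + e - 1) gchoose j) * \<sigma> * Beta (b + e + 1) (real j - \<sigma>)"
    by (simp add: Beta_commute)
qed

section \<open>Counts given the atoms and labels\<close>

lemma prob_space_nbp_counts: "prob_space (nbp_counts r t)"
  unfolding nbp_counts_def by (intro prob_space_PiM measure_pmf.prob_space_axioms)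

lemma measure_nbp_counts_cylinder:
  fixes D N :: nat
  shows "measure (Pi\<^sub>M {1..} (\<lambda>_. nbp_counts r t))
     {b \<in> space (Pi\<^sub>M {1..} (\<lambda>_. Pi\<^sub>M UNIV (\<lambda>_. count_space UNIV))). \<forall>d\<in>{1..D}. \<forall>n<N. b d n = a n d}
    = (\<Prod>n<N. \<Prod>d=1..D. pmf (negbin_pmf r (t n)) (a n d))"
proof -
  interpret days: product_prob_space "\<lambda>_ :: nat. nbp_counts r t" "{1..}"
    by (rule product_prob_spaceI) (rule prob_space_nbp_counts)
  interpret units: product_prob_space "\<lambda>n :: nat. measure_pmf (negbin_pmf r (t n))" UNIV
    by (rule product_prob_spaceI) (rule measure_pmf.prob_space_axioms)
  define X where "X d = {b \<in> space (nbp_counts r t). \<forall>n\<in>{..<N}. b n \<in> {a n d}}" for d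
  have X_sets: "X d \<in> sets (nbp_counts r t)" for d
    unfolding X_def nbp_counts_def by (intro sets.sets_Collect_finite_All sets_Collect_single') auto
  have X: "emeasure (nbp_counts r t) (X d) = ennreal (\<Prod>n<N. pmf (negbin_pmf r (t n)) (a n d))" for d
  proof -
    have "emeasure (nbp_counts r t) (X d) = (\<Prod>n<N. emeasure (measure_pmf (negbin_pmf r (t n))) {a n d})"
      unfolding X_def nbp_counts_def by (rule units.emeasure_PiM_Collect) auto
    then show ?thesis
      by (simp add: emeasure_pmf_single prod_ennreal)
  qed
  have space: "space (nbp_counts r t) = UNIV"
    by (simp add: nbp_counts_def space_PiM)
  have "{b \<in> space (Pi\<^sub>M {1..} (\<lambda>_. Pi\<^sub>M UNIV (\<lambda>_. count_space UNIV))). \<forall>d\<in>{1..D}. \<forall>n<N. b d n = a n d}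
      = {b \<in> space (Pi\<^sub>M {1..} (\<lambda>_. nbp_counts r t)). \<forall>d\<in>{1..D}. b d \<in> X d}"
    by (simp add: X_def space_PiM space Ball_def)
  moreover have "emeasure (Pi\<^sub>M {1..} (\<lambda>_. nbp_counts r t)) \<dots> = (\<Prod>d=1..D. emeasure (nbp_counts r t) (X d))"
    by (rule days.emeasure_PiM_Collect[of "{1..D}" X]) (use X_sets in auto)
  ultimately show ?thesis
    by (simp add: measure_def X prod_ennreal prod_nonneg) (rule prod.swap)
qed

text \<open>Outside \<open>(0, 1)\<close> the law \<^term>\<open>negbin_pmf r t\<close> is unspecified and need not be measurable in \<open>t\<close>.\<close>

definition clamp :: "real \<Rightarrow> real" where
  "clamp t = (if 0 < t \<and> t < 1 then t else 1 / 2)"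

lemma clamp: "0 < clamp t" "clamp t < 1"
  by (auto simp: clamp_def)

lemma borel_measurable_clamp [measurable]: "clamp \<in> borel_measurable borel"
  unfolding clamp_def by measurable

lemma borel_measurable_pmf_negbin_clamp [measurable]:
  assumes "0 < r"
  shows "(\<lambda>t. pmf (negbin_pmf r (clamp t)) k) \<in> borel_measurable borel"
  by (subst pmf_negbin) (use assms clamp in auto)

lemma prob_space_label_law: "prob_space label_law"
  by (rule prob_spaceI) (simp add: emeasure_restrict_space space_restrict_space)

lemma nn_integral_prod_label_seq:
  assumes "\<And>n. n < N \<Longrightarrow> f n \<in> borel_measurable label_law"
  shows "(\<integral>\<^sup>+x. (\<Prod>n<N. f n (x n)) \<partial>label_seq) = (\<Prod>n<N. \<integral>\<^sup>+x. f n x \<partial>label_law)"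
proof -
  interpret product_prob_space "\<lambda>_ :: nat. label_law" UNIV
    by (rule product_prob_spaceI) (rule prob_space_label_law)
  have [measurable]: "(\<lambda>x. \<Prod>n<N. f n (x n)) \<in> borel_measurable (Pi\<^sub>M {..<N} (\<lambda>_. label_law))"
    using assms by (intro borel_measurable_prod_ennreal) (auto intro: measurable_compose[OF measurable_component_singleton])
  have "(\<Prod>n<N. \<integral>\<^sup>+x. f n x \<partial>label_law) = (\<integral>\<^sup>+x. (\<Prod>n<N. f n (x n)) \<partial>Pi\<^sub>M {..<N} (\<lambda>_. label_law))"
    using assms by (intro product_nn_integral_prod[symmetric]) auto
  also have "\<dots> = (\<integral>\<^sup>+x. (\<Prod>n<N. f n (x n)) \<partial>distr label_seq (Pi\<^sub>M {..<N} (\<lambda>_. label_law)) (\<lambda>x. restrict x {..<N}))"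
    by (subst distr_PiM_restrict_finite) auto
  also have "\<dots> = (\<integral>\<^sup>+x. (\<Prod>n<N. f n (restrict x {..<N} n)) \<partial>label_seq)"
    by (intro nn_integral_distr measurable_restrict_subset) auto
  also have "\<dots> = (\<integral>\<^sup>+x. (\<Prod>n<N. f n (x n)) \<partial>label_seq)"
    by (intro nn_integral_cong prod.cong) auto
  finally show ?thesis ..
qed

section \<open>Integrating out labels and counts\<close>

locale sbsp_nbp = prob_space M for M :: "'a measure" +
  fixes \<beta> \<sigma> c r :: real and D :: "'a \<Rightarrow> real" and \<theta> \<omega> :: "nat \<Rightarrow> 'a \<Rightarrow> real" and A :: "nat \<Rightarrow> nat \<Rightarrow> 'a \<Rightarrow> nat"
  assumes \<sigma>: "0 < \<sigma>" "\<sigma> < 1" and \<beta>: "0 < \<beta>" and c: "0 < c" and r: "0 < r"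
    and series: "sbsp_series M \<beta> \<sigma> c D \<theta> \<omega>"
    and counts: "iid_nbp M r \<theta> \<omega> A"
begin

lemma joint_law: "has_cond_law M (\<lambda>w. (\<lambda>n. \<theta> n w, \<lambda>n. \<omega> n w)) (real_seq \<Otimes>\<^sub>M label_seq)
       (\<lambda>w. \<lambda>d\<in>{1..}. \<lambda>n. A d n w) (Pi\<^sub>M {1..} (\<lambda>_. Pi\<^sub>M UNIV (\<lambda>_. count_space UNIV)))
       (\<lambda>(t, x). Pi\<^sub>M {1..} (\<lambda>_. nbp_counts r t))"
  using counts by (simp add: iid_nbp_def)

lemma pair_measurable: "(\<lambda>w. (\<lambda>n. \<theta> n w, \<lambda>n. \<omega> n w)) \<in> M \<rightarrow>\<^sub>M real_seq \<Otimes>\<^sub>M label_seq"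
  using joint_law by (simp add: has_cond_law_def)

lemma \<theta>_seq_measurable [measurable]: "(\<lambda>w n. \<theta> n w) \<in> M \<rightarrow>\<^sub>M real_seq"
  using measurable_compose[OF pair_measurable measurable_fst] by simp

lemma \<omega>_seq_measurable [measurable]: "(\<lambda>w n. \<omega> n w) \<in> M \<rightarrow>\<^sub>M label_seq"
  using measurable_compose[OF pair_measurable measurable_snd] by simp

lemma \<theta>_measurable [measurable]: "\<theta> n \<in> borel_measurable M"
  using measurable_compose[OF \<theta>_seq_measurable measurable_component_singleton[of n]] by simp

lemma \<omega>_measurable [measurable]: "\<omega> n \<in> M \<rightarrow>\<^sub>M label_law"
  using measurable_compose[OF \<omega>_seq_measurable measurable_component_singleton[of n]] by simp

lemma A_measurable [measurable]:
  assumes "1 \<le> d"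
  shows "A d n \<in> M \<rightarrow>\<^sub>M count_space UNIV"
proof -
  have "(\<lambda>w. \<lambda>d\<in>{1..}. \<lambda>n. A d n w) \<in> M \<rightarrow>\<^sub>M Pi\<^sub>M {1..} (\<lambda>_. Pi\<^sub>M UNIV (\<lambda>_. count_space UNIV))"
    using joint_law by (simp add: has_cond_law_def)
  from measurable_compose[OF this measurable_component_singleton[of d "{1..}"]]
  have "(\<lambda>w. (\<lambda>d\<in>{1..}. \<lambda>n. A d n w) d) \<in> M \<rightarrow>\<^sub>M Pi\<^sub>M UNIV (\<lambda>_. count_space UNIV)"
    using assms by simp
  from measurable_compose[OF this measurable_component_singleton[of n UNIV]]
  have "(\<lambda>w. (\<lambda>d\<in>{1..}. \<lambda>n. A d n w) d n) \<in> M \<rightarrow>\<^sub>M count_space UNIV"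
    by simp
  then show ?thesis
    using assms by simp
qed

lemma AE_\<theta>_range: "AE w in M. \<forall>n. 0 < \<theta> n w \<and> \<theta> n w < 1"
  by (rule sbsp_series_AE_range[OF prob_space_axioms series \<sigma>(1)])

lemma distr_\<omega>: "distr M label_seq (\<lambda>w n. \<omega> n w) = label_seq"
proof -
  have "indep_vars (\<lambda>_. label_law) \<omega> UNIV" "\<And>n. distr M label_law (\<omega> n) = label_law"
    using series by (auto simp: sbsp_series_def)
  then show ?thesis
    by (subst (asm) indep_vars_iff_distr_eq_PiM) (auto simp: restrict_UNIV)
qed

text \<open>The independence in \<open>sbsp_series\<close> concerns the pair of \<open>D\<close> and
  the atoms; events of the atoms alone are rectangles with first side \<open>UNIV\<close>. The
  rectangles then identify the product law.\<close>

lemma distr_pair: "distr M (real_seq \<Otimes>\<^sub>M label_seq) (\<lambda>w. (\<lambda>n. \<theta> n w, \<lambda>n. \<omega> n w))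
  = distr M real_seq (\<lambda>w n. \<theta> n w) \<Otimes>\<^sub>M label_seq"
proof -
  interpret label_seq: product_prob_space "\<lambda>_ :: nat. label_law" UNIV
    by (rule product_prob_spaceI) (rule prob_space_label_law)
  interpret \<theta>: prob_space "distr M real_seq (\<lambda>w n. \<theta> n w)"
    by (rule prob_space_distr) measurable
  have [measurable]: "D \<in> borel_measurable M"
    using series by (auto simp: sbsp_series_def distributed_def)
  have indep: "indep_set
       (sets (vimage_algebra (space M) (\<lambda>w. (D w, \<lambda>n. \<theta> n w)) (borel \<Otimes>\<^sub>M real_seq)))
       (sets (vimage_algebra (space M) (\<lambda>w n. \<omega> n w) label_seq))"
    using series by (simp add: sbsp_series_def)
  show ?thesis
  proof (rule pair_measure_eqI[symmetric])
    show "sigma_finite_measure (distr M real_seq (\<lambda>w n. \<theta> n w))" "sigma_finite_measure label_seq"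
      by unfold_locales
    fix X Y assume "X \<in> sets (distr M real_seq (\<lambda>w n. \<theta> n w))" and Y[measurable]: "Y \<in> sets label_seq"
    then have X[measurable]: "X \<in> sets real_seq"
      by simp
    let ?a = "(\<lambda>w n. \<theta> n w) -` X \<inter> space M" and ?b = "(\<lambda>w n. \<omega> n w) -` Y \<inter> space M"
    have a_eq: "?a = (\<lambda>w. (D w, \<lambda>n. \<theta> n w)) -` (UNIV \<times> X) \<inter> space M"
      by auto
    have "UNIV \<times> X \<in> sets (borel \<Otimes>\<^sub>M real_seq)"
      using X by (intro pair_measureI) auto
    then have "?a \<in> sets (vimage_algebra (space M) (\<lambda>w. (D w, \<lambda>n. \<theta> n w)) (borel \<Otimes>\<^sub>M real_seq))"
      unfolding a_eq by (rule in_vimage_algebra)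
    moreover have "?b \<in> sets (vimage_algebra (space M) (\<lambda>w n. \<omega> n w) label_seq)"
      using Y by (rule in_vimage_algebra)
    ultimately have "prob (?a \<inter> ?b) = prob ?a * prob ?b"
      by (rule indep_setD[OF indep])
    moreover have "emeasure label_seq Y = emeasure M ?b"
      by (subst distr_\<omega>[symmetric], subst emeasure_distr) auto
    moreover have "(\<lambda>w. (\<lambda>n. \<theta> n w, \<lambda>n. \<omega> n w)) -` (X \<times> Y) \<inter> space M = ?a \<inter> ?b"
      by auto
    ultimately show "emeasure (distr M real_seq (\<lambda>w n. \<theta> n w)) X * emeasure label_seq Y
        = emeasure (distr M (real_seq \<Otimes>\<^sub>M label_seq) (\<lambda>w. (\<lambda>n. \<theta> n w, \<lambda>n. \<omega> n w))) (X \<times> Y)"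
      by (simp add: emeasure_distr emeasure_eq_measure ennreal_mult pair_measurable)
  qed simp
qed

lemma nn_integral_prod_labels:
  assumes g[measurable]: "(\<lambda>(t, x). g t x) \<in> borel_measurable (borel \<Otimes>\<^sub>M label_law)"
  shows "(\<integral>\<^sup>+w. (\<Prod>n<N. g (\<theta> n w) (\<omega> n w)) \<partial>M) = (\<integral>\<^sup>+w. (\<Prod>n<N. \<integral>\<^sup>+x. g (\<theta> n w) x \<partial>label_law) \<partial>M)"
proof -
  interpret label: prob_space label_law
    by (rule prob_space_label_law)
  interpret label_seq: product_prob_space "\<lambda>_ :: nat. label_law" UNIV
    by (rule product_prob_spaceI) (rule prob_space_label_law)
  have gm: "(\<lambda>(t, x). \<Prod>n<N. g (t n) (x n)) \<in> borel_measurable (real_seq \<Otimes>\<^sub>M label_seq)"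
    by measurable
  have gm': "(\<lambda>(t, x). \<Prod>n<N. g (t n) (x n)) \<in> borel_measurable (distr M real_seq (\<lambda>w n. \<theta> n w) \<Otimes>\<^sub>M label_seq)"
    using gm by (simp cong: measurable_cong_sets)
  have "(\<integral>\<^sup>+w. (\<Prod>n<N. g (\<theta> n w) (\<omega> n w)) \<partial>M)
      = (\<integral>\<^sup>+p. (case p of (t, x) \<Rightarrow> \<Prod>n<N. g (t n) (x n)) \<partial>distr M (real_seq \<Otimes>\<^sub>M label_seq) (\<lambda>w. (\<lambda>n. \<theta> n w, \<lambda>n. \<omega> n w)))"
    using gm pair_measurable by (subst nn_integral_distr) auto
  also have "\<dots> = (\<integral>\<^sup>+t. (\<integral>\<^sup>+x. (\<Prod>n<N. g (t n) (x n)) \<partial>label_seq) \<partial>distr M real_seq (\<lambda>w n. \<theta> n w))"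
    unfolding distr_pair using label_seq.nn_integral_fst[OF gm'] by simp
  also have "\<dots> = (\<integral>\<^sup>+t. (\<Prod>n<N. \<integral>\<^sup>+x. g (t n) x \<partial>label_law) \<partial>distr M real_seq (\<lambda>w n. \<theta> n w))"
    by (intro nn_integral_cong nn_integral_prod_label_seq) measurable
  also have "\<dots> = (\<integral>\<^sup>+w. (\<Prod>n<N. \<integral>\<^sup>+x. g (\<theta> n w) x \<partial>label_law) \<partial>M)"
    using label.borel_measurable_nn_integral[OF g]
    by (intro nn_integral_distr borel_measurable_prod_ennreal) (auto intro: measurable_compose[OF measurable_component_singleton])
  finally show ?thesis .
qed

context
  fixes n\<^sub>d :: nat and \<phi> :: "real \<Rightarrow> (nat \<Rightarrow> nat) \<Rightarrow> real" and g :: "real \<Rightarrow> real \<Rightarrow> real"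
  assumes \<phi>01: "\<And>x a. \<phi> x a \<in> {0..1}"
    and \<phi>_meas [measurable]: "\<And>a. (\<lambda>x. \<phi> x a) \<in> borel_measurable label_law"
    and \<phi>_cong: "\<And>x a b. (\<And>d. d \<in> {1..n\<^sub>d} \<Longrightarrow> a d = b d) \<Longrightarrow> \<phi> x a = \<phi> x b"
    and g_eq: "\<And>t x. 0 < t \<Longrightarrow> t < 1 \<Longrightarrow> x \<in> space label_law \<Longrightarrow> measure_pmf.expectation (mark_pmf r n\<^sub>d t) (\<phi> x) = g t x"
    and g_meas [measurable]: "(\<lambda>(t, x). g t x) \<in> borel_measurable (borel \<Otimes>\<^sub>M label_law)"
begin

text \<open>Finitely many units and days have only countably many count arrays. For each array the
  conditional law is used as the probability of one event, and the sum over arrays is then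
  recognised as an integral against a product of mark laws. Integrating directly against the kernel
  would require its measurability.\<close>

lemma nn_integral_counts_prod:
  "(\<integral>\<^sup>+w. ennreal (\<Prod>n<N. \<phi> (\<omega> n w) (\<lambda>d. A d n w)) \<partial>M)
    = (\<integral>\<^sup>+w. (\<Prod>n<N. ennreal (g (\<theta> n w) (\<omega> n w))) \<partial>M)"
proof -
  let ?T = "Pi\<^sub>M {1..} (\<lambda>_ :: nat. Pi\<^sub>M UNIV (\<lambda>_ :: nat. count_space (UNIV :: nat set)))"
  define F where "F x a = (\<Prod>n<N. \<phi> (x n) (a n))" for x :: "nat \<Rightarrow> real" and a :: "nat \<Rightarrow> nat \<Rightarrow> nat"
  \<comment> \<open>The array cut to \<open>N\<close> units and \<open>n\<^sub>d\<close> days.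
    Padding with zeros matches the default values of \<open>PP\<close> and places it in the
    countable set \<open>C\<close>.\<close>
  define Gr where "Gr w = (\<lambda>n. if n < N then (\<lambda>d. if d \<in> {1..n\<^sub>d} then A d n w else 0) else (\<lambda>_. 0))" for w
  define C where "C = PiE_dflt {..<N} (\<lambda>_. 0) (\<lambda>_. PiE_dflt {1..n\<^sub>d} 0 (\<lambda>_. UNIV :: nat set))"
  define PP where "PP t = Pi_pmf {..<N} (\<lambda>_. 0) (\<lambda>n. mark_pmf r n\<^sub>d (clamp (t n)))" for t :: "nat \<Rightarrow> real"
  have C_iff: "a \<in> C \<longleftrightarrow> (\<forall>n\<ge>N. a n = (\<lambda>_. 0)) \<and> (\<forall>n<N. \<forall>d. d \<notin> {1..n\<^sub>d} \<longrightarrow> a n d = 0)" for a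
    by (auto simp: C_def PiE_dflt_def not_less)
  have C_countable: "countable C"
    unfolding C_def dflt_image_PiE[symmetric] by (intro countable_image countable_PiE) auto
  have Gr_C: "Gr w \<in> C" for w
    by (auto simp: C_iff Gr_def)
  have F_Gr: "F (\<lambda>n. \<omega> n w) (Gr w) = (\<Prod>n<N. \<phi> (\<omega> n w) (\<lambda>d. A d n w))" for w
    unfolding F_def by (intro prod.cong refl \<phi>_cong) (auto simp: Gr_def)
  have F01: "F x a \<in> {0..1}" for x a
    unfolding F_def by (intro prod_in_unit_interval \<phi>01)
  have Fm[measurable]: "(\<lambda>x. F x a) \<in> borel_measurable label_seq" for a
    unfolding F_def by measurable
  have pmf_PP: "pmf (PP t) a = (\<Prod>n<N. \<Prod>d=1..n\<^sub>d. pmf (negbin_pmf r (clamp (t n))) (a n d))" if "a \<in> C" for t a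
    using that unfolding PP_def mark_pmf_def by (subst pmf_Pi) (auto simp: C_iff pmf_Pi not_less intro!: prod.cong)
  have PP_support: "pmf (PP t) a = 0" if "a \<notin> C" for t a
  proof (cases "\<forall>n. n \<notin> {..<N} \<longrightarrow> a n = (\<lambda>_. 0)")
    case True
    then obtain n d where n: "n < N" "d \<notin> {1..n\<^sub>d}" "a n d \<noteq> 0"
      using \<open>a \<notin> C\<close> by (auto simp: C_iff not_less)
    then have "pmf (mark_pmf r n\<^sub>d (clamp (t n))) (a n) = 0"
      unfolding mark_pmf_def by (subst pmf_Pi) auto
    then have "(\<Prod>n<N. pmf (mark_pmf r n\<^sub>d (clamp (t n))) (a n)) = 0"
      using n(1) by (intro prod_zero) auto
    then show ?thesis
      unfolding PP_def by (subst pmf_Pi) simp_all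
  next
    case False
    then show ?thesis
      unfolding PP_def by (subst pmf_Pi) auto
  qed
  have [measurable]: "(\<lambda>w. pmf (PP (\<lambda>n. \<theta> n w)) a) \<in> borel_measurable M" if "a \<in> C" for a
    using r unfolding pmf_PP[OF that] by measurable
  have Gr_meas [measurable]: "{w \<in> space M. Gr w = a} \<in> sets M" for a
  proof -
    have "{w \<in> space M. Gr w = a} = {w \<in> space M. a \<in> C \<and> (\<forall>n<N. \<forall>d\<in>{1..n\<^sub>d}. A d n w = a n d)}"
      by (auto simp: Gr_def C_iff fun_eq_iff not_less)
    also have "\<dots> \<in> sets M"
      by measurable
    finally show ?thesis .
  qed
  have single: "(\<integral>\<^sup>+w. ennreal (F (\<lambda>n. \<omega> n w) a) * indicator {a} (Gr w) \<partial>M)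
      = (\<integral>\<^sup>+w. ennreal (pmf (PP (\<lambda>n. \<theta> n w)) a) * ennreal (F (\<lambda>n. \<omega> n w) a) \<partial>M)" if a: "a \<in> C" for a
  proof -
    define E where "E = {b \<in> space ?T. \<forall>d\<in>{1..n\<^sub>d}. \<forall>n<N. b d n = a n d}"
    have E: "E \<in> sets ?T"
    proof -
      define X where "X d = {c \<in> space (Pi\<^sub>M UNIV (\<lambda>_ :: nat. count_space (UNIV :: nat set))). \<forall>n\<in>{..<N}. c n \<in> {a n d}}" for d
      have X_sets: "X d \<in> sets (Pi\<^sub>M UNIV (\<lambda>_. count_space UNIV))" for d
        unfolding X_def by (intro sets.sets_Collect_finite_All sets_Collect_single') auto
      have "E = {b \<in> space ?T. \<forall>d\<in>{1..n\<^sub>d}. b d \<in> X d}"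
        by (simp add: E_def X_def space_PiM Ball_def)
      also have "\<dots> \<in> sets ?T"
        using X_sets by (intro sets.sets_Collect_finite_All sets_Collect_single) auto
      finally show ?thesis .
    qed
    have ind: "indicator {a} (Gr w) = (indicator E (\<lambda>d\<in>{1..}. \<lambda>n. A d n w) :: real)" if "w \<in> space M" for w
    proof -
      have "Gr w = a \<longleftrightarrow> (\<forall>d\<in>{1..n\<^sub>d}. \<forall>n<N. A d n w = a n d)"
        using a by (auto simp: Gr_def C_iff fun_eq_iff not_less)
      moreover have "(\<lambda>d\<in>{1..}. \<lambda>n. A d n w) \<in> E \<longleftrightarrow> (\<forall>d\<in>{1..n\<^sub>d}. \<forall>n<N. A d n w = a n d)"
        by (auto simp: E_def space_PiM)
      ultimately show ?thesis
        by (simp add: indicator_def)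
    qed
    \<comment> \<open>Almost surely all atoms lie in (0, 1), where \<open>clamp\<close> is the
      identity; the kernel mass is thus exchanged for an expression that is measurable
      everywhere.\<close>
    have "AE w in M. measure (case (\<lambda>n. \<theta> n w, \<lambda>n. \<omega> n w) of (t, x) \<Rightarrow> Pi\<^sub>M {1..} (\<lambda>_. nbp_counts r t)) E = pmf (PP (\<lambda>n. \<theta> n w)) a"
      using AE_\<theta>_range
    proof eventually_elim
      case (elim w)
      then have "clamp (\<theta> n w) = \<theta> n w" for n
        by (simp add: clamp_def)
      then show ?case
        by (simp only: prod.case E_def measure_nbp_counts_cylinder pmf_PP[OF a])
    qed
    then have "(\<integral>w. (case (\<lambda>n. \<theta> n w, \<lambda>n. \<omega> n w) of (t, x) \<Rightarrow> F x a) * indicator E (\<lambda>d\<in>{1..}. \<lambda>n. A d n w) \<partial>M)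
        = (\<integral>w. (case (\<lambda>n. \<theta> n w, \<lambda>n. \<omega> n w) of (t, x) \<Rightarrow> F x a) * pmf (PP (\<lambda>n. \<theta> n w)) a \<partial>M)"
      using F01 a by (intro has_cond_law_integral_mult_indicator[OF joint_law E])
        (auto intro!: integrable_const_bound[where B = 1])
    then have eq: "(\<integral>w. F (\<lambda>n. \<omega> n w) a * indicator {a} (Gr w) \<partial>M) = (\<integral>w. F (\<lambda>n. \<omega> n w) a * pmf (PP (\<lambda>n. \<theta> n w)) a \<partial>M)"
      using ind by (simp cong: Bochner_Integration.integral_cong)
    have [measurable]: "(\<lambda>w. indicator {a} (Gr w) :: real) \<in> borel_measurable M"
    proof -
      have "(\<lambda>w. indicator {w \<in> space M. Gr w = a} w :: real) \<in> borel_measurable M"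
        by measurable
      then show ?thesis
        by (rule measurable_cong[THEN iffD1, rotated]) (simp add: indicator_def)
    qed
    have "(\<integral>\<^sup>+w. ennreal (F (\<lambda>n. \<omega> n w) a) * indicator {a} (Gr w) \<partial>M) = (\<integral>\<^sup>+w. ennreal (F (\<lambda>n. \<omega> n w) a * indicator {a} (Gr w)) \<partial>M)"
      by (intro nn_integral_cong) (auto simp: indicator_def)
    also have "\<dots> = ennreal (\<integral>w. F (\<lambda>n. \<omega> n w) a * indicator {a} (Gr w) \<partial>M)"
      using F01 by (intro nn_integral_eq_integral integrable_const_bound[where B = 1]) (auto simp: indicator_def)
    also have "\<dots> = (\<integral>\<^sup>+w. ennreal (F (\<lambda>n. \<omega> n w) a * pmf (PP (\<lambda>n. \<theta> n w)) a) \<partial>M)"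
      unfolding eq using F01 a by (intro nn_integral_eq_integral[symmetric] integrable_const_bound[where B = 1])
        (auto simp: abs_mult pmf_le_1 intro!: mult_le_one)
    also have "\<dots> = (\<integral>\<^sup>+w. ennreal (pmf (PP (\<lambda>n. \<theta> n w)) a) * ennreal (F (\<lambda>n. \<omega> n w) a) \<partial>M)"
      using F01 by (intro nn_integral_cong) (simp add: ennreal_mult mult.commute)
    finally show ?thesis .
  qed
  have "(\<integral>\<^sup>+w. ennreal (\<Prod>n<N. \<phi> (\<omega> n w) (\<lambda>d. A d n w)) \<partial>M)
      = (\<integral>\<^sup>+w. (\<integral>\<^sup>+a. ennreal (F (\<lambda>n. \<omega> n w) a) * indicator {a} (Gr w) \<partial>count_space C) \<partial>M)"
  proof (intro nn_integral_cong)
    fix w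
    have "(\<integral>\<^sup>+a. ennreal (F (\<lambda>n. \<omega> n w) a) * indicator {a} (Gr w) \<partial>count_space C)
        = (\<integral>\<^sup>+a. ennreal (F (\<lambda>n. \<omega> n w) (Gr w)) * indicator {Gr w} a \<partial>count_space C)"
      by (intro nn_integral_cong) (auto simp: indicator_def)
    also have "\<dots> = ennreal (F (\<lambda>n. \<omega> n w) (Gr w))"
      using Gr_C by (simp add: nn_integral_cmult_indicator)
    finally show "ennreal (\<Prod>n<N. \<phi> (\<omega> n w) (\<lambda>d. A d n w)) = (\<integral>\<^sup>+a. ennreal (F (\<lambda>n. \<omega> n w) a) * indicator {a} (Gr w) \<partial>count_space C)"
      by (simp add: F_Gr)
  qed
  also have "\<dots> = (\<integral>\<^sup>+a. (\<integral>\<^sup>+w. ennreal (F (\<lambda>n. \<omega> n w) a) * indicator {a} (Gr w) \<partial>M) \<partial>count_space C)"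
  proof (rule nn_integral_count_space_nn_integral[OF C_countable])
    fix a assume "a \<in> C"
    have "(\<lambda>w. ennreal (F (\<lambda>n. \<omega> n w) a) * indicator {w \<in> space M. Gr w = a} w) \<in> borel_measurable M"
      by measurable
    then show "(\<lambda>w. ennreal (F (\<lambda>n. \<omega> n w) a) * indicator {a} (Gr w)) \<in> borel_measurable M"
      by (rule measurable_cong[THEN iffD1, rotated]) (simp add: indicator_def)
  qed
  also have "\<dots> = (\<integral>\<^sup>+a. (\<integral>\<^sup>+w. ennreal (pmf (PP (\<lambda>n. \<theta> n w)) a) * ennreal (F (\<lambda>n. \<omega> n w) a) \<partial>M) \<partial>count_space C)"
    by (intro nn_integral_cong single) simp
  also have "\<dots> = (\<integral>\<^sup>+w. (\<integral>\<^sup>+a. ennreal (pmf (PP (\<lambda>n. \<theta> n w)) a) * ennreal (F (\<lambda>n. \<omega> n w) a) \<partial>count_space C) \<partial>M)"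
    by (intro nn_integral_count_space_nn_integral[OF C_countable, symmetric]) measurable
  also have "\<dots> = (\<integral>\<^sup>+w. (\<integral>\<^sup>+a. ennreal (F (\<lambda>n. \<omega> n w) a) \<partial>PP (\<lambda>n. \<theta> n w)) \<partial>M)"
  proof (intro nn_integral_cong)
    fix w
    show "(\<integral>\<^sup>+a. ennreal (pmf (PP (\<lambda>n. \<theta> n w)) a) * ennreal (F (\<lambda>n. \<omega> n w) a) \<partial>count_space C)
        = (\<integral>\<^sup>+a. ennreal (F (\<lambda>n. \<omega> n w) a) \<partial>PP (\<lambda>n. \<theta> n w))"
      unfolding nn_integral_measure_pmf
      by (subst nn_integral_count_space_indicator) (auto intro!: nn_integral_cong simp: indicator_def PP_support)
  qed
  also have "\<dots> = (\<integral>\<^sup>+w. (\<Prod>n<N. ennreal (g (\<theta> n w) (\<omega> n w))) \<partial>M)"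
  proof (rule nn_integral_cong_AE)
    show "AE w in M. (\<integral>\<^sup>+a. ennreal (F (\<lambda>n. \<omega> n w) a) \<partial>PP (\<lambda>n. \<theta> n w)) = (\<Prod>n<N. ennreal (g (\<theta> n w) (\<omega> n w)))"
      using AE_\<theta>_range AE_space
    proof eventually_elim
      case (elim w)
      have "(\<integral>\<^sup>+a. ennreal (F (\<lambda>n. \<omega> n w) a) \<partial>PP (\<lambda>n. \<theta> n w))
          = (\<integral>\<^sup>+a. (\<Prod>n<N. ennreal (\<phi> (\<omega> n w) (a n))) \<partial>PP (\<lambda>n. \<theta> n w))"
        unfolding F_def using \<phi>01 by (intro nn_integral_cong) (simp add: prod_ennreal)
      also have "\<dots> = (\<Prod>n<N. \<integral>\<^sup>+a. ennreal (\<phi> (\<omega> n w) a) \<partial>mark_pmf r n\<^sub>d (clamp (\<theta> n w)))"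
        unfolding PP_def by (rule nn_integral_prod_Pi_pmf) simp
      also have "\<dots> = (\<Prod>n<N. ennreal (g (\<theta> n w) (\<omega> n w)))"
      proof (intro prod.cong refl)
        fix n
        have "(\<integral>\<^sup>+a. ennreal (\<phi> (\<omega> n w) a) \<partial>mark_pmf r n\<^sub>d (clamp (\<theta> n w)))
            = ennreal (measure_pmf.expectation (mark_pmf r n\<^sub>d (clamp (\<theta> n w))) (\<phi> (\<omega> n w)))"
          using \<phi>01 by (intro nn_integral_eq_integral measure_pmf.integrable_const_bound[where B = 1]) auto
        then show "(\<integral>\<^sup>+a. ennreal (\<phi> (\<omega> n w) a) \<partial>mark_pmf r n\<^sub>d (clamp (\<theta> n w))) = ennreal (g (\<theta> n w) (\<omega> n w))"
          using elim g_eq[of "\<theta> n w" "\<omega> n w"] measurable_space[OF \<omega>_measurable[of n] elim(2)] by (simp add: clamp_def)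
      qed
      finally show ?case .
    qed
  qed
  finally show ?thesis .
qed

text \<open>The identity is proved for the first \<open>N\<close> units, with counts and then labels
  integrated out, and passed to the limit on both sides by dominated convergence.\<close>

lemma integral_iprod_counts:
  "(\<integral>w. iprod (\<lambda>n. \<phi> (\<omega> n w) (\<lambda>d. A d n w)) \<partial>M)
    = (\<integral>w. iprod (\<lambda>n. \<integral>x. g (clamp (\<theta> n w)) x \<partial>label_law) \<partial>M)"
proof -
  interpret label: prob_space label_law
    by (rule prob_space_label_law)
  let ?G = "\<lambda>t. \<integral>x. g (clamp t) x \<partial>label_law"
  have gc[measurable]: "(\<lambda>(t, x). g (clamp t) x) \<in> borel_measurable (borel \<Otimes>\<^sub>M label_law)"
  proof -
    have "(\<lambda>p. (clamp (fst p), snd p)) \<in> borel \<Otimes>\<^sub>M label_law \<rightarrow>\<^sub>M borel \<Otimes>\<^sub>M label_law"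
      by measurable
    from measurable_compose[OF this g_meas] show ?thesis
      by (simp add: split_beta')
  qed
  have g01: "0 \<le> g (clamp t) x" "g (clamp t) x \<le> 1" if "x \<in> space label_law" for t x
  proof -
    have eq: "g (clamp t) x = measure_pmf.expectation (mark_pmf r n\<^sub>d (clamp t)) (\<phi> x)"
      using g_eq[OF clamp that] by simp
    show "0 \<le> g (clamp t) x"
      unfolding eq using \<phi>01 by (intro integral_nonneg_AE) auto
    have "measure_pmf.expectation (mark_pmf r n\<^sub>d (clamp t)) (\<phi> x) \<le> measure_pmf.expectation (mark_pmf r n\<^sub>d (clamp t)) (\<lambda>_. 1)"
      using \<phi>01 by (intro integral_mono measure_pmf.integrable_const_bound[where B = 1]) auto
    then show "g (clamp t) x \<le> 1"
      unfolding eq by simp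
  qed
  have g_int: "integrable label_law (g (clamp t))" for t
    using g01 by (intro label.integrable_const_bound[where B = 1]) (auto intro!: AE_I2 simp del: space_restrict_space)
  have G01: "?G t \<in> {0..1}" for t
  proof -
    have "?G t \<le> 1"
      using g01 by (intro label.integral_le_const g_int AE_I2) auto
    moreover have "0 \<le> ?G t"
      using g01 by (intro integral_nonneg_AE AE_I2) auto
    ultimately show ?thesis
      by simp
  qed
  have [measurable]: "?G \<in> borel_measurable borel"
    by (rule label.borel_measurable_lebesgue_integral) (use gc in simp)
  \<comment> \<open>No measurability of \<open>\<phi>\<close> in the counts is assumed. It depends
    on finitely many days only, so truncation by \<open>tr\<close> reduces the claim to countably
    many values.\<close>
  have A_fun: "(\<lambda>w. \<phi> (\<omega> n w) (\<lambda>d. A d n w)) \<in> borel_measurable M" for n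
  proof -
    define tr where "tr a = (\<lambda>d. if d \<in> {1..n\<^sub>d} then a d else (0 :: nat))" for a :: "nat \<Rightarrow> nat"
    define C where "C = PiE_dflt {1..n\<^sub>d} 0 (\<lambda>_. UNIV :: nat set)"
    have "countable C"
      unfolding C_def dflt_image_PiE[symmetric] by (intro countable_image countable_PiE) auto
    have tr: "(\<lambda>w. tr (\<lambda>d. A d n w)) \<in> M \<rightarrow>\<^sub>M count_space C"
    proof (rule measurable_count_space_eq_countable[THEN iffD2, OF \<open>countable C\<close>], intro conjI ballI)
      show "(\<lambda>w. tr (\<lambda>d. A d n w)) \<in> space M \<rightarrow> C"
        by (auto simp: tr_def C_def PiE_dflt_def)
      fix a assume "a \<in> C"
      then have "(\<lambda>w. tr (\<lambda>d. A d n w)) -` {a} \<inter> space M = {w \<in> space M. \<forall>d\<in>{1..n\<^sub>d}. A d n w = a d}"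
        by (auto simp: tr_def C_def PiE_dflt_def fun_eq_iff)
      also have "\<dots> \<in> sets M"
        by measurable
      finally show "(\<lambda>w. tr (\<lambda>d. A d n w)) -` {a} \<inter> space M \<in> sets M" .
    qed
    have "(\<lambda>w. \<phi> (\<omega> n w) (tr (\<lambda>d. A d n w))) \<in> borel_measurable M"
      by (rule measurable_compose_countable'[OF _ tr \<open>countable C\<close>, of "\<lambda>a w. \<phi> (\<omega> n w) a"]) measurable
    moreover have "\<phi> x (tr a) = \<phi> x a" for x a
      by (rule \<phi>_cong) (simp add: tr_def)
    ultimately show ?thesis
      by simp
  qed
  have "(\<integral>w. (\<Prod>n<N. \<phi> (\<omega> n w) (\<lambda>d. A d n w)) \<partial>M) = (\<integral>w. (\<Prod>n<N. ?G (\<theta> n w)) \<partial>M)" for N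
  proof -
    have p1: "(\<Prod>n<N. \<phi> (\<omega> n w) (\<lambda>d. A d n w)) \<in> {0..1}" "(\<Prod>n<N. ?G (\<theta> n w)) \<in> {0..1}" for w
      by (intro prod_in_unit_interval \<phi>01 G01)+
    have "ennreal (\<integral>w. (\<Prod>n<N. \<phi> (\<omega> n w) (\<lambda>d. A d n w)) \<partial>M) = (\<integral>\<^sup>+w. ennreal (\<Prod>n<N. \<phi> (\<omega> n w) (\<lambda>d. A d n w)) \<partial>M)"
      using p1 A_fun by (intro nn_integral_eq_integral[symmetric] integrable_const_bound[where B = 1]) auto
    also have "\<dots> = (\<integral>\<^sup>+w. (\<Prod>n<N. ennreal (g (\<theta> n w) (\<omega> n w))) \<partial>M)"
      by (rule nn_integral_counts_prod)
    also have "\<dots> = (\<integral>\<^sup>+w. (\<Prod>n<N. ennreal (g (clamp (\<theta> n w)) (\<omega> n w))) \<partial>M)"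
      using AE_\<theta>_range by (intro nn_integral_cong_AE) (auto elim!: eventually_mono simp: clamp_def)
    also have "\<dots> = (\<integral>\<^sup>+w. (\<Prod>n<N. \<integral>\<^sup>+x. ennreal (g (clamp (\<theta> n w)) x) \<partial>label_law) \<partial>M)"
      by (rule nn_integral_prod_labels) measurable
    also have "\<dots> = (\<integral>\<^sup>+w. ennreal (\<Prod>n<N. ?G (\<theta> n w)) \<partial>M)"
    proof (intro nn_integral_cong)
      fix w
      have "(\<integral>\<^sup>+x. ennreal (g (clamp t) x) \<partial>label_law) = ennreal (?G t)" for t
        using g01 by (intro nn_integral_eq_integral g_int AE_I2) auto
      then show "(\<Prod>n<N. \<integral>\<^sup>+x. ennreal (g (clamp (\<theta> n w)) x) \<partial>label_law) = ennreal (\<Prod>n<N. ?G (\<theta> n w))"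
        using G01 by (simp add: prod_ennreal)
    qed
    also have "\<dots> = ennreal (\<integral>w. (\<Prod>n<N. ?G (\<theta> n w)) \<partial>M)"
      using p1 by (intro nn_integral_eq_integral integrable_const_bound[where B = 1]) auto
    finally show ?thesis
      using p1 by (subst (asm) ennreal_inj) (auto intro!: integral_nonneg_AE)
  qed
  moreover have "(\<lambda>N. \<integral>w. (\<Prod>n<N. \<phi> (\<omega> n w) (\<lambda>d. A d n w)) \<partial>M) \<longlonglongrightarrow> (\<integral>w. iprod (\<lambda>n. \<phi> (\<omega> n w) (\<lambda>d. A d n w)) \<partial>M)"
    using \<phi>01 by (intro integral_iprod_LIMSEQ A_fun)
  moreover have "(\<lambda>N. \<integral>w. (\<Prod>n<N. ?G (\<theta> n w)) \<partial>M) \<longlonglongrightarrow> (\<integral>w. iprod (\<lambda>n. ?G (\<theta> n w)) \<partial>M)"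
    using G01 by (intro integral_iprod_LIMSEQ) measurable
  ultimately show ?thesis
    using LIMSEQ_unique by simp
qed

end

end

section \<open>The joint generating function\<close>

text \<open>The conventions agree at infinity: \<open>card\<close> of an infinite set and
  \<open>enn2real\<close> of infinity are both 0.\<close>

lemma measurable_card_nat_set:
  assumes "\<And>n::nat. {w \<in> space M. n \<in> S w} \<in> sets M"
  shows "(\<lambda>w. card (S w)) \<in> M \<rightarrow>\<^sub>M count_space UNIV"
proof -
  let ?e = "\<lambda>w. \<Sum>n. indicator {w \<in> space M. n \<in> S w} w :: ennreal"
  have "card (S w) = nat \<lfloor>enn2real (?e w)\<rfloor>" if "w \<in> space M" for w
  proof -
    have "?e w = (\<Sum>n. indicator (S w) n)"
      using that by (auto simp: indicator_def intro!: suminf_cong)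
    also have "\<dots> = emeasure (count_space UNIV) (S w)"
      using nn_integral_count_space_nat[of "indicator (S w)"] by simp
    finally show ?thesis
      by (simp add: emeasure_count_space flip: ennreal_of_nat_eq_real_of_nat)
  qed
  moreover have "?e \<in> borel_measurable M"
    using assms by measurable
  then have "(\<lambda>w. nat \<lfloor>enn2real (?e w)\<rfloor>) \<in> M \<rightarrow>\<^sub>M count_space UNIV"
    by measurable
  ultimately show ?thesis
    by (subst measurable_cong) auto
qed

text \<open>Powers are turned into indicators one coordinate at a time; all other factors are
  absorbed into the weight of \<open>pgf_determines_weighted_law\<close>.\<close>

lemma joint_pgf_determines_weights:
  fixes V1 V2 :: "'a \<Rightarrow> real" and X :: "'i \<Rightarrow> 'a \<Rightarrow> nat"
  assumes V[measurable]: "integrable M V1" "integrable M V2"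
    and X[measurable]: "\<And>i. i \<in> S \<Longrightarrow> X i \<in> M \<rightarrow>\<^sub>M count_space UNIV"
    and eq: "\<And>I z. finite I \<Longrightarrow> I \<subseteq> S \<Longrightarrow> (\<And>i. 0 < z i \<and> z i < 1) \<Longrightarrow>
      (\<integral>w. V1 w * (\<Prod>i\<in>I. z i ^ X i w) \<partial>M) = (\<integral>w. V2 w * (\<Prod>i\<in>I. z i ^ X i w) \<partial>M)"
    and J: "finite J" "J \<subseteq> S"
  shows "(\<integral>w. V1 w * (\<Prod>i\<in>J. indicator (C i) (X i w)) \<partial>M) = (\<integral>w. V2 w * (\<Prod>i\<in>J. indicator (C i) (X i w)) \<partial>M)"
proof -
  have int: "integrable M (\<lambda>w. V w * ((\<Prod>i\<in>J. indicator (C i) (X i w)) * (\<Prod>i\<in>I. z i ^ X i w)))"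
    if V: "integrable M V" and I: "finite I" "I \<subseteq> S" and z: "\<And>i. 0 < z i \<and> z i < 1" and J: "finite J" "J \<subseteq> S"
    for V and I J and z :: "'i \<Rightarrow> real"
  proof (rule Bochner_Integration.integrable_bound[OF V])
    have [measurable]: "V \<in> borel_measurable M"
      using V by auto
    have "(\<lambda>w. \<Prod>i\<in>J. indicator (C i) (X i w) :: real) \<in> borel_measurable M"
      using J by (intro borel_measurable_prod measurable_compose[OF X]) auto
    moreover have "(\<lambda>w. \<Prod>i\<in>I. z i ^ X i w) \<in> borel_measurable M"
      using I by (intro borel_measurable_prod measurable_compose[OF X, of _ "\<lambda>k. _ ^ k"]) auto
    ultimately show "(\<lambda>w. V w * ((\<Prod>i\<in>J. indicator (C i) (X i w)) * (\<Prod>i\<in>I. z i ^ X i w))) \<in> borel_measurable M"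
      by measurable
    have "(\<Prod>i\<in>J. indicator (C i) (X i w) :: real) \<in> {0..1}" "(\<Prod>i\<in>I. z i ^ X i w) \<in> {0..1}" for w
      using z by (auto intro!: prod_in_unit_interval simp del: atLeastAtMost_iff)
        (auto simp: indicator_def less_imp_le power_le_one)
    then show "AE w in M. norm (V w * ((\<Prod>i\<in>J. indicator (C i) (X i w)) * (\<Prod>i\<in>I. z i ^ X i w))) \<le> norm (V w)"
      by (intro AE_I2) (auto simp: abs_mult intro!: mult_left_le mult_le_one)
  qed
  \<comment> \<open>The set \<open>I\<close> of coordinates still carrying powers stays arbitrary.
    Converting coordinate \<open>k\<close> uses the induction hypothesis for
    \<open>insert k I\<close> with \<open>u\<close> as the value of \<open>z\<close> at
    \<open>k\<close>.\<close>
  have "\<forall>I z. finite I \<longrightarrow> I \<subseteq> S \<longrightarrow> I \<inter> J = {} \<longrightarrow> (\<forall>i. 0 < z i \<and> z i < 1) \<longrightarrow>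
      (\<integral>w. V1 w * ((\<Prod>i\<in>J. indicator (C i) (X i w)) * (\<Prod>i\<in>I. z i ^ X i w)) \<partial>M)
      = (\<integral>w. V2 w * ((\<Prod>i\<in>J. indicator (C i) (X i w)) * (\<Prod>i\<in>I. z i ^ X i w)) \<partial>M)"
    using J
  proof (induction J)
    case empty
    then show ?case
      using eq by simp
  next
    case (insert k J)
    show ?case
    proof (intro allI impI)
      fix I and z :: "'i \<Rightarrow> real" assume I: "finite I" "I \<subseteq> S" "I \<inter> insert k J = {}" and z: "\<forall>i. 0 < z i \<and> z i < 1"
      let ?W = "\<lambda>V w. V w * ((\<Prod>i\<in>J. indicator (C i) (X i w)) * (\<Prod>i\<in>I. z i ^ X i w))"
      have "(\<integral>w. ?W V1 w * indicator (C k) (X k w) \<partial>M) = (\<integral>w. ?W V2 w * indicator (C k) (X k w) \<partial>M)"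
      proof (rule pgf_determines_weighted_law)
        show "integrable M (?W V1)" "integrable M (?W V2)"
          using insert.prems insert.hyps I z by (intro int V; auto)+
        show "X k \<in> M \<rightarrow>\<^sub>M count_space UNIV" "X k \<in> M \<rightarrow>\<^sub>M count_space UNIV"
          using insert.prems by (intro X; auto)+
        fix u :: real assume u: "0 < u" "u < 1"
        have k: "k \<notin> I" "k \<notin> J"
          using I insert.hyps by auto
        have *: "?W V w * u ^ X k w = V w * ((\<Prod>i\<in>J. indicator (C i) (X i w)) * (\<Prod>i\<in>insert k I. (z(k := u)) i ^ X i w))" for V w
        proof -
          have "(\<Prod>i\<in>insert k I. (z(k := u)) i ^ X i w) = u ^ X k w * (\<Prod>i\<in>I. (z(k := u)) i ^ X i w)"
            using I k by simp
          also have "(\<Prod>i\<in>I. (z(k := u)) i ^ X i w) = (\<Prod>i\<in>I. z i ^ X i w)"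
            using k by (intro prod.cong) auto
          finally show ?thesis
            by (simp add: mult_ac)
        qed
        show "(\<integral>w. ?W V1 w * u ^ X k w \<partial>M) = (\<integral>w. ?W V2 w * u ^ X k w \<partial>M)"
          unfolding * using insert I z u k by (intro insert.IH[rule_format]) auto
      qed
      then show "(\<integral>w. V1 w * ((\<Prod>i\<in>insert k J. indicator (C i) (X i w)) * (\<Prod>i\<in>I. z i ^ X i w)) \<partial>M)
          = (\<integral>w. V2 w * ((\<Prod>i\<in>insert k J. indicator (C i) (X i w)) * (\<Prod>i\<in>I. z i ^ X i w)) \<partial>M)"
        using insert.hyps by (simp add: mult_ac)
    qed
  qed
  from this[rule_format, of "{}" "\<lambda>_. 1 / 2"] show ?thesis
    by simp
qed

lemma measurable_measure_algebraI:
  assumes "\<And>w. w \<in> space N \<Longrightarrow> sets (K w) = sets S"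
    and "\<And>B. B \<in> sets S \<Longrightarrow> (\<lambda>w. emeasure (K w) B) \<in> borel_measurable N"
  shows "K \<in> N \<rightarrow>\<^sub>M measure_algebra S"
  using assms by (auto intro!: measurable_Sup2 measurable_vimage_algebra2 simp: measure_algebra_def)

lemma measurable_emeasure_measure_algebra:
  "B \<in> sets S \<Longrightarrow> (\<lambda>\<nu>. emeasure \<nu> B) \<in> borel_measurable (measure_algebra S)"
  by (auto intro!: measurable_Sup1 measurable_vimage_algebra1 simp: measure_algebra_def)

lemma label_law_diagonal: "AE p in label_law \<Otimes>\<^sub>M label_law. fst p \<noteq> snd p"
proof -
  interpret label: prob_space label_law
    by (rule prob_space_label_law)
  interpret pair_sigma_finite label_law label_law ..
  have [measurable]: "{p \<in> space (label_law \<Otimes>\<^sub>M label_law). fst p \<noteq> snd p} \<in> sets (label_law \<Otimes>\<^sub>M label_law)"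
  proof -
    have [measurable]: "(\<lambda>x. x) \<in> label_law \<rightarrow>\<^sub>M borel"
      by (intro measurable_restrict_space1) simp
    have "fst \<in> label_law \<Otimes>\<^sub>M label_law \<rightarrow>\<^sub>M borel" "snd \<in> label_law \<Otimes>\<^sub>M label_law \<rightarrow>\<^sub>M borel"
      using measurable_compose[OF measurable_fst \<open>(\<lambda>x. x) \<in> label_law \<rightarrow>\<^sub>M borel\<close>]
        measurable_compose[OF measurable_snd \<open>(\<lambda>x. x) \<in> label_law \<rightarrow>\<^sub>M borel\<close>] by auto
    then show ?thesis
      by measurable
  qed
  have "AE x in label_law. AE y in label_law. x \<noteq> y"
  proof (rule AE_I2)
    fix x :: real
    have "AE y in lborel. x \<noteq> y"
      using AE_lborel_singleton[of x] by (auto elim!: eventually_mono)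
    then show "AE y in label_law. x \<noteq> y"
      by (subst AE_restrict_space_iff) auto
  qed
  then show ?thesis
    by (subst AE_pair_iff[symmetric]) auto
qed

context sbsp_nbp
begin

text \<open>With distinct labels, counting observed locations is the same as counting observed
  indices.\<close>

lemma AE_inj_\<omega>: "AE w in M. inj (\<lambda>n. \<omega> n w)"
proof -
  interpret label: prob_space label_law
    by (rule prob_space_label_law)
  have indep: "indep_vars (\<lambda>_. label_law) \<omega> UNIV" and law: "distr M label_law (\<omega> n) = label_law" for n
    using series by (auto simp: sbsp_series_def)
  have "AE w in M. \<omega> m w \<noteq> \<omega> n w" if "m \<noteq> n" for m n
  proof -
    have d: "label_law \<Otimes>\<^sub>M label_law = distr M (label_law \<Otimes>\<^sub>M label_law) (\<lambda>w. (\<omega> m w, \<omega> n w))"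
    proof (rule pair_measure_eqI)
      show "sigma_finite_measure label_law" "sigma_finite_measure label_law"
        by unfold_locales
      fix X Y assume X[measurable]: "X \<in> sets label_law" and Y[measurable]: "Y \<in> sets label_law"
      define B where "B i = (if i = m then X else Y)" for i
      have "prob (\<Inter>i\<in>{m, n}. \<omega> i -` B i \<inter> space M) = (\<Prod>i\<in>{m, n}. prob (\<omega> i -` B i \<inter> space M))"
        using X Y by (intro indep_varsD[OF indep]) (auto simp: B_def)
      moreover have "(\<Inter>i\<in>{m, n}. \<omega> i -` B i \<inter> space M) = (\<lambda>w. (\<omega> m w, \<omega> n w)) -` (X \<times> Y) \<inter> space M"
        using that by (auto simp: B_def)
      moreover have "emeasure label_law X = prob (\<omega> m -` X \<inter> space M)" "emeasure label_law Y = prob (\<omega> n -` Y \<inter> space M)"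
        by (subst law[symmetric], subst emeasure_distr; simp add: emeasure_eq_measure)+
      ultimately show "emeasure label_law X * emeasure label_law Y
          = emeasure (distr M (label_law \<Otimes>\<^sub>M label_law) (\<lambda>w. (\<omega> m w, \<omega> n w))) (X \<times> Y)"
        using that by (simp add: emeasure_distr emeasure_eq_measure B_def ennreal_mult)
    qed simp
    have "AE p in distr M (label_law \<Otimes>\<^sub>M label_law) (\<lambda>w. (\<omega> m w, \<omega> n w)). fst p \<noteq> snd p"
      unfolding d[symmetric] by (rule label_law_diagonal)
    then show ?thesis
      using AE_distrD[of "\<lambda>w. (\<omega> m w, \<omega> n w)" M "label_law \<Otimes>\<^sub>M label_law" "\<lambda>p. fst p \<noteq> snd p"] by simp
  qed
  then have "AE w in M. \<forall>m n. m \<noteq> n \<longrightarrow> \<omega> m w \<noteq> \<omega> n w"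
    by (simp add: AE_all_countable)
  then show ?thesis
    by eventually_elim (auto simp: inj_def)
qed

end

locale sbsp_prediction = sbsp_nbp +
  fixes D0 D1 j :: nat
  assumes D0: "1 \<le> D0" and D1: "1 \<le> D1" and j: "1 \<le> j"
begin

abbreviation "\<psi> \<equiv> psi \<sigma> r 0 (real D0)"
abbreviation "\<rho> \<equiv> rho \<sigma> r D0 D1 j"
abbreviation "p \<equiv> p_new \<beta> \<sigma> r D0 D1 j"

text \<open>The constant \<open>K\<close> of the overview. The subtracted power is the chance of
  being unobserved, a case in which the monomial in \<open>z\<close> equals 1; what remains is the
  contribution of observed units.\<close>

definition seen_mass :: "(nat \<Rightarrow> real \<Rightarrow> real) \<Rightarrow> real" where
  "seen_mass z = stable_mass \<sigma> (\<lambda>t. (\<integral>x. (\<Prod>d=1..D0. ((1 - t) / (1 - t * z d x)) powr r) \<partial>label_law)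
      - (1 - t) powr (r * real D0))"

text \<open>The mean weight \<open>G t\<close> satisfies \<open>1 - G t = (1 - a t) + (1 - u) * (a t
  * q t) - v * (W t - a t)\<close>. Integrated against the stable rate, the three terms give
  \<open>\<psi>\<close>, \<open>(1 - u) * \<rho>\<close> and \<open>v * seen_mass z\<close>.\<close>

lemma joint_pgf:
  assumes z_meas[measurable]: "\<And>d. z d \<in> borel_measurable label_law" and z: "\<And>d x. z d x \<in> {0..1}"
    and u: "0 < u" "u \<le> 1" and v: "0 \<le> v" "v \<le> 1"
  shows "(\<integral>w. iprod (\<lambda>n. unit_weight D0 D1 j u v (\<lambda>d. z d (\<omega> n w)) (\<lambda>d. A d n w)) \<partial>M)
      = (\<beta> / (\<beta> + (\<psi> + (1 - u) * \<rho> - v * seen_mass z))) powr (c + 1)"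
    and "0 \<le> seen_mass z" "seen_mass z \<le> \<psi>"
proof -
  interpret label: prob_space label_law
    by (rule prob_space_label_law)
  define a where "a t = (1 - t) powr (r * real D0)" for t
  define f where "f t x = (\<Prod>d=1..D0. ((1 - t) / (1 - t * z d x)) powr r)" for t x
  define W where "W t = (\<integral>x. f t x \<partial>label_law)" for t
  define q where "q t = pmf (negbin_pmf (r * real D1) (clamp t)) j" for t
  define g where "g t x = a t * (1 - (1 - u) * q t) + v * (f t x - a t)" for t x
  define G where "G t = a t * (1 - (1 - u) * q t) + v * (W t - a t)" for t
  \<comment> \<open>The value 1 outside (0, 1) makes the bounds required by
    \<open>sbsp_series_iprod\<close> hold on the whole line; the atoms almost surely avoid that
    region.\<close>
  define \<gamma> where "\<gamma> t = (if 0 < t \<and> t < 1 then G t else 1)" for t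
  have e: "0 < r * real D0" "0 < r * real D1"
    using r D0 D1 by auto
  have [measurable]: "a \<in> borel_measurable borel"
    unfolding a_def by measurable
  have [measurable]: "q \<in> borel_measurable borel"
    unfolding q_def using borel_measurable_pmf_negbin_clamp[OF e(2)] by simp
  have f_meas[measurable]: "(\<lambda>(t, x). f t x) \<in> borel_measurable (borel \<Otimes>\<^sub>M label_law)"
    unfolding f_def by measurable
  have [measurable]: "f t \<in> borel_measurable label_law" for t
    unfolding f_def by measurable
  have [measurable]: "W \<in> borel_measurable borel"
    unfolding W_def by (rule label.borel_measurable_lebesgue_integral[OF f_meas])
  have [measurable]: "\<gamma> \<in> borel_measurable borel"
    unfolding \<gamma>_def G_def by measurable
  have factor: "1 - t \<le> (1 - t) / (1 - t * y)" "(1 - t) / (1 - t * y) \<le> 1"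
    if t: "0 < t" "t < 1" and y: "y \<in> {0..1}" for t y :: real
  proof -
    have "t * y \<le> t"
      using t y by (simp add: mult_left_le)
    moreover have "0 \<le> t * y"
      using t y by simp
    moreover have "(1 - t) * (1 - t * y) \<le> (1 - t) * 1"
      using t y by (intro mult_left_mono) auto
    moreover have "0 < 1 - t * y"
      using calculation(1) t by linarith
    ultimately show "1 - t \<le> (1 - t) / (1 - t * y)" "(1 - t) / (1 - t * y) \<le> 1"
      by (simp_all only: pos_le_divide_eq pos_divide_le_eq) simp_all
  qed
  have f01: "a t \<le> f t x" "f t x \<le> 1" if t: "0 < t" "t < 1" for t x
  proof -
    have "a t = (\<Prod>d=1..D0. (1 - t) powr r)"
    proof -
      have "((1 - t) powr r) ^ D0 = ((1 - t) powr r) powr real D0"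
        using t by (subst powr_realpow) auto
      then show ?thesis
        by (simp add: a_def powr_powr)
    qed
    also have "\<dots> \<le> f t x"
      unfolding f_def using t z r factor by (intro prod_mono conjI powr_mono2) auto
    finally show "a t \<le> f t x" .
    show "f t x \<le> 1"
      unfolding f_def
    proof (rule prod_le_1)
      fix d
      have "0 \<le> (1 - t) / (1 - t * z d x)"
        using factor(1)[OF t z, of d x] t by linarith
      then show "0 \<le> ((1 - t) / (1 - t * z d x)) powr r \<and> ((1 - t) / (1 - t * z d x)) powr r \<le> 1"
        using factor(2)[OF t z, of d x] r powr_mono2[of r "(1 - t) / (1 - t * z d x)" 1] by simp
    qed
  qed
  have a01: "0 < a t" "a t < 1" if "0 < t" "t < 1" for t
    using that powr_less_mono2[OF e(1), of "1 - t" 1] by (auto simp: a_def)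
  have f_int: "integrable label_law (f t)" if t: "0 < t" "t < 1" for t
  proof (rule label.integrable_const_bound[where B = 1])
    show "AE x in label_law. norm (f t x) \<le> 1"
      using f01[OF t] a01(1)[OF t] by (intro AE_I2) (simp add: abs_le_iff, smt (verit))
  qed measurable
  have W01: "a t \<le> W t" "W t \<le> 1" if t: "0 < t" "t < 1" for t
    unfolding W_def using f01[OF t] by (auto intro!: label.integral_ge_const label.integral_le_const f_int t)
  have q01: "0 \<le> q t" "q t \<le> 1" for t
    by (auto simp: q_def pmf_le_1)
  have \<gamma>01: "\<gamma> t \<in> {0<..1}" for t
  proof (cases "0 < t \<and> t < 1")
    case True
    then have t: "0 < t" "t < 1"
      by auto
    \<comment> \<open>The lower bound \<open>a t * u\<close> keeps the mean weight positive, and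
      this is why \<open>u > 0\<close> is assumed.\<close>
    have "(1 - u) * q t \<le> 1 - u"
      using q01[of t] u by (intro mult_left_le) auto
    then have 1: "a t * u \<le> a t * (1 - (1 - u) * q t)"
      using a01(1)[OF t] by (intro mult_left_mono) auto
    have "0 < a t * u"
      using a01(1)[OF t] u by simp
    moreover have "0 \<le> v * (W t - a t)"
      using W01[OF t] v by simp
    moreover have "a t * (1 - (1 - u) * q t) \<le> a t * 1"
      using a01(1)[OF t] q01[of t] u by (intro mult_left_mono) auto
    moreover have "v * (W t - a t) \<le> 1 * (1 - a t)"
      using W01[OF t] v by (intro mult_mono) auto
    ultimately show ?thesis
      using 1 True by (simp add: \<gamma>_def G_def)
  qed (auto simp: \<gamma>_def)
  have W_cont: "continuous_on {0<..<1} W"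
  proof (rule continuous_on_sequentiallyI)
    fix s :: "nat \<Rightarrow> real" and t assume s: "\<forall>n. s n \<in> {0<..<1}" and t: "t \<in> {0<..<1}" and lim: "s \<longlonglongrightarrow> t"
    show "(\<lambda>n. W (s n)) \<longlonglongrightarrow> W t"
      unfolding W_def
    proof (rule integral_dominated_convergence[where w = "\<lambda>_. 1"])
      show "AE x in label_law. norm (f (s n) x) \<le> 1" for n
      proof (rule AE_I2)
        fix x
        have "0 < s n" "s n < 1"
          using s by auto
        then show "norm (f (s n) x) \<le> 1"
          using f01[of "s n" x] a01(1)[of "s n"] by (simp add: abs_le_iff)
      qed
      show "AE x in label_law. (\<lambda>n. f (s n) x) \<longlonglongrightarrow> f t x"
      proof (rule AE_I2)
        fix x
        have "t * z d x \<le> t" for d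
          using t z[of d x] by (simp add: mult_left_le)
        then have "1 - t * z d x \<noteq> 0" for d
          using t by (metis diff_gt_0_iff_gt greaterThanLessThan_iff less_irrefl order_le_less_trans)
        then show "(\<lambda>n. f (s n) x) \<longlonglongrightarrow> f t x"
          unfolding f_def using t by (intro tendsto_intros lim) auto
      qed
    qed auto
  qed
  have q_cont: "continuous_on {0<..<1} q"
  proof -
    have "continuous_on {0<..<1} (\<lambda>t. ((real j + r * real D1 - 1) gchoose j) * t ^ j * (1 - t) powr (r * real D1))"
      by (intro continuous_intros) auto
    then show ?thesis
      by (rule continuous_on_cong[THEN iffD1, rotated -1, OF _ refl])
        (use e in \<open>auto simp: q_def clamp_def pmf_negbin\<close>)
  qed
  have "continuous_on {0<..<1} G"
    unfolding G_def a_def by (intro continuous_intros W_cont q_cont) auto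
  then have \<gamma>_cont: "continuous_on {0<..<1} \<gamma>"
    by (rule continuous_on_cong[THEN iffD1, rotated -1, OF _ refl]) (auto simp: \<gamma>_def)
  have i1: "set_integrable lborel {0<..<1} (\<lambda>t. (1 - a t) * stable_rate \<sigma> t)" "stable_mass \<sigma> (\<lambda>t. 1 - a t) = \<psi>"
    using stable_mass_observed[OF \<sigma> e(1)] by (auto simp: a_def[abs_def] psi_def)
  have q_eq: "q t = pmf (negbin_pmf (r * real D1) t) j" if "t \<in> {0<..<1}" for t
    using that by (simp add: q_def clamp_def)
  have i2: "set_integrable lborel {0<..<1} (\<lambda>t. (a t * q t) * stable_rate \<sigma> t)" "stable_mass \<sigma> (\<lambda>t. a t * q t) = \<rho>"
  proof -
    note new = stable_mass_new[OF \<sigma> less_imp_le[OF e(1)] e(2) j]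
    show "set_integrable lborel {0<..<1} (\<lambda>t. (a t * q t) * stable_rate \<sigma> t)"
      using new(1) by (rule set_integrable_cong[THEN iffD1, rotated -1]) (auto simp: a_def q_eq)
    have "stable_mass \<sigma> (\<lambda>t. a t * q t) = stable_mass \<sigma> (\<lambda>t. (1 - t) powr (r * real D0) * pmf (negbin_pmf (r * real D1) t) j)"
      unfolding stable_mass_def by (intro set_lebesgue_integral_cong) (auto simp: a_def q_eq)
    then show "stable_mass \<sigma> (\<lambda>t. a t * q t) = \<rho>"
      unfolding new(2) rho_def by (simp add: distrib_left)
  qed
  have i3: "set_integrable lborel {0<..<1} (\<lambda>t. (W t - a t) * stable_rate \<sigma> t)"
    using i1(1) unfolding set_integrable_def
  proof (rule Bochner_Integration.integrable_bound)
    show "AE t in lborel. norm (indicator {0<..<1} t *\<^sub>R ((W t - a t) * stable_rate \<sigma> t)) \<le> norm (indicator {0<..<1} t *\<^sub>R ((1 - a t) * stable_rate \<sigma> t))"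
    proof (rule AE_I2)
      fix t
      show "norm (indicator {0<..<1} t *\<^sub>R ((W t - a t) * stable_rate \<sigma> t)) \<le> norm (indicator {0<..<1} t *\<^sub>R ((1 - a t) * stable_rate \<sigma> t))"
        using W01[of t] a01[of t] \<sigma> by (auto simp: indicator_def abs_mult intro!: mult_right_mono)
    qed
  qed measurable
  have K: "seen_mass z = stable_mass \<sigma> (\<lambda>t. W t - a t)"
    unfolding seen_mass_def W_def f_def a_def ..
  show "0 \<le> seen_mass z"
    unfolding K stable_mass_def set_lebesgue_integral_def using W01 \<sigma>
    by (intro integral_nonneg_AE AE_I2) (auto simp: indicator_def)
  show "seen_mass z \<le> \<psi>"
    unfolding K i1(2)[symmetric] stable_mass_def set_lebesgue_integral_def
    using i1(1) i3 W01 \<sigma> unfolding set_integrable_def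
    by (intro integral_mono) (auto simp: indicator_def intro!: mult_right_mono)
  have mass_eq: "(\<lambda>t. (1 - \<gamma> t) * stable_rate \<sigma> t) t = (1 - a t) * stable_rate \<sigma> t + ((1 - u) * ((a t * q t) * stable_rate \<sigma> t) - v * ((W t - a t) * stable_rate \<sigma> t))"
    if "t \<in> {0<..<1}" for t
    using that by (simp add: \<gamma>_def G_def algebra_simps)
  have comb: "set_integrable lborel {0<..<1} (\<lambda>t. (1 - u) * ((a t * q t) * stable_rate \<sigma> t) - v * ((W t - a t) * stable_rate \<sigma> t))"
    using i2(1) i3 by (intro set_integral_diff(1) set_integrable_mult_right)
  have "set_integrable lborel {0<..<1} (\<lambda>t. (1 - a t) * stable_rate \<sigma> t + ((1 - u) * ((a t * q t) * stable_rate \<sigma> t) - v * ((W t - a t) * stable_rate \<sigma> t)))"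
    using i1(1) comb by (rule set_integral_add(1))
  then have \<gamma>_int: "set_integrable lborel {0<..<1} (\<lambda>t. (1 - \<gamma> t) * stable_rate \<sigma> t)"
    using mass_eq by (subst set_integrable_cong) auto
  have mass: "stable_mass \<sigma> (\<lambda>t. 1 - \<gamma> t) = \<psi> + (1 - u) * \<rho> - v * seen_mass z"
  proof -
    have "stable_mass \<sigma> (\<lambda>t. 1 - \<gamma> t)
        = (LBINT t:{0<..<1}. (1 - a t) * stable_rate \<sigma> t + ((1 - u) * ((a t * q t) * stable_rate \<sigma> t) - v * ((W t - a t) * stable_rate \<sigma> t)))"
      unfolding stable_mass_def using mass_eq by (intro set_lebesgue_integral_cong) auto
    also have "\<dots> = (LBINT t:{0<..<1}. (1 - a t) * stable_rate \<sigma> t)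
        + (LBINT t:{0<..<1}. (1 - u) * ((a t * q t) * stable_rate \<sigma> t) - v * ((W t - a t) * stable_rate \<sigma> t))"
      using i1(1) comb by (rule set_integral_add(2))
    also have "(LBINT t:{0<..<1}. (1 - u) * ((a t * q t) * stable_rate \<sigma> t) - v * ((W t - a t) * stable_rate \<sigma> t))
        = (LBINT t:{0<..<1}. (1 - u) * ((a t * q t) * stable_rate \<sigma> t)) - (LBINT t:{0<..<1}. v * ((W t - a t) * stable_rate \<sigma> t))"
      using i2(1) i3 by (intro set_integral_diff(2) set_integrable_mult_right)
    also have "\<dots> = (1 - u) * \<rho> - v * seen_mass z"
      unfolding K i2(2)[symmetric] stable_mass_def by (simp only: set_integral_mult_right)
    finally show ?thesis
      using i1(2) by (simp add: stable_mass_def)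
  qed
  have "(\<integral>w. iprod (\<lambda>n. unit_weight D0 D1 j u v (\<lambda>d. z d (\<omega> n w)) (\<lambda>d. A d n w)) \<partial>M)
      = (\<integral>w. iprod (\<lambda>n. \<integral>x. g (clamp (\<theta> n w)) x \<partial>label_law) \<partial>M)"
  proof (rule integral_iprod_counts[of "\<lambda>x. unit_weight D0 D1 j u v (\<lambda>d. z d x)" "D0 + D1" g])
    show "unit_weight D0 D1 j u v (\<lambda>d. z d x) b \<in> {0..1}" for x b
      using u v z by (intro unit_weight_in_unit_interval) auto
    show "(\<lambda>x. unit_weight D0 D1 j u v (\<lambda>d. z d x) b) \<in> borel_measurable label_law" for b
      unfolding unit_weight_def by measurable
    show "unit_weight D0 D1 j u v (\<lambda>d. z d x) b = unit_weight D0 D1 j u v (\<lambda>d. z d x) b'"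
      if "\<And>d. d \<in> {1..D0 + D1} \<Longrightarrow> b d = b' d" for x b b'
    proof -
      have "(\<Sum>d=1..D0. b d) = (\<Sum>d=1..D0. b' d)" "(\<Sum>d=1..D1. b (D0 + d)) = (\<Sum>d=1..D1. b' (D0 + d))"
        "(\<Prod>d=1..D0. z d x ^ b d) = (\<Prod>d=1..D0. z d x ^ b' d)"
        using that by (auto intro!: sum.cong prod.cong)
      then show ?thesis
        by (simp only: unit_weight_def)
    qed
    show "measure_pmf.expectation (mark_pmf r (D0 + D1) t) (unit_weight D0 D1 j u v (\<lambda>d. z d x)) = g t x"
      if "0 < t" "t < 1" for t x
      using expectation_unit_weight[OF r that D1, of u v "\<lambda>d. z d x" D0 j] u v z that
      by (simp add: g_def a_def f_def q_def clamp_def)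
    show "(\<lambda>(t, x). g t x) \<in> borel_measurable (borel \<Otimes>\<^sub>M label_law)"
      unfolding g_def by measurable
  qed
  also have "\<dots> = (\<integral>w. iprod (\<lambda>n. \<gamma> (\<theta> n w)) \<partial>M)"
  proof -
    have G_eq: "(\<integral>x. g t x \<partial>label_law) = G t" if t: "0 < t" "t < 1" for t
      unfolding g_def G_def W_def using f_int[OF t] label.prob_space by simp
    have "iprod (\<lambda>n. \<integral>x. g (clamp (\<theta> n w)) x \<partial>label_law) = iprod (\<lambda>n. G (clamp (\<theta> n w)))" for w
      by (simp add: G_eq clamp)
    moreover have "(\<integral>w. iprod (\<lambda>n. G (clamp (\<theta> n w))) \<partial>M) = (\<integral>w. iprod (\<lambda>n. \<gamma> (\<theta> n w)) \<partial>M)"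
    proof (rule integral_cong_AE)
      show "AE w in M. iprod (\<lambda>n. G (clamp (\<theta> n w))) = iprod (\<lambda>n. \<gamma> (\<theta> n w))"
        using AE_\<theta>_range by eventually_elim (simp add: clamp_def \<gamma>_def)
      have [measurable]: "G \<in> borel_measurable borel"
        unfolding G_def by measurable
      show "(\<lambda>w. iprod (\<lambda>n. G (clamp (\<theta> n w)))) \<in> borel_measurable M"
        by measurable
    qed measurable
    ultimately show ?thesis
      by simp
  qed
  also have "\<dots> = (\<beta> / (\<beta> + stable_mass \<sigma> (\<lambda>t. 1 - \<gamma> t))) powr (c + 1)"
    by (rule sbsp_series_iprod[OF prob_space_axioms series \<sigma>(1) \<beta> c _ \<gamma>01 \<gamma>_cont \<gamma>_int]) measurable
  finally show "(\<integral>w. iprod (\<lambda>n. unit_weight D0 D1 j u v (\<lambda>d. z d (\<omega> n w)) (\<lambda>d. A d n w)) \<partial>M)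
      = (\<beta> / (\<beta> + (\<psi> + (1 - u) * \<rho> - v * seen_mass z))) powr (c + 1)"
    unfolding mass .
qed

section \<open>Observed and new units, and their finiteness\<close>

definition seen :: "'a \<Rightarrow> nat set" where
  "seen w = {n. \<exists>d\<in>{1..D0}. 0 < A d n w}"

definition fresh :: "'a \<Rightarrow> nat set" where
  "fresh w = {n. (\<Sum>d=1..D0. A d n w) = 0 \<and> (\<Sum>d=1..D1. A (D0 + d) n w) = j}"

lemma seen_iff: "n \<in> seen w \<longleftrightarrow> (\<Sum>d=1..D0. A d n w) \<noteq> 0"
  by (auto simp: seen_def)

lemma measurable_card_seen [measurable]: "(\<lambda>w. card (seen w)) \<in> M \<rightarrow>\<^sub>M count_space UNIV"
  unfolding seen_def by (rule measurable_card_nat_set) measurable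

lemma measurable_card_fresh [measurable]: "(\<lambda>w. card (fresh w)) \<in> M \<rightarrow>\<^sub>M count_space UNIV"
  unfolding fresh_def by (rule measurable_card_nat_set) measurable

lemma unit_weight_seen:
  "n \<in> seen w \<Longrightarrow> unit_weight D0 D1 j u v z (\<lambda>d. A d n w) = v * (\<Prod>d=1..D0. z d ^ A d n w)"
  by (simp only: unit_weight_def seen_iff if_False)

lemma unit_weight_fresh: "n \<in> fresh w \<Longrightarrow> unit_weight D0 D1 j u v z (\<lambda>d. A d n w) = u"
  by (simp add: unit_weight_def fresh_def)

lemma unit_weight_other:
  "n \<notin> seen w \<Longrightarrow> n \<notin> fresh w \<Longrightarrow> unit_weight D0 D1 j u v z (\<lambda>d. A d n w) = 1"
  unfolding seen_iff fresh_def unit_weight_def by auto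

lemma iprod_unit_weight_finite:
  assumes "finite (seen w)" "finite (fresh w)"
  shows "iprod (\<lambda>n. unit_weight D0 D1 j u v (\<lambda>d. z d (\<omega> n w)) (\<lambda>d. A d n w))
    = u ^ card (fresh w) * v ^ card (seen w) * (\<Prod>n\<in>seen w. \<Prod>d=1..D0. z d (\<omega> n w) ^ A d n w)"
proof -
  let ?f = "\<lambda>n. unit_weight D0 D1 j u v (\<lambda>d. z d (\<omega> n w)) (\<lambda>d. A d n w)"
  have "iprod ?f = (\<Prod>n\<in>fresh w \<union> seen w. ?f n)"
    using assms by (intro iprod_eq_prod) (auto simp: unit_weight_other)
  also have "\<dots> = (\<Prod>n\<in>fresh w. ?f n) * (\<Prod>n\<in>seen w. ?f n)"
    using assms by (intro prod.union_disjoint) (auto simp: fresh_def seen_iff)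
  also have "(\<Prod>n\<in>fresh w. ?f n) = (\<Prod>n\<in>fresh w. u)"
    by (intro prod.cong refl unit_weight_fresh)
  also have "(\<Prod>n\<in>seen w. ?f n) = (\<Prod>n\<in>seen w. v * (\<Prod>d=1..D0. z d (\<omega> n w) ^ A d n w))"
    by (intro prod.cong refl unit_weight_seen)
  finally show ?thesis
    by (simp add: prod.distrib)
qed

lemma iprod_unit_weight_infinite:
  assumes "infinite (seen w) \<or> infinite (fresh w)" and z: "\<And>d x. z d x \<in> {0..1}"
    and u: "0 \<le> u" "u < 1" and v: "0 \<le> v" "v < 1"
  shows "iprod (\<lambda>n. unit_weight D0 D1 j u v (\<lambda>d. z d (\<omega> n w)) (\<lambda>d. A d n w)) = 0"
proof -
  let ?f = "\<lambda>n. unit_weight D0 D1 j u v (\<lambda>d. z d (\<omega> n w)) (\<lambda>d. A d n w)"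
  have f01: "?f n \<in> {0..1}" for n
    using u v z by (intro unit_weight_in_unit_interval) auto
  have "?f n \<le> v" if "n \<in> seen w" for n
  proof -
    have "(\<Prod>d=1..D0. z d (\<omega> n w) ^ A d n w) \<in> {0..1}"
      using z by (intro prod_in_unit_interval) (auto simp: power_le_one)
    moreover have "?f n = v * (\<Prod>d=1..D0. z d (\<omega> n w) ^ A d n w)"
      using that by (rule unit_weight_seen)
    ultimately show ?thesis
      using v by (simp add: mult_left_le)
  qed
  moreover have "?f n \<le> u" if "n \<in> fresh w" for n
    using unit_weight_fresh[OF that] by simp
  ultimately show ?thesis
    using assms(1) iprod_infinite_eq_0[of ?f, OF f01] u v by blast
qed

lemma rho_pos: "0 < \<rho>"
proof -
  have "((real j + r * real D1 - 1) gchoose j) = pochhammer (r * real D1) j / fact j"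
    unfolding gbinomial_pochhammer' by (rule arg_cong2[where f = "\<lambda>u v. pochhammer u j / v"]) simp_all
  moreover have "0 < pochhammer (r * real D1) j"
    using r D1 by (intro pochhammer_pos) auto
  moreover have "0 < Beta (r * real (D0 + D1) + 1) (real j - \<sigma>)"
  proof -
    have "0 < r * real (D0 + D1) + 1" "0 < real j - \<sigma>"
      using r \<sigma> j by (auto intro: add_nonneg_pos)
    then show ?thesis
      unfolding Beta_def by (intro divide_pos_pos mult_pos_pos Gamma_real_pos) auto
  qed
  ultimately show ?thesis
    using \<sigma> by (simp add: rho_def)
qed

text \<open>At \<open>z = 1\<close> the upper bound of \<open>seen_mass\<close> is attained, so the
  generating function tends to 1 as \<open>u\<close> and \<open>v\<close> do;
  \<open>AE_finite\<close> rests on this.\<close>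

lemma seen_mass_1: "seen_mass (\<lambda>_ _. 1) = \<psi>"
proof -
  interpret label: prob_space label_law
    by (rule prob_space_label_law)
  have e: "0 < r * real D0"
    using r D0 by simp
  have "seen_mass (\<lambda>_ _. 1) = stable_mass \<sigma> (\<lambda>t. 1 - (1 - t) powr (r * real D0))"
    unfolding seen_mass_def stable_mass_def
  proof (intro set_lebesgue_integral_cong allI impI)
    fix t :: real assume "t \<in> {0<..<1}"
    then have "(\<integral>x. (\<Prod>d=1..D0. ((1 - t) / (1 - t * 1)) powr r) \<partial>label_law) = (\<integral>x. 1 \<partial>label_law)"
      by simp
    also have "\<dots> = 1"
      by (simp only: lebesgue_integral_const label.prob_space) simp
    finally show "((\<integral>x. (\<Prod>d=1..D0. ((1 - t) / (1 - t * 1)) powr r) \<partial>label_law) - (1 - t) powr (r * real D0)) * stable_rate \<sigma> t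
        = (1 - (1 - t) powr (r * real D0)) * stable_rate \<sigma> t"
      by simp
  qed simp
  then show ?thesis
    using stable_mass_observed(2)[OF \<sigma> e] by (simp add: psi_def)
qed

lemma psi_nonneg: "0 \<le> \<psi>"
  using joint_pgf(2)[of "\<lambda>_ _. 1" 1 1] by (simp add: seen_mass_1)

text \<open>For \<open>z = 1\<close> and \<open>u = v < 1\<close> the product vanishes unless both
  sets are finite, so the generating function is a lower bound for the probability of finiteness.
  Its value tends to 1 along \<open>u k\<close>.\<close>

lemma AE_finite: "AE w in M. finite (seen w) \<and> finite (fresh w)"
proof -
  let ?good = "{w \<in> space M. finite (seen w) \<and> finite (fresh w)}"
  have [measurable]: "?good \<in> sets M"
    unfolding finite_nat_set_iff_bounded seen_def fresh_def Ball_def mem_Collect_eq by measurable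
  define u where "u k = 1 - 1 / real (Suc (Suc k))" for k
  have u: "0 < u k" "u k < 1" for k
    by (auto simp: u_def)
  have "(\<lambda>k. u k) \<longlonglongrightarrow> 1 - 0"
    unfolding u_def by (intro tendsto_intros LIMSEQ_Suc lim_1_over_n)
  then have u_lim: "u \<longlonglongrightarrow> 1"
    by simp
  have bound: "(\<beta> / (\<beta> + (\<psi> + (1 - u k) * \<rho> - u k * \<psi>))) powr (c + 1) \<le> prob ?good" for k
  proof -
    let ?f = "\<lambda>w n. unit_weight D0 D1 j (u k) (u k) (\<lambda>d. 1) (\<lambda>d. A d n w)"
    have f01: "?f w n \<in> {0..1}" for w n
      using u[of k] by (intro unit_weight_in_unit_interval) auto
    have ip: "iprod (?f w) \<in> {0..1}" for w
      by (rule iprod_in_unit_interval[OF f01])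
    have "(\<beta> / (\<beta> + (\<psi> + (1 - u k) * \<rho> - u k * \<psi>))) powr (c + 1) = (\<integral>w. iprod (?f w) \<partial>M)"
      using joint_pgf(1)[of "\<lambda>_ _. 1" "u k" "u k"] u[of k] by (simp add: seen_mass_1)
    also have "\<dots> \<le> (\<integral>w. indicator ?good w \<partial>M)"
    proof (rule integral_mono')
      show "integrable M (indicator ?good :: 'a \<Rightarrow> real)"
        by (intro integrable_real_indicator) (auto simp: emeasure_eq_measure)
      fix w assume w: "w \<in> space M"
      show "iprod (?f w) \<le> indicator ?good w"
        using iprod_unit_weight_infinite[of w "\<lambda>_ _. 1" "u k" "u k"] u[of k] ip[of w] w by (auto simp: indicator_def)
      show "0 \<le> (indicator ?good w :: real)"
        by simp
    qed
    also have "\<dots> = prob ?good"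
      by simp
    finally show ?thesis .
  qed
  have "(\<lambda>k. (\<beta> / (\<beta> + (\<psi> + (1 - u k) * \<rho> - u k * \<psi>))) powr (c + 1))
      \<longlonglongrightarrow> (\<beta> / (\<beta> + (\<psi> + (1 - 1) * \<rho> - 1 * \<psi>))) powr (c + 1)"
    using \<beta> by (intro tendsto_intros u_lim) auto
  then have "(\<lambda>k. (\<beta> / (\<beta> + (\<psi> + (1 - u k) * \<rho> - u k * \<psi>))) powr (c + 1)) \<longlonglongrightarrow> 1"
    using \<beta> by simp
  then have "1 \<le> prob ?good"
    using bound by (intro LIMSEQ_le_const2) auto
  then have "prob ?good = 1"
    using prob_le_1[of ?good] by simp
  then have "AE w in M. w \<in> ?good"
    by (subst (asm) prob_eq_1) auto
  then show ?thesis
    by eventually_elim simp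
qed

text \<open>Indices are pairs of a day and a label set. An infinite mass would be read as 0, but by
  \<open>AE_finite\<close> the masses on observed days are almost surely finite.\<close>

definition day_count :: "nat \<times> real set \<Rightarrow> 'a \<Rightarrow> nat" where
  "day_count i w = nat \<lfloor>enn2real (emeasure (nbp_day \<omega> A (fst i) w) (snd i))\<rfloor>"

abbreviation "day_sets \<equiv> {1..D0} \<times> sets label_law"

lemma emeasure_nbp_day:
  assumes "w \<in> space M" "B \<in> sets label_law"
  shows "emeasure (nbp_day \<omega> A d w) B = (\<Sum>n. of_nat (A d n w) * indicator B (\<omega> n w))"
  unfolding nbp_day_def using assms measurable_space[OF \<omega>_measurable]
  by (intro emeasure_atomic_measure) auto

lemma borel_measurable_emeasure_nbp_day:
  assumes "1 \<le> d" "B \<in> sets label_law"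
  shows "(\<lambda>w. emeasure (nbp_day \<omega> A d w) B) \<in> borel_measurable M"
proof -
  note [measurable] = A_measurable[OF assms(1)] assms(2)
  have "(\<lambda>w. \<Sum>n. of_nat (A d n w) * indicator B (\<omega> n w) :: ennreal) \<in> borel_measurable M"
    by measurable
  then show ?thesis
    by (rule measurable_cong[THEN iffD2, rotated]) (simp add: emeasure_nbp_day assms)
qed

lemma measurable_day_count:
  assumes "i \<in> day_sets"
  shows "day_count i \<in> M \<rightarrow>\<^sub>M count_space UNIV"
  unfolding day_count_def using borel_measurable_emeasure_nbp_day[of "fst i" "snd i"] assms by auto

lemma emeasure_nbp_day_finite:
  assumes w: "w \<in> space M" and fin: "finite (seen w)" and i: "i \<in> day_sets"
  shows "emeasure (nbp_day \<omega> A (fst i) w) (snd i) = of_nat (day_count i w)"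
    and "day_count i w = (\<Sum>n\<in>seen w. A (fst i) n w * of_bool (\<omega> n w \<in> snd i))"
proof -
  let ?S = "\<Sum>n\<in>seen w. A (fst i) n w * of_bool (\<omega> n w \<in> snd i)"
  have "emeasure (nbp_day \<omega> A (fst i) w) (snd i) = (\<Sum>n. of_nat (A (fst i) n w) * indicator (snd i) (\<omega> n w))"
    using w i by (intro emeasure_nbp_day) auto
  also have "\<dots> = (\<Sum>n\<in>seen w. of_nat (A (fst i) n w) * indicator (snd i) (\<omega> n w))"
    using fin i by (intro suminf_finite) (auto simp: seen_def)
  also have "\<dots> = of_nat ?S"
    by (auto simp: indicator_def intro!: sum.cong)
  finally have *: "emeasure (nbp_day \<omega> A (fst i) w) (snd i) = of_nat ?S" .
  then show "day_count i w = ?S"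
    unfolding day_count_def by (simp del: of_nat_sum of_nat_mult flip: ennreal_of_nat_eq_real_of_nat)
  with * show "emeasure (nbp_day \<omega> A (fst i) w) (snd i) = of_nat (day_count i w)"
    by simp
qed

text \<open>To produce powers of the masses of label sets, a count on day \<open>d\<close> at label
  \<open>x\<close> receives every \<open>z i\<close> whose pair has day \<open>d\<close> and a set
  containing \<open>x\<close>. The sets may overlap; exchanging the products collects the
  exponents.\<close>

lemma prod_power_day_count:
  fixes z :: "nat \<times> real set \<Rightarrow> real"
  assumes w: "w \<in> space M" and fin: "finite (seen w)" and I: "finite I" "I \<subseteq> day_sets"
  shows "(\<Prod>n\<in>seen w. \<Prod>d=1..D0. (\<Prod>i\<in>I. if fst i = d \<and> \<omega> n w \<in> snd i then z i else 1) ^ A d n w)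
    = (\<Prod>i\<in>I. z i ^ day_count i w)"
proof -
  have "(\<Prod>d=1..D0. (\<Prod>i\<in>I. if fst i = d \<and> \<omega> n w \<in> snd i then z i else 1) ^ A d n w)
      = (\<Prod>i\<in>I. z i ^ (A (fst i) n w * of_bool (\<omega> n w \<in> snd i)))" for n
  proof -
    have "(\<Prod>d=1..D0. (\<Prod>i\<in>I. if fst i = d \<and> \<omega> n w \<in> snd i then z i else 1) ^ A d n w)
        = (\<Prod>d=1..D0. \<Prod>i\<in>I. (if fst i = d then z i ^ (A d n w * of_bool (\<omega> n w \<in> snd i)) else 1))"
      unfolding prod_power_distrib by (intro prod.cong) auto
    also have "\<dots> = (\<Prod>i\<in>I. \<Prod>d=1..D0. (if fst i = d then z i ^ (A d n w * of_bool (\<omega> n w \<in> snd i)) else 1))"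
      by (rule prod.swap)
    also have "\<dots> = (\<Prod>i\<in>I. z i ^ (A (fst i) n w * of_bool (\<omega> n w \<in> snd i)))"
      using I by (intro prod.cong refl) (auto simp: prod.delta')
    finally show ?thesis .
  qed
  then have "(\<Prod>n\<in>seen w. \<Prod>d=1..D0. (\<Prod>i\<in>I. if fst i = d \<and> \<omega> n w \<in> snd i then z i else 1) ^ A d n w)
      = (\<Prod>i\<in>I. \<Prod>n\<in>seen w. z i ^ (A (fst i) n w * of_bool (\<omega> n w \<in> snd i)))"
    by (simp only: prod.swap[of _ I])
  also have "\<dots> = (\<Prod>i\<in>I. z i ^ day_count i w)"
    using emeasure_nbp_day_finite(2)[OF w fin] I by (intro prod.cong refl) (auto simp: power_sum)
  finally show ?thesis .
qed

lemma p_bounds: "0 < p" "p < 1"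
proof -
  have "0 < \<beta> + \<psi> + \<rho>"
    using \<beta> psi_nonneg rho_pos by linarith
  then show "0 < p" "p < 1"
    using \<beta> psi_nonneg rho_pos by (auto simp: p_new_def)
qed

text \<open>Both sides are values of the one generating function \<open>E\<close>: the left at
  \<open>u\<close> and \<open>v = 1\<close>, the right at \<open>u = 1\<close> and
  \<open>v = q\<close>, where \<open>q\<close> to the number of observed units absorbs the random
  size parameter and \<open>q powr (c + 1)\<close> is the rest.\<close>

lemma pgf_identity:
  assumes I: "finite I" "I \<subseteq> day_sets" and z: "\<And>i. 0 < z i \<and> z i < 1" and u: "0 < u" "u < 1"
  shows "(\<integral>w. (\<Prod>i\<in>I. z i ^ day_count i w) * u ^ card (fresh w) \<partial>M)
    = (\<integral>w. (\<Prod>i\<in>I. z i ^ day_count i w) * ((1 - p) / (1 - p * u)) powr (real (card (seen w)) + c + 1) \<partial>M)"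
proof -
  define zz where "zz d x = (\<Prod>i\<in>I. if fst i = d \<and> x \<in> snd i then z i else 1)" for d x
  define q where "q = (1 - p) / (1 - p * u)"
  have zz_meas: "zz d \<in> borel_measurable label_law" for d
    unfolding zz_def
  proof (intro borel_measurable_prod)
    fix i assume "i \<in> I"
    then have [measurable]: "snd i \<in> sets label_law"
      using I by auto
    show "(\<lambda>x. if fst i = d \<and> x \<in> snd i then z i else 1) \<in> borel_measurable label_law"
      by measurable
  qed
  have zz01: "zz d x \<in> {0..1}" for d x
    unfolding zz_def using z by (intro prod_in_unit_interval) (auto simp: less_imp_le)
  have "p * u < 1"
    using p_bounds u by (metis less_trans mult.commute mult_less_cancel_right1 mult_strict_mono' not_less_iff_gr_or_eq less_eq_real_def mult_1)
  then have q: "0 < q" "q \<le> 1"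
    using p_bounds u by (auto simp: q_def divide_le_eq mult_left_le)
  have day_meas[measurable]: "(\<lambda>w. \<Prod>i\<in>I. z i ^ day_count i w) \<in> borel_measurable M"
    using I by (intro borel_measurable_prod measurable_compose[OF measurable_day_count, of _ "\<lambda>k. _ ^ k"]) auto
  have E: "(\<integral>w. u' ^ card (fresh w) * v ^ card (seen w) * (\<Prod>i\<in>I. z i ^ day_count i w) \<partial>M)
      = (\<beta> / (\<beta> + (\<psi> + (1 - u') * \<rho> - v * seen_mass zz))) powr (c + 1)"
    if "0 < u'" "u' \<le> 1" "0 \<le> v" "v \<le> 1" for u' v
  proof -
    have "(\<integral>w. iprod (\<lambda>n. unit_weight D0 D1 j u' v (\<lambda>d. zz d (\<omega> n w)) (\<lambda>d. A d n w)) \<partial>M)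
        = (\<integral>w. u' ^ card (fresh w) * v ^ card (seen w) * (\<Prod>i\<in>I. z i ^ day_count i w) \<partial>M)"
    proof (rule integral_cong_AE)
      show "AE w in M. iprod (\<lambda>n. unit_weight D0 D1 j u' v (\<lambda>d. zz d (\<omega> n w)) (\<lambda>d. A d n w))
          = u' ^ card (fresh w) * v ^ card (seen w) * (\<Prod>i\<in>I. z i ^ day_count i w)"
        using AE_finite AE_space
      proof eventually_elim
        case (elim w)
        then show ?case
          using prod_power_day_count[OF elim(2) _ I, of z]
          by (subst iprod_unit_weight_finite) (auto simp: zz_def)
      qed
      have "(\<lambda>w. unit_weight D0 D1 j u' v (\<lambda>d. zz d (\<omega> n w)) (\<lambda>d. A d n w)) \<in> borel_measurable M" for n
      proof -
        note [measurable] = measurable_compose[OF \<omega>_measurable zz_meas]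
        show ?thesis
          unfolding unit_weight_def by measurable
      qed
      then show "(\<lambda>w. iprod (\<lambda>n. unit_weight D0 D1 j u' v (\<lambda>d. zz d (\<omega> n w)) (\<lambda>d. A d n w))) \<in> borel_measurable M"
        by (rule borel_measurable_iprod)
    qed measurable
    then show ?thesis
      using joint_pgf(1)[OF zz_meas zz01 that] by simp
  qed
  have K: "0 \<le> seen_mass zz" "seen_mass zz \<le> \<psi>"
    using joint_pgf(2,3)[OF zz_meas zz01, of 1 1] by auto
  have "(\<integral>w. (\<Prod>i\<in>I. z i ^ day_count i w) * q powr (real (card (seen w)) + c + 1) \<partial>M)
      = (\<integral>w. q powr (c + 1) * (1 ^ card (fresh w) * q ^ card (seen w) * (\<Prod>i\<in>I. z i ^ day_count i w)) \<partial>M)"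
    using q by (intro Bochner_Integration.integral_cong refl) (simp add: powr_add powr_realpow mult_ac)
  also have "\<dots> = q powr (c + 1) * (\<beta> / (\<beta> + (\<psi> + (1 - 1) * \<rho> - q * seen_mass zz))) powr (c + 1)"
    using E[of 1 q] q by simp
  also have "\<dots> = (q * (\<beta> / (\<beta> + (\<psi> - q * seen_mass zz)))) powr (c + 1)"
  proof -
    have "q * seen_mass zz \<le> 1 * \<psi>"
      using q K by (intro mult_mono) auto
    then have "0 \<le> \<beta> / (\<beta> + (\<psi> - q * seen_mass zz))"
      using \<beta> by (intro divide_nonneg_nonneg) auto
    then show ?thesis
      using q by (subst powr_mult) auto
  qed
  \<comment> \<open>With \<open>T = \<beta> + \<psi> + \<rho> * (1 - u)\<close> the definition of
    \<open>p\<close> gives \<open>q * T = \<beta> + \<psi>\<close>. Hence \<open>q\<close> factors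
    out of the denominator and cancels against the prefactor.\<close>
  also have "q * (\<beta> / (\<beta> + (\<psi> - q * seen_mass zz))) = \<beta> / (\<beta> + (\<psi> + (1 - u) * \<rho> - seen_mass zz))"
  proof -
    have bp: "0 < \<beta> + \<psi>" "0 < \<beta> + \<psi> + \<rho>"
      using \<beta> psi_nonneg rho_pos by linarith+
    have "q = (\<beta> + \<psi>) / (\<beta> + \<psi> + \<rho> * (1 - u))"
    proof -
      have "1 - p = (\<beta> + \<psi>) / (\<beta> + \<psi> + \<rho>)" "1 - p * u = (\<beta> + \<psi> + \<rho> * (1 - u)) / (\<beta> + \<psi> + \<rho>)"
        using bp by (simp_all add: p_new_def field_simps)
      then show ?thesis
        using bp by (simp add: q_def)
    qed
    moreover define T where "T = \<beta> + \<psi> + \<rho> * (1 - u)"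
    moreover have "0 < \<rho> * (1 - u)"
      using rho_pos u by simp
    then have T: "0 < T" "seen_mass zz < T"
      using bp K \<beta> unfolding T_def by linarith+
    ultimately have qT: "q * T = \<beta> + \<psi>"
      by simp
    have "\<beta> + (\<psi> - q * seen_mass zz) = q * (T - seen_mass zz)"
      using qT by (simp add: algebra_simps)
    then have "q * (\<beta> / (\<beta> + (\<psi> - q * seen_mass zz))) = \<beta> / (T - seen_mass zz)"
      using q T by simp
    then show ?thesis
      by (simp add: T_def algebra_simps)
  qed
  also have "(\<beta> / (\<beta> + (\<psi> + (1 - u) * \<rho> - seen_mass zz))) powr (c + 1)
      = (\<integral>w. (\<Prod>i\<in>I. z i ^ day_count i w) * u ^ card (fresh w) \<partial>M)"
    using E[of u 1] u by (simp add: mult.commute)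
  finally show ?thesis
    unfolding q_def ..
qed

end

section \<open>The conditional law of the number of new units\<close>

text \<open>Once \<open>1 / m\<close> is below every gap, no two of the points share a bin; the
  points are nonnegative, so \<open>nat\<close> loses nothing.\<close>

lemma eventually_inj_on_floor_multiples:
  fixes O' :: "real set"
  assumes "finite O'" "O' \<subseteq> {0..1}"
  shows "\<forall>\<^sub>F m in sequentially. inj_on (\<lambda>x. nat \<lfloor>real m * x\<rfloor>) O'"
proof -
  have "\<forall>\<^sub>F m in sequentially. x \<noteq> y \<longrightarrow> nat \<lfloor>real m * x\<rfloor> \<noteq> nat \<lfloor>real m * y\<rfloor>"
    if "x \<in> O'" "y \<in> O'" for x y
  proof (cases "x = y")
    case False
    obtain N where N: "1 / \<bar>x - y\<bar> < real N"
      using reals_Archimedean2 by blast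
    have "nat \<lfloor>real m * x\<rfloor> \<noteq> nat \<lfloor>real m * y\<rfloor>" if "m \<ge> N" for m
    proof
      assume "nat \<lfloor>real m * x\<rfloor> = nat \<lfloor>real m * y\<rfloor>"
      moreover have "0 \<le> real m * x" "0 \<le> real m * y"
        using \<open>x \<in> O'\<close> \<open>y \<in> O'\<close> assms(2) by auto
      ultimately have "\<lfloor>real m * x\<rfloor> = \<lfloor>real m * y\<rfloor>"
        by (simp add: eq_nat_nat_iff)
      then have "\<bar>real m * x - real m * y\<bar> < 1"
        by linarith
      moreover have "1 < real N * \<bar>x - y\<bar>"
        using N False by (simp add: divide_less_eq)
      moreover have "real N * \<bar>x - y\<bar> \<le> real m * \<bar>x - y\<bar>"
        using that by (intro mult_right_mono) auto
      moreover have "real m * \<bar>x - y\<bar> = \<bar>real m * x - real m * y\<bar>"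
        by (simp add: abs_mult flip: right_diff_distrib)
      ultimately show False
        by linarith
    qed
    then show ?thesis
      by (auto simp: eventually_sequentially)
  qed simp
  then have "\<forall>\<^sub>F m in sequentially. \<forall>x\<in>O'. \<forall>y\<in>O'. x \<noteq> y \<longrightarrow> nat \<lfloor>real m * x\<rfloor> \<noteq> nat \<lfloor>real m * y\<rfloor>"
    using assms(1) by (intro eventually_ball_finite ballI) auto
  then show ?thesis
    by eventually_elim (auto simp: inj_on_def)
qed

lemma emeasure_distr_density:
  assumes [measurable]: "f \<in> borel_measurable M" "g \<in> M \<rightarrow>\<^sub>M N" "Q \<in> sets N"
  shows "emeasure (distr (density M f) N g) Q = (\<integral>\<^sup>+w. f w * indicator (g -` Q \<inter> space M) w \<partial>M)"
  by (simp add: emeasure_distr emeasure_density)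

context sbsp_prediction
begin

lemma borel_measurable_indicator_card_fresh [measurable]:
  "(\<lambda>w. indicator C (card (fresh w)) :: real) \<in> borel_measurable M"
  by (rule measurable_compose[OF measurable_card_fresh]) simp

lemma borel_measurable_pmf_card_seen [measurable]:
  "(\<lambda>w. pmf (negbin_pmf (real (card (seen w)) + c + 1) p) k) \<in> borel_measurable M"
  by (rule measurable_compose[OF measurable_card_seen, of "\<lambda>n. pmf (negbin_pmf (real n + c + 1) p) k"]) simp

text \<open>Comparison of the coefficients of \<open>u ^ k\<close> in \<open>pgf_identity\<close>;
  on the right the power of \<open>(1 - p) / (1 - p * u)\<close> is expanded as the negative
  binomial generating function for each outcome.\<close>

lemma day_count_weights:
  assumes I: "finite I" "I \<subseteq> day_sets" and z: "\<And>i. 0 < z i \<and> z i < 1"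
  shows "(\<integral>w. indicator {k} (card (fresh w)) * (\<Prod>i\<in>I. z i ^ day_count i w) \<partial>M)
    = (\<integral>w. pmf (negbin_pmf (real (card (seen w)) + c + 1) p) k * (\<Prod>i\<in>I. z i ^ day_count i w) \<partial>M)"
proof -
  let ?W = "\<lambda>w. \<Prod>i\<in>I. z i ^ day_count i w"
  let ?q = "\<lambda>k w. pmf (negbin_pmf (real (card (seen w)) + c + 1) p) k"
  have [measurable]: "?W \<in> borel_measurable M"
    using I by (intro borel_measurable_prod measurable_compose[OF measurable_day_count, of _ "\<lambda>k. _ ^ k"]) auto
  have W01: "?W w \<in> {0..1}" for w
    using z by (intro prod_in_unit_interval) (auto simp: less_imp_le power_le_one)
  have W_int: "integrable M ?W"
    using W01 by (intro integrable_const_bound[where B = 1]) auto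
  have bounds: "0 \<le> ?W w * y" "?W w * y \<le> 1" if "0 \<le> y" "y \<le> 1" for w and y :: real
    using W01[of w] that by (auto intro: mult_le_one)
  have unit_int: "\<bar>\<integral>w. ?W w * y w \<partial>M\<bar> \<le> 1" "integrable M (\<lambda>w. ?W w * y w)"
    if [measurable]: "y \<in> borel_measurable M" and y: "\<And>w. 0 \<le> y w \<and> y w \<le> 1" for y
  proof -
    show int: "integrable M (\<lambda>w. ?W w * y w)"
    proof (rule integrable_const_bound[where B = 1])
      show "AE w in M. norm (?W w * y w) \<le> 1"
        using bounds y by (intro AE_I2) (simp add: abs_of_nonneg)
    qed measurable
    have "0 \<le> (\<integral>w. ?W w * y w \<partial>M)"
      using bounds y by (intro integral_nonneg_AE AE_I2) auto
    moreover have "(\<integral>w. ?W w * y w \<partial>M) \<le> 1"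
      using bounds y by (intro integral_le_const int AE_I2) auto
    ultimately show "\<bar>\<integral>w. ?W w * y w \<partial>M\<bar> \<le> 1"
      by simp
  qed
  have "(\<integral>w. ?W w * indicator {k} (card (fresh w)) \<partial>M) = (\<integral>w. ?W w * ?q k w \<partial>M)"
  proof (rule power_series_coeffs_unique[where C = 1])
    show "\<bar>\<integral>w. ?W w * indicator {k} (card (fresh w)) \<partial>M\<bar> \<le> 1" for k
      by (rule unit_int) (auto simp: indicator_def)
    show "\<bar>\<integral>w. ?W w * ?q k w \<partial>M\<bar> \<le> 1" for k
      by (rule unit_int) (auto simp: pmf_le_1)
    fix u :: real assume u: "0 < u" "u < 1"
    show "(\<lambda>k. (\<integral>w. ?W w * indicator {k} (card (fresh w)) \<partial>M) * u ^ k) sums (\<integral>w. ?W w * u ^ card (fresh w) \<partial>M)"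
      using W_int u by (intro sums_integral_nat_fibres) (auto simp: power_le_one)
    show "(\<lambda>k. (\<integral>w. ?W w * ?q k w \<partial>M) * u ^ k) sums (\<integral>w. ?W w * u ^ card (fresh w) \<partial>M)"
    proof -
      have q_sums: "(\<lambda>k. ?q k w * u ^ k) sums ((1 - p) / (1 - p * u)) powr (real (card (seen w)) + c + 1)" for w
      proof -
        let ?n = "real (card (seen w)) + c + 1"
        have "(\<lambda>k. measure_pmf.expectation (negbin_pmf ?n p) (\<lambda>x. 1 * indicator {k} x) * u ^ k)
            sums measure_pmf.expectation (negbin_pmf ?n p) (\<lambda>k. 1 * u ^ k)"
          using u by (intro sums_integral_nat_fibres[where X = "\<lambda>x. x"]) (auto simp: power_le_one)
        moreover have "measure_pmf.expectation (negbin_pmf ?n p) (\<lambda>k. u ^ k) = ((1 - p) / (1 - p * u)) powr ?n"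
          using u c p_bounds by (intro negbin_pgf) auto
        ultimately show ?thesis
          by (simp add: measure_pmf_single)
      qed
      have s: "(\<lambda>k. ?W w * ?q k w * u ^ k) sums (?W w * ((1 - p) / (1 - p * u)) powr (real (card (seen w)) + c + 1))" for w
        using sums_mult[OF q_sums[of w], of "?W w"] by (simp only: mult.assoc)
      have n: "norm (?W w * ?q k w * u ^ k) = ?W w * ?q k w * u ^ k" for w k
        using bounds(1)[of "?q k w" w] u by (simp add: pmf_le_1)
      have "(\<lambda>k. \<integral>w. ?W w * ?q k w * u ^ k \<partial>M) sums (\<integral>w. (\<Sum>k. ?W w * ?q k w * u ^ k) \<partial>M)"
      proof (rule sums_integral)
        show "integrable M (\<lambda>w. ?W w * ?q k w * u ^ k)" for k
          using unit_int(2)[of "?q k"] by (auto simp: pmf_le_1)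
        show "AE w in M. summable (\<lambda>k. norm (?W w * ?q k w * u ^ k))"
          unfolding n using s by (auto simp: sums_iff)
        show "summable (\<lambda>k. \<integral>w. norm (?W w * ?q k w * u ^ k) \<partial>M)"
          unfolding n
        proof (rule summable_comparison_test')
          show "summable (\<lambda>k. u ^ k)"
            using u by (intro summable_geometric) auto
          show "norm (\<integral>w. ?W w * ?q k w * u ^ k \<partial>M) \<le> u ^ k" for k
            using unit_int(1)[of "?q k"] u by (simp add: abs_mult mult_left_le_one_le pmf_le_1)
        qed
      qed
      then show ?thesis
        using s pgf_identity[OF I z u] by (simp add: sums_iff)
    qed
  qed
  then show ?thesis
    by (simp add: mult.commute)
qed

lemma day_count_events:
  assumes J: "finite J" "J \<subseteq> day_sets"
  shows "(\<integral>w. indicator {k} (card (fresh w)) * (\<Prod>i\<in>J. indicator (C i) (day_count i w)) \<partial>M)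
    = (\<integral>w. pmf (negbin_pmf (real (card (seen w)) + c + 1) p) k * (\<Prod>i\<in>J. indicator (C i) (day_count i w)) \<partial>M)"
proof (rule joint_pgf_determines_weights[OF _ _ measurable_day_count day_count_weights J])
  show "integrable M (\<lambda>w. indicator {k} (card (fresh w)) :: real)"
    by (intro integrable_const_bound[where B = 1]) auto
  show "integrable M (\<lambda>w. pmf (negbin_pmf (real (card (seen w)) + c + 1) p) k)"
    by (intro integrable_const_bound[where B = 1]) (auto simp: pmf_le_1)
qed auto

text \<open>All masses of all label sets on all observed days form one element of an uncountable
  product, whose measurable structure is determined by finitely many masses at a time.\<close>

abbreviation "obs_masses \<equiv> \<lambda>w. \<lambda>i\<in>day_sets. emeasure (nbp_day \<omega> A (fst i) w) (snd i)"

abbreviation "mass_space \<equiv> Pi\<^sub>M day_sets (\<lambda>_. borel :: ennreal measure)"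

lemma obs_masses_measurable [measurable]: "obs_masses \<in> M \<rightarrow>\<^sub>M mass_space"
  by (intro measurable_restrict borel_measurable_emeasure_nbp_day) auto

text \<open>An identity for all observable events with a given weight is an equality of two finite
  measures on the product space. It suffices to check cylinders, where
  \<open>day_count_events\<close> applies.\<close>

lemma distr_obs_masses:
  "distr (density M (\<lambda>w. ennreal (indicator {k} (card (fresh w))))) mass_space obs_masses
    = distr (density M (\<lambda>w. ennreal (pmf (negbin_pmf (real (card (seen w)) + c + 1) p) k))) mass_space obs_masses"
proof -
  let ?V1 = "\<lambda>w. indicator {k} (card (fresh w)) :: real"
  let ?V2 = "\<lambda>w. pmf (negbin_pmf (real (card (seen w)) + c + 1) p) k"
  have V1: "?V1 \<in> borel_measurable M"
    by measurable
  have V2: "?V2 \<in> borel_measurable M"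
    by measurable
  have cylinder: "emeasure (distr (density M (\<lambda>w. ennreal (V w))) mass_space obs_masses) (prod_emb day_sets (\<lambda>_. borel) J (Pi\<^sub>E J X))
      = ennreal (\<integral>w. V w * (\<Prod>i\<in>J. indicator {n. of_nat n \<in> X i} (day_count i w)) \<partial>M)"
    if [measurable]: "V \<in> borel_measurable M" and V: "\<And>w. 0 \<le> V w \<and> V w \<le> 1"
      and J: "finite J" "J \<subseteq> day_sets" and X: "\<And>i. i \<in> J \<Longrightarrow> X i \<in> sets borel" for V J and X :: "_ \<Rightarrow> ennreal set"
  proof -
    let ?P = "prod_emb day_sets (\<lambda>_. borel) J (Pi\<^sub>E J X)"
    let ?I = "\<lambda>w. \<Prod>i\<in>J. indicator {n. of_nat n \<in> X i} (day_count i w) :: real"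
    have [measurable]: "?P \<in> sets mass_space"
      using J X by (intro sets_PiM_I) auto
    have [measurable]: "?I \<in> borel_measurable M"
      using J by (intro borel_measurable_prod measurable_compose[OF measurable_day_count]) auto
    have I01: "?I w \<in> {0..1}" for w
      by (intro prod_in_unit_interval) (auto simp: indicator_def)
    have "emeasure (distr (density M (\<lambda>w. ennreal (V w))) mass_space obs_masses) ?P
        = (\<integral>\<^sup>+w. ennreal (V w) * indicator (obs_masses -` ?P \<inter> space M) w \<partial>M)"
      by (intro emeasure_distr_density obs_masses_measurable) measurable
    also have "\<dots> = (\<integral>\<^sup>+w. ennreal (V w * ?I w) \<partial>M)"
    proof (rule nn_integral_cong_AE)
      \<comment> \<open>Almost surely each mass is a natural number, namely
        \<open>day_count\<close>, so cylinder conditions on masses become conditions on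
        counts.\<close>
      show "AE w in M. ennreal (V w) * indicator (obs_masses -` ?P \<inter> space M) w = ennreal (V w * ?I w)"
        using AE_finite AE_space
      proof eventually_elim
        case (elim w)
        have "obs_masses w \<in> ?P \<longleftrightarrow> (\<forall>i\<in>J. emeasure (nbp_day \<omega> A (fst i) w) (snd i) \<in> X i)"
          using J(2) by (auto simp: prod_emb_def PiE_iff Ball_def)
        also have "\<dots> \<longleftrightarrow> (\<forall>i\<in>J. of_nat (day_count i w) \<in> X i)"
          using emeasure_nbp_day_finite(1)[OF elim(2)] elim(1) J(2) by (intro ball_cong refl) auto
        finally have mem: "obs_masses w \<in> ?P \<longleftrightarrow> (\<forall>i\<in>J. of_nat (day_count i w) \<in> X i)" .
        have "?I w = of_bool (\<forall>i\<in>J. of_nat (day_count i w) \<in> X i)"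
          using J(1) by (induction J) (auto simp: indicator_def)
        then have "indicator (obs_masses -` ?P \<inter> space M) w = ennreal (?I w)"
          using elim(2) mem by (simp add: indicator_def)
        then show ?case
          using V by (simp add: ennreal_mult')
      qed
    qed
    also have "\<dots> = ennreal (\<integral>w. V w * ?I w \<partial>M)"
    proof (intro nn_integral_eq_integral integrable_const_bound[where B = 1] AE_I2)
      show "norm (V w * ?I w) \<le> 1" "0 \<le> V w * ?I w" for w
        using V[of w] I01[of w] by (auto simp: abs_mult intro!: mult_le_one)
    qed measurable
    finally show ?thesis .
  qed
  show ?thesis
  proof (rule measure_eqI_PiM_infinite[where I = day_sets and M = "\<lambda>_. borel"])
    fix X :: "_ \<Rightarrow> ennreal set" and J :: "(nat \<times> real set) set"
    assume J: "finite J" "J \<subseteq> day_sets" and X: "\<And>i. i \<in> J \<Longrightarrow> X i \<in> sets borel"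
    have "0 \<le> ?V1 w \<and> ?V1 w \<le> 1" "0 \<le> ?V2 w \<and> ?V2 w \<le> 1" for w
      by (auto simp: indicator_def pmf_le_1)
    note * = cylinder[OF V1 this(1) J X] cylinder[OF V2 this(2) J X]
    show "emeasure (distr (density M (\<lambda>w. ennreal (?V1 w))) mass_space obs_masses) (prod_emb day_sets (\<lambda>_. borel) J (Pi\<^sub>E J X))
        = emeasure (distr (density M (\<lambda>w. ennreal (?V2 w))) mass_space obs_masses) (prod_emb day_sets (\<lambda>_. borel) J (Pi\<^sub>E J X))"
      using * day_count_events[OF J] by simp
  next
    have "(\<integral>\<^sup>+w. ennreal (?V1 w) \<partial>M) \<le> (\<integral>\<^sup>+w. 1 \<partial>M)"
      by (intro nn_integral_mono) (simp add: indicator_def)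
    then have "emeasure (density M (\<lambda>w. ennreal (?V1 w))) (space M) \<le> 1"
      by (simp add: emeasure_density emeasure_space_1 cong: nn_integral_cong)
    then have "finite_measure (density M (\<lambda>w. ennreal (?V1 w)))"
      by (intro finite_measureI) (auto simp: top_unique)
    then show "finite_measure (distr (density M (\<lambda>w. ennreal (?V1 w))) mass_space obs_masses)"
      by (rule finite_measure.finite_measure_distr)
        (subst measurable_cong_sets[OF sets_density refl], rule obs_masses_measurable)
  qed simp_all
qed

section \<open>The sigma-algebra generated by the observed days\<close>

abbreviation "obs_days \<equiv> \<lambda>w. \<lambda>d\<in>{1..D0}. nbp_day \<omega> A d w"

abbreviation "day_space \<equiv> Pi\<^sub>M {1..D0} (\<lambda>_. measure_algebra label_law)"

abbreviation "obs_algebra \<equiv> vimage_algebra (space M) obs_days day_space"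

lemma sets_nbp_day: "sets (nbp_day \<omega> A d w) = sets label_law"
  by (simp add: nbp_day_def atomic_measure_def)

lemma obs_days_measurableI:
  assumes "\<And>d B. d \<in> {1..D0} \<Longrightarrow> B \<in> sets label_law \<Longrightarrow> (\<lambda>w. emeasure (nbp_day \<omega> A d w) B) \<in> borel_measurable N"
  shows "obs_days \<in> N \<rightarrow>\<^sub>M day_space"
  using assms by (intro measurable_restrict measurable_measure_algebraI sets_nbp_day) auto

lemma obs_days_measurable [measurable]: "obs_days \<in> M \<rightarrow>\<^sub>M day_space"
  by (rule obs_days_measurableI) (simp add: borel_measurable_emeasure_nbp_day)

text \<open>\<open>measure_algebra\<close> is generated by the evaluations at label sets, so each
  observed day is a measurable function of its masses. Events of the days are therefore among the
  events already treated.\<close>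

lemma obs_algebra_subset: "sets obs_algebra \<subseteq> sets (vimage_algebra (space M) obs_masses mass_space)"
proof -
  let ?V = "vimage_algebra (space M) obs_masses mass_space"
  have E: "obs_masses \<in> ?V \<rightarrow>\<^sub>M mass_space"
    using measurable_space[OF obs_masses_measurable] by (intro measurable_vimage_algebra1) auto
  have "obs_days \<in> ?V \<rightarrow>\<^sub>M day_space"
  proof (rule obs_days_measurableI)
    fix d B assume dB: "d \<in> {1..D0}" "B \<in> sets label_law"
    then have "(d, B) \<in> day_sets"
      by simp
    from measurable_compose[OF E measurable_component_singleton[OF this]]
    show "(\<lambda>w. emeasure (nbp_day \<omega> A d w) B) \<in> borel_measurable ?V"
      using dB by simp
  qed
  then show ?thesis
    by (simp add: measurable_iff_sets)
qed

lemma integral_obs_event: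
  assumes F: "F \<in> sets obs_algebra"
  shows "(\<integral>w\<in>F. indicator {k} (card (fresh w)) \<partial>M)
    = (\<integral>w\<in>F. pmf (negbin_pmf (real (card (seen w)) + c + 1) p) k \<partial>M)"
proof -
  let ?V1 = "\<lambda>w. indicator {k} (card (fresh w)) :: real"
  let ?V2 = "\<lambda>w. pmf (negbin_pmf (real (card (seen w)) + c + 1) p) k"
  have V2: "?V2 \<in> borel_measurable M"
    by measurable
  have "F \<in> sets (vimage_algebra (space M) obs_masses mass_space)"
    using F obs_algebra_subset by blast
  then obtain Q where Q[measurable]: "Q \<in> sets mass_space" and F_eq: "F = obs_masses -` Q \<inter> space M"
    using measurable_space[OF obs_masses_measurable] by (subst (asm) sets_vimage_algebra2) auto
  have [measurable]: "F \<in> sets M"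
    unfolding F_eq by measurable
  have *: "emeasure (distr (density M (\<lambda>w. ennreal (V w))) mass_space obs_masses) Q = ennreal (\<integral>w\<in>F. V w \<partial>M)"
    if [measurable]: "V \<in> borel_measurable M" and V: "\<And>w. 0 \<le> V w \<and> V w \<le> 1" for V
  proof -
    have "emeasure (distr (density M (\<lambda>w. ennreal (V w))) mass_space obs_masses) Q = (\<integral>\<^sup>+w. ennreal (V w) * indicator F w \<partial>M)"
      unfolding F_eq by (intro emeasure_distr_density obs_masses_measurable Q) measurable
    also have "\<dots> = (\<integral>\<^sup>+w. ennreal (indicator F w *\<^sub>R V w) \<partial>M)"
      by (intro nn_integral_cong) (auto simp: indicator_def)
    also have "\<dots> = ennreal (\<integral>w\<in>F. V w \<partial>M)"
      unfolding set_lebesgue_integral_def using V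
      by (intro nn_integral_eq_integral integrable_const_bound[where B = 1]) (auto simp: indicator_def)
    finally show ?thesis .
  qed
  have "ennreal (\<integral>w\<in>F. ?V1 w \<partial>M) = ennreal (\<integral>w\<in>F. ?V2 w \<partial>M)"
    using *[of ?V1] *[of ?V2] distr_obs_masses[of k] by (simp add: pmf_le_1 indicator_def)
  then show ?thesis
    by (subst (asm) ennreal_inj) (auto simp: set_lebesgue_integral_def intro!: integral_nonneg_AE)
qed

text \<open>A sum of nonnegative terms is positive when one term is. The version for arbitrary label
  sets says when a bin carries mass; singletons give the observed locations.\<close>

lemma observed_units_eq:
  assumes w: "w \<in> space M"
  shows "observed_units (nbp_day \<omega> A) D0 w = (\<lambda>n. \<omega> n w) ` seen w"
    and "B \<in> sets label_law \<Longrightarrow> (\<exists>d\<in>{1..D0}. 0 < emeasure (nbp_day \<omega> A d w) B) \<longleftrightarrow> (\<exists>n\<in>seen w. \<omega> n w \<in> B)"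
proof -
  have pos: "0 < emeasure (nbp_day \<omega> A d w) B \<longleftrightarrow> (\<exists>n. 0 < A d n w \<and> \<omega> n w \<in> B)" if "B \<in> sets label_law" for d B
  proof -
    have "emeasure (nbp_day \<omega> A d w) B = 0 \<longleftrightarrow> (\<forall>n. of_nat (A d n w) * indicator B (\<omega> n w) = (0 :: ennreal))"
      unfolding emeasure_nbp_day[OF w that] by (rule suminf_eq_zero_iff) auto
    moreover have "of_nat (A d n w) * indicator B (\<omega> n w) = (0 :: ennreal) \<longleftrightarrow> \<not> (0 < A d n w \<and> \<omega> n w \<in> B)" for n
      by (simp add: indicator_def)
    ultimately show ?thesis
      unfolding zero_less_iff_neq_zero by blast
  qed
  then show *: "(\<exists>d\<in>{1..D0}. 0 < emeasure (nbp_day \<omega> A d w) B) \<longleftrightarrow> (\<exists>n\<in>seen w. \<omega> n w \<in> B)" if "B \<in> sets label_law" for B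
    using that by (auto simp: seen_def)
  have \<omega>: "\<omega> n w \<in> space label_law" for n
    using measurable_space[OF \<omega>_measurable w] .
  have "{x} \<in> sets label_law" if "x \<in> space label_law" for x
    using that by (auto simp: sets_restrict_space_iff)
  then show "observed_units (nbp_day \<omega> A) D0 w = (\<lambda>n. \<omega> n w) ` seen w"
    unfolding observed_units_def using * \<omega> by auto
qed

text \<open>The number of observed units is a function of the observed measures: it is the limit of the number
  of bins of width \<open>1 / m\<close> that carry mass.\<close>

definition bin_count :: "nat \<Rightarrow> 'a \<Rightarrow> nat" where
  "bin_count m w = (\<Sum>i\<le>m. of_bool (\<exists>d\<in>{1..D0}. 0 < emeasure (nbp_day \<omega> A d w) {x \<in> space label_law. nat \<lfloor>real m * x\<rfloor> = i}))"

definition unit_count :: "'a \<Rightarrow> nat" where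
  "unit_count w = nat \<lfloor>lim (\<lambda>m. real (bin_count m w))\<rfloor>"

lemma bin_sets: "{x \<in> space label_law. nat \<lfloor>real m * x\<rfloor> = i} \<in> sets label_law"
proof -
  have [measurable]: "(\<lambda>x. x) \<in> label_law \<rightarrow>\<^sub>M borel"
    by (intro measurable_restrict_space1) simp
  show ?thesis
    by measurable
qed

text \<open>A version of the conditional probability has to be measurable for
  \<open>obs_algebra\<close>, while \<open>card (seen w)\<close> has so far been shown measurable
  only for \<open>M\<close>.\<close>

lemma measurable_unit_count: "unit_count \<in> obs_algebra \<rightarrow>\<^sub>M count_space UNIV"
proof -
  have O: "obs_days \<in> obs_algebra \<rightarrow>\<^sub>M day_space"
    using measurable_space[OF obs_days_measurable] by (intro measurable_vimage_algebra1) auto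
  have [measurable]: "(\<lambda>w. emeasure (nbp_day \<omega> A d w) {x \<in> space label_law. nat \<lfloor>real m * x\<rfloor> = i}) \<in> borel_measurable obs_algebra"
    if d: "d \<in> {1..D0}" for d m i
  proof -
    have "(\<lambda>w. emeasure (obs_days w d) {x \<in> space label_law. nat \<lfloor>real m * x\<rfloor> = i}) \<in> borel_measurable obs_algebra"
      by (rule measurable_compose[OF measurable_compose[OF O measurable_component_singleton[OF d]]
        measurable_emeasure_measure_algebra[OF bin_sets[of m i]]])
    then show ?thesis
      by (simp only: restrict_apply' d)
  qed
  have [measurable]: "bin_count m \<in> obs_algebra \<rightarrow>\<^sub>M count_space UNIV" for m
    unfolding bin_count_def by measurable
  show ?thesis
    unfolding unit_count_def by measurable
qed

lemma unit_count_eq: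
  assumes w: "w \<in> space M" and fin: "finite (observed_units (nbp_day \<omega> A) D0 w)"
  shows "unit_count w = card (observed_units (nbp_day \<omega> A) D0 w)"
proof -
  let ?O = "observed_units (nbp_day \<omega> A) D0 w"
  have O01: "?O \<subseteq> {0..1}"
    by (auto simp: observed_units_def space_restrict_space)
  have bin: "bin_count m w = card ((\<lambda>x. nat \<lfloor>real m * x\<rfloor>) ` ?O)" for m
  proof -
    have "(\<exists>d\<in>{1..D0}. 0 < emeasure (nbp_day \<omega> A d w) {x \<in> space label_law. nat \<lfloor>real m * x\<rfloor> = i})
        \<longleftrightarrow> i \<in> (\<lambda>x. nat \<lfloor>real m * x\<rfloor>) ` ?O" for i
      unfolding observed_units_eq(2)[OF w bin_sets] observed_units_eq(1)[OF w]
      using measurable_space[OF \<omega>_measurable w] by auto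
    then have "bin_count m w = (\<Sum>i\<le>m. of_bool (i \<in> (\<lambda>x. nat \<lfloor>real m * x\<rfloor>) ` ?O))"
      unfolding bin_count_def by simp
    also have "\<dots> = card ({..m} \<inter> (\<lambda>x. nat \<lfloor>real m * x\<rfloor>) ` ?O)"
      by (simp add: Int_def)
    \<comment> \<open>A label equal to 1 falls into bin \<open>m\<close>, hence the bins 0 to
      \<open>m\<close> and not only up to \<open>m - 1\<close>.\<close>
    also have "{..m} \<inter> (\<lambda>x. nat \<lfloor>real m * x\<rfloor>) ` ?O = (\<lambda>x. nat \<lfloor>real m * x\<rfloor>) ` ?O"
    proof -
      have "nat \<lfloor>real m * x\<rfloor> \<le> m" if "x \<in> ?O" for x
      proof -
        have "real m * x \<le> real m"
          using that O01 by (intro mult_left_le) auto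
        then have "\<lfloor>real m * x\<rfloor> \<le> int m"
          by (simp add: floor_le_iff)
        then show ?thesis
          by simp
      qed
      then show ?thesis
        by auto
    qed
    finally show ?thesis .
  qed
  have "\<forall>\<^sub>F m in sequentially. real (bin_count m w) = real (card ?O)"
    using eventually_inj_on_floor_multiples[OF fin O01] by eventually_elim (simp add: bin card_image)
  then have "(\<lambda>m. real (bin_count m w)) \<longlonglongrightarrow> real (card ?O)"
    by (rule tendsto_eventually)
  then show ?thesis
    by (simp add: unit_count_def limI)
qed

lemma AE_unit_count: "AE w in M. unit_count w = card (seen w)"
  using AE_finite AE_inj_\<omega> AE_space
proof eventually_elim
  case (elim w)
  then show ?case
    using unit_count_eq[of w] observed_units_eq(1)[of w] by (simp add: card_image inj_on_subset)
qed

lemma new_units_eq: "new_units A D0 D1 j w = emeasure (count_space UNIV) (fresh w)"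
proof -
  have "new_units A D0 D1 j w = (\<Sum>n. indicator (fresh w) n)"
    unfolding new_units_def by (intro suminf_cong) (auto simp: fresh_def indicator_def)
  then show ?thesis
    using nn_integral_count_space_nat[of "indicator (fresh w)"] by simp
qed

text \<open>The candidate written with \<open>unit_count\<close> is measurable for the observed days
  and agrees almost surely with the one written with \<open>seen\<close>, for which
  \<open>integral_obs_event\<close> provides the defining integral identities.\<close>

theorem AE_cond_prob_new_units:
  "AE w in M. finite (observed_units (nbp_day \<omega> A) D0 w) \<longrightarrow>
    cond_prob_given M obs_days day_space {w \<in> space M. new_units A D0 D1 j w = of_nat k} w
    = pmf (negbin_pmf (real (card (observed_units (nbp_day \<omega> A) D0 w)) + c + 1) p) k"
proof -
  let ?E = "{w \<in> space M. new_units A D0 D1 j w = of_nat k}"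
  let ?Y = "\<lambda>w. pmf (negbin_pmf (real (unit_count w) + c + 1) p) k"
  interpret sigma_finite_subalgebra M obs_algebra
    by (rule sigma_finite_subalgebra_vimage) measurable
  have Y_meas: "?Y \<in> borel_measurable obs_algebra"
    by (rule measurable_compose[OF measurable_unit_count, of "\<lambda>n. pmf (negbin_pmf (real n + c + 1) p) k"]) simp
  have [measurable]: "?Y \<in> borel_measurable M"
    by (rule measurable_from_subalg[OF subalg Y_meas])
  have [measurable]: "?E \<in> sets M"
  proof -
    have [measurable]: "new_units A D0 D1 j \<in> borel_measurable M"
      unfolding new_units_def by measurable
    show ?thesis
      by measurable
  qed
  have AE_E: "AE w in M. indicator ?E w = (indicator {k} (card (fresh w)) :: real)"
    using AE_finite AE_space
    by eventually_elim (auto simp: new_units_eq emeasure_count_space indicator_def)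
  have "AE w in M. cond_prob_given M obs_days day_space ?E w = ?Y w"
  proof (rule real_cond_exp_charact[OF _ _ _ Y_meas])
    show "integrable M (indicator ?E :: 'a \<Rightarrow> real)"
      by (intro integrable_const_bound[where B = 1]) (auto simp: indicator_def)
    show "integrable M ?Y"
      by (intro integrable_const_bound[where B = 1]) (auto simp: pmf_le_1)
    fix F assume F: "F \<in> sets obs_algebra"
    then have [measurable]: "F \<in> sets M"
      using subalg by (auto simp: subalgebra_def)
    have "(\<integral>w\<in>F. (indicator ?E w :: real) \<partial>M) = (\<integral>w\<in>F. indicator {k} (card (fresh w)) \<partial>M)"
      using AE_E by (intro set_lebesgue_integral_cong_AE) auto
    also have "\<dots> = (\<integral>w\<in>F. pmf (negbin_pmf (real (card (seen w)) + c + 1) p) k \<partial>M)"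
      by (rule integral_obs_event[OF F])
    also have "\<dots> = (\<integral>w\<in>F. ?Y w \<partial>M)"
      using AE_unit_count by (intro set_lebesgue_integral_cong_AE) (auto elim!: eventually_mono)
    finally show "(\<integral>w\<in>F. (indicator ?E w :: real) \<partial>M) = (\<integral>w\<in>F. ?Y w \<partial>M)" .
  qed
  then show ?thesis
    using AE_space by eventually_elim (simp add: unit_count_eq)
qed

end

theorem proposition6:
  fixes M :: "'a measure"
    and \<sigma> \<beta> c r :: real
    and D0 D1 j :: nat
    and D :: "'a \<Rightarrow> real"
    and \<theta> \<omega> :: "nat \<Rightarrow> 'a \<Rightarrow> real"
    and A :: "nat \<Rightarrow> nat \<Rightarrow> 'a \<Rightarrow> nat"
    and Z :: "nat \<Rightarrow> 'a \<Rightarrow> real measure"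
    and N :: "'a \<Rightarrow> nat"
  assumes "0 < \<sigma>" "\<sigma> < 1" "0 < \<beta>" "0 < c" "0 < r"
    and "1 \<le> D0" "1 \<le> D1" "1 \<le> j"
    and "prob_space M"
    and "sbsp_series M \<beta> \<sigma> c D \<theta> \<omega>"
    and "iid_nbp M r \<theta> \<omega> A"
    and Z_def: "Z = nbp_day \<omega> A"
    and N_def: "N = (\<lambda>w. card (observed_units Z D0 w))"
  shows "\<forall>k::nat. AE w in M. finite (observed_units Z D0 w) \<and> 0 < N w \<longrightarrow>
           cond_prob_given M
             (\<lambda>w. \<lambda>d\<in>{1..D0}. Z d w) (Pi\<^sub>M {1..D0} (\<lambda>_. measure_algebra label_law))
             {w \<in> space M. new_units A D0 D1 j w = of_nat k} w
           = pmf (negbin_pmf (real (N w) + c + 1) (p_new \<beta> \<sigma> r D0 D1 j)) k"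
proof
  fix k
  interpret sbsp_prediction M \<beta> \<sigma> c r D \<theta> \<omega> A D0 D1 j
    using assms by (simp add: sbsp_prediction_def sbsp_nbp_def sbsp_nbp_axioms_def sbsp_prediction_axioms_def)
  show "AE w in M. finite (observed_units Z D0 w) \<and> 0 < N w \<longrightarrow>
           cond_prob_given M
             (\<lambda>w. \<lambda>d\<in>{1..D0}. Z d w) (Pi\<^sub>M {1..D0} (\<lambda>_. measure_algebra label_law))
             {w \<in> space M. new_units A D0 D1 j w = of_nat k} w
           = pmf (negbin_pmf (real (N w) + c + 1) (p_new \<beta> \<sigma> r D0 D1 j)) k"
    unfolding N_def Z_def using AE_cond_prob_new_units[of k] by eventually_elim blast
qed

end
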